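(* Let $M$ be a smooth $2$-dimensional manifold equipped with a Möbius structure and let $\gamma\hookrightarrow M$ be a smooth oriented curve whose normalised jerk $J_b$ is nowhere vanishing. In terms of any background metric $g_{ab}$ in the conformal class, let $\kappa$ be the function along $\gamma$ defined by $$\partial J_b+A^cJ_cU_b+2\kappa J_b=0.$$ Then the invariantly defined line subbundle $$\mathrm{span}\left(\left[\begin{array}{c}U_b\\ 2U_{[b}A_{c]}\quad\kappa\\ J_b+\frac12(A^cA_c-\kappa^2)U_b+\kappa A_b\end{array}\right]\right)$$ of the adjoint tractor bundle $\mathcal{A}|_\gamma$ is preserved by $\partial$ along $\gamma$ if and only if $$\partial\kappa+\tfrac12(A^aA_a+\kappa^2)+U^aU^b\mathrm{P}_{ab}=0 .$$
   Context: Square brackets on indices denote skew-symmetrisation, $2U_{[b}A_{c]}=U_bA_c-U_cA_b$. Indices are raised and lowered with the chosen background metric $g_{ab}$, whose Levi-Civita connection is $\nabla_a$. Möbius structure (dimension $2$): a conformal class of Riemannian metrics together with, for each metric $g_{ab}$ in the class, a symmetric tensor $\mathrm{P}_{ab}$ (the Rho-tensor), such that if $\widehat g_{ab}=\Omega^2g_{ab}$ with $\Omega>0$ smooth and $\Upsilon_a=\Omega^{-1}\nabla_a\Omega$, then $$\widehat{\mathrm{P}}_{ab}=\mathrm{P}_{ab}-\nabla_a\Upsilon_b+\Upsilon_a\Upsilon_b-\tfrac12\Upsilon^c\Upsilon_c g_{ab}.$$ Curve quantities: $U^a$ is the $g$-unit tangent vector along $\gamma$ in the direction of the orientation, $U_a=g_{ab}U^b$,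 $\partial=U^a\nabla_a$ is the directional derivative of tensors along $\gamma$, $A_a=\partial U_a$ is the acceleration, and the normalised jerk is $$J_a=\partial A_a+(A^bA_b+\mathrm{P}_{bc}U^bU^c)U_a-\mathrm{P}_{ab}U^b .$$ One has $U^aA_a=0$ and $U^aJ_a=0$, and $J_a$ is conformally invariant of weight $-1$ ($\widehat J_a=\Omega^{-1}J_a$). In dimension $2$, $\kappa$ is well-defined wherever $J_b\neq 0$. Adjoint tractor bundle: in the presence of a metric $g$ in the conformal class, a section of $\mathcal{A}$ is a quadruple $\left[\begin{array}{c}\sigma_b\\ \mu_{bc}\quad\nu\\ \rho_b\end{array}\right]$ with $\sigma_b$ and $\rho_b$ $1$-forms, $\mu_{bc}$ a $2$-form and $\nu$ a function. The quadruples for $g$ and $\widehat g=\Omega^2g$ are identified by $$\widehat\sigma_b=\sigma_b,\quad \widehat\mu_{bc}=\mu_{bc}+2\Upsilon_{[b}\sigma_{c]},\quad \widehat\nu=\nu+\Upsilon^b\sigma_b,\quad \widehat\rho_b=\rho_b+\Upsilon^a\mu_{ab}-\Upsilon_b\nu-\Upsilon^a\Upsilon_b\sigma_a+\tfrac12\Upsilon^a\Upsilon_a\sigma_b,$$ where $\sigma_b,\mu_{bc},\nu,\rho_b$ are regarded as conformally weighted of weights $2,2,0,0$ respectively (i.e. as ordinary tensors, the right-hand sides are additionally multiplied by $\Omega^2,\Omega^2,1,1$). The directional derivative along $\gamma$ induced by the adjoint tractor connection is, in terms of $g$, $$\partial\left[\begin{array}{c}\sigma_b\\ \mu_{bc}\quad\nu\\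 \rho_b\end{array}\right]=\left[\begin{array}{c}\partial\sigma_b-U^a\mu_{ab}-\nu U_b\\ \partial\mu_{bc}-2U_{[b}\rho_{c]}+2U^a\mathrm{P}_{a[b}\sigma_{c]}\quad \partial\nu+U^a\rho_a+U^a\mathrm{P}_a{}^b\sigma_b\\ \partial\rho_b-U^a\mathrm{P}_a{}^c\mu_{bc}-U^a\mathrm{P}_{ab}\nu\end{array}\right].$$ It is invariantly defined up to conformal weight. A subbundle of $\mathcal{A}|_\gamma$ is preserved by $\partial$ if, with respect to a metric in the conformal class, $\partial$ maps its smooth sections to sections of the same subbundle (this does not depend on the choice of metric). *)

theory Defs
  imports "HOL-Analysis.Analysis"
begin

subsection \<open>Smooth functions and surfaces\<close>

text \<open>For an open set \<open>S\<close> of a Euclidean space, \<open>smooth_on S f\<close> is the usual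
  \<open>C\<^sup>\<infinity>\<close> condition.\<close>

primrec n_times_differentiable_on ::
    "nat \<Rightarrow> 'a::real_normed_vector set \<Rightarrow> ('a \<Rightarrow> 'b::real_normed_vector) \<Rightarrow> bool" where
  "n_times_differentiable_on 0 S f \<longleftrightarrow> continuous_on S f"
| "n_times_differentiable_on (Suc n) S f \<longleftrightarrow>
     (\<forall>x\<in>S. f differentiable (at x)) \<and>
     (\<forall>v. n_times_differentiable_on n S (\<lambda>x. frechet_derivative f (at x) v))"

definition smooth_on :: "'a::real_normed_vector set \<Rightarrow> ('a \<Rightarrow> 'b::real_normed_vector) \<Rightarrow> bool" where
  "smooth_on S f \<longleftrightarrow> (\<forall>n. n_times_differentiable_on n S f)"

datatype 'a chart = Chart (cdom: "'a set") (coord: "'a \<Rightarrow> real^2")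

definition cinv :: "'a chart \<Rightarrow> real^2 \<Rightarrow> 'a" where
  "cinv c = inv_into (cdom c) (coord c)"

text \<open>The surface is the union of the chart domains, an open subspace of a Hausdorff
  second-countable space. The atlas need not be maximal.\<close>

definition smooth_surface :: "'a::{t2_space,second_countable_topology} chart set \<Rightarrow> bool" where
  "smooth_surface A \<longleftrightarrow>
     (\<forall>c\<in>A. open (cdom c) \<and> open (coord c ` cdom c) \<and>
        homeomorphism (cdom c) (coord c ` cdom c) (coord c) (cinv c)) \<and>
     (\<forall>c\<in>A. \<forall>d\<in>A. smooth_on (coord c ` (cdom c \<inter> cdom d)) (coord d \<circ> cinv c))"

definition surface :: "'a chart set \<Rightarrow> 'a set" where
  "surface A = (\<Union>c\<in>A. cdom c)"

definition smooth_field :: "'a chart set \<Rightarrow> ('a chart \<Rightarrow> 'a \<Rightarrow> 'b::real_normed_vector) \<Rightarrow> bool" where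
  "smooth_field A T \<longleftrightarrow> (\<forall>c\<in>A. smooth_on (coord c ` cdom c) (T c \<circ> cinv c))"

definition partial_deriv :: "'a chart \<Rightarrow> ('a \<Rightarrow> real) \<Rightarrow> 'a \<Rightarrow> 2 \<Rightarrow> real" where
  "partial_deriv c f p i = frechet_derivative (f \<circ> cinv c) (at (coord c p)) (axis i 1)"

text \<open>\<open>transition c d p $ k $ i\<close> is the derivative at \<open>p\<close> of the \<open>k\<close>-th coordinate of \<open>d\<close>
  with respect to the \<open>i\<close>-th coordinate of \<open>c\<close>.\<close>

definition transition :: "'a chart \<Rightarrow> 'a chart \<Rightarrow> 'a \<Rightarrow> real^2^2" where
  "transition c d p = jacobian (coord d \<circ> cinv c) (at (coord c p))"

text \<open>Change of components from chart \<open>d\<close> to chart \<open>c\<close> for covectors and for covariant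
  \<open>2\<close>-tensors, where \<open>J = transition c d p\<close>.\<close>

definition pull1 :: "real^2^2 \<Rightarrow> real^2 \<Rightarrow> real^2" where
  "pull1 J \<omega> = transpose J *v \<omega>"

definition pull2 :: "real^2^2 \<Rightarrow> real^2^2 \<Rightarrow> real^2^2" where
  "pull2 J T = transpose J ** T ** J"


subsection \<open>Metrics, conformal classes and Moebius structures\<close>

text \<open>A covariant \<open>2\<close>-tensor field is the family of its component functions in the charts
  of the atlas. Values outside the chart domain carry no information.\<close>

type_synonym 'a tensor2 = "'a chart \<Rightarrow> 'a \<Rightarrow> real^2^2"

definition symmetric_tensor2 :: "'a chart set \<Rightarrow> 'a tensor2 \<Rightarrow> bool" where
  "symmetric_tensor2 A T \<longleftrightarrow> smooth_field A T \<and>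
     (\<forall>c\<in>A. \<forall>p\<in>cdom c. transpose (T c p) = T c p) \<and>
     (\<forall>c\<in>A. \<forall>d\<in>A. \<forall>p\<in>cdom c \<inter> cdom d. T c p = pull2 (transition c d p) (T d p))"

definition riemannian_metric :: "'a chart set \<Rightarrow> 'a tensor2 \<Rightarrow> bool" where
  "riemannian_metric A g \<longleftrightarrow> symmetric_tensor2 A g \<and>
     (\<forall>c\<in>A. \<forall>p\<in>cdom c. \<forall>v. v \<noteq> 0 \<longrightarrow> v \<bullet> (g c p *v v) > 0)"

definition rescaling :: "'a chart set \<Rightarrow> ('a \<Rightarrow> real) \<Rightarrow> 'a tensor2 \<Rightarrow> 'a tensor2 \<Rightarrow> bool" where
  "rescaling A \<Omega> g h \<longleftrightarrow> smooth_field A (\<lambda>c. \<Omega>) \<and> (\<forall>p\<in>surface A. \<Omega> p > 0) \<and>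
     (\<forall>c\<in>A. \<forall>p\<in>cdom c. h c p = (\<Omega> p)\<^sup>2 *\<^sub>R g c p)"

definition raise :: "'a tensor2 \<Rightarrow> 'a chart \<Rightarrow> 'a \<Rightarrow> real^2 \<Rightarrow> real^2" where
  "raise g c p \<omega> = matrix_inv (g c p) *v \<omega>"

definition form_inner :: "'a tensor2 \<Rightarrow> 'a chart \<Rightarrow> 'a \<Rightarrow> real^2 \<Rightarrow> real^2 \<Rightarrow> real" where
  "form_inner g c p \<alpha> \<beta> = \<alpha> \<bullet> raise g c p \<beta>"

definition christoffel :: "'a tensor2 \<Rightarrow> 'a chart \<Rightarrow> 'a \<Rightarrow> 2 \<Rightarrow> 2 \<Rightarrow> 2 \<Rightarrow> real" where
  "christoffel g c p k i j = (1/2) * (\<Sum>l\<in>UNIV. matrix_inv (g c p) $ k $ l *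
     (partial_deriv c (\<lambda>q. g c q $ j $ l) p i + partial_deriv c (\<lambda>q. g c q $ i $ l) p j
      - partial_deriv c (\<lambda>q. g c q $ i $ j) p l))"

definition cov_deriv_form :: "'a tensor2 \<Rightarrow> 'a chart \<Rightarrow> ('a \<Rightarrow> real^2) \<Rightarrow> 'a \<Rightarrow> real^2^2" where
  "cov_deriv_form g c \<omega> p = (\<chi> a b. partial_deriv c (\<lambda>q. \<omega> q $ b) p a
     - (\<Sum>k\<in>UNIV. christoffel g c p k a b * \<omega> p $ k))"

definition Upsilon :: "('a \<Rightarrow> real) \<Rightarrow> 'a chart \<Rightarrow> 'a \<Rightarrow> real^2" where
  "Upsilon \<Omega> c p = (\<chi> a. partial_deriv c \<Omega> p a / \<Omega> p)"

definition conformal_class :: "'a chart set \<Rightarrow> 'a tensor2 set \<Rightarrow> bool" where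
  "conformal_class A C \<longleftrightarrow>
     (\<exists>g. riemannian_metric A g \<and> C = {h. \<exists>\<Omega>. rescaling A \<Omega> g h})"

definition mobius_structure ::
    "'a chart set \<Rightarrow> 'a tensor2 set \<Rightarrow> ('a tensor2 \<Rightarrow> 'a tensor2) \<Rightarrow> bool" where
  "mobius_structure A C P \<longleftrightarrow> conformal_class A C \<and>
     (\<forall>g\<in>C. symmetric_tensor2 A (P g)) \<and>
     (\<forall>g\<in>C. \<forall>h\<in>C. \<forall>\<Omega>. rescaling A \<Omega> g h \<longrightarrow> (\<forall>c\<in>A. \<forall>p\<in>cdom c.
        P h c p = P g c p - cov_deriv_form g c (Upsilon \<Omega> c) p
          + (\<chi> a b. Upsilon \<Omega> c p $ a * Upsilon \<Omega> c p $ b)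
          - (1/2 * form_inner g c p (Upsilon \<Omega> c p) (Upsilon \<Omega> c p)) *\<^sub>R g c p))"


subsection \<open>Curves\<close>

text \<open>An oriented curve is given by a regular parametrisation on an open interval \<open>I\<close>,
  oriented by increasing parameter. Injectivity is not required, so closed curves are covered
  by periodic parametrisations. Quantities along the curve are written in the components of a
  chart \<open>c\<close>; they are meaningful at those \<open>t \<in> I\<close> with \<open>\<gamma> t \<in> cdom c\<close>.\<close>

definition smooth_curve :: "'a::topological_space chart set \<Rightarrow> real set \<Rightarrow> (real \<Rightarrow> 'a) \<Rightarrow> bool" where
  "smooth_curve A I \<gamma> \<longleftrightarrow> open I \<and> is_interval I \<and> \<gamma> ` I \<subseteq> surface A \<and> continuous_on I \<gamma> \<and>
     (\<forall>c\<in>A. smooth_on {t\<in>I. \<gamma> t \<in> cdom c} (coord c \<circ> \<gamma>) \<and>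
        (\<forall>t\<in>I. \<gamma> t \<in> cdom c \<longrightarrow> vector_derivative (coord c \<circ> \<gamma>) (at t) \<noteq> 0))"

definition speed :: "(real \<Rightarrow> 'a) \<Rightarrow> 'a tensor2 \<Rightarrow> 'a chart \<Rightarrow> real \<Rightarrow> real" where
  "speed \<gamma> g c t = (let v = vector_derivative (coord c \<circ> \<gamma>) (at t) in sqrt (v \<bullet> (g c (\<gamma> t) *v v)))"

definition Uvec :: "(real \<Rightarrow> 'a) \<Rightarrow> 'a tensor2 \<Rightarrow> 'a chart \<Rightarrow> real \<Rightarrow> real^2" where
  "Uvec \<gamma> g c t = vector_derivative (coord c \<circ> \<gamma>) (at t) /\<^sub>R speed \<gamma> g c t"

definition Uform :: "(real \<Rightarrow> 'a) \<Rightarrow> 'a tensor2 \<Rightarrow> 'a chart \<Rightarrow> real \<Rightarrow> real^2" where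
  "Uform \<gamma> g c t = g c (\<gamma> t) *v Uvec \<gamma> g c t"

text \<open>The derivative \<open>U\<^sup>a\<nabla>\<^sub>a\<close> along the curve of functions, covectors and covariant
  \<open>2\<close>-tensors; division by the speed turns \<open>d/dt\<close> into the arc-length derivative.\<close>

definition D0 :: "(real \<Rightarrow> 'a) \<Rightarrow> 'a tensor2 \<Rightarrow> 'a chart \<Rightarrow> (real \<Rightarrow> real) \<Rightarrow> real \<Rightarrow> real" where
  "D0 \<gamma> g c f t = vector_derivative f (at t) / speed \<gamma> g c t"

definition D1 :: "(real \<Rightarrow> 'a) \<Rightarrow> 'a tensor2 \<Rightarrow> 'a chart \<Rightarrow> (real \<Rightarrow> real^2) \<Rightarrow> real \<Rightarrow> real^2" where
  "D1 \<gamma> g c \<omega> t = (\<chi> b. vector_derivative \<omega> (at t) $ b / speed \<gamma> g c t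
     - (\<Sum>a\<in>UNIV. \<Sum>k\<in>UNIV. Uvec \<gamma> g c t $ a * christoffel g c (\<gamma> t) k a b * \<omega> t $ k))"

definition D2 :: "(real \<Rightarrow> 'a) \<Rightarrow> 'a tensor2 \<Rightarrow> 'a chart \<Rightarrow> (real \<Rightarrow> real^2^2) \<Rightarrow> real \<Rightarrow> real^2^2" where
  "D2 \<gamma> g c \<mu> t = (\<chi> b d. vector_derivative \<mu> (at t) $ b $ d / speed \<gamma> g c t
     - (\<Sum>a\<in>UNIV. \<Sum>k\<in>UNIV. Uvec \<gamma> g c t $ a *
          (christoffel g c (\<gamma> t) k a b * \<mu> t $ k $ d + christoffel g c (\<gamma> t) k a d * \<mu> t $ b $ k)))"

definition accel :: "(real \<Rightarrow> 'a) \<Rightarrow> 'a tensor2 \<Rightarrow> 'a chart \<Rightarrow> real \<Rightarrow> real^2" where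
  "accel \<gamma> g c t = D1 \<gamma> g c (Uform \<gamma> g c) t"

definition jerk ::
    "('a tensor2 \<Rightarrow> 'a tensor2) \<Rightarrow> (real \<Rightarrow> 'a) \<Rightarrow> 'a tensor2 \<Rightarrow> 'a chart \<Rightarrow> real \<Rightarrow> real^2" where
  "jerk P \<gamma> g c t = D1 \<gamma> g c (accel \<gamma> g c) t
     + (form_inner g c (\<gamma> t) (accel \<gamma> g c t) (accel \<gamma> g c t)
        + Uvec \<gamma> g c t \<bullet> (P g c (\<gamma> t) *v Uvec \<gamma> g c t)) *\<^sub>R Uform \<gamma> g c t
     - P g c (\<gamma> t) *v Uvec \<gamma> g c t"

definition kappa ::
    "'a chart set \<Rightarrow> ('a tensor2 \<Rightarrow> 'a tensor2) \<Rightarrow> (real \<Rightarrow> 'a) \<Rightarrow> 'a tensor2 \<Rightarrow> real \<Rightarrow> real" where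
  "kappa A P \<gamma> g t = (THE k. \<forall>c\<in>A. \<gamma> t \<in> cdom c \<longrightarrow>
     D1 \<gamma> g c (jerk P \<gamma> g c) t
     + form_inner g c (\<gamma> t) (accel \<gamma> g c t) (jerk P \<gamma> g c t) *\<^sub>R Uform \<gamma> g c t
     + (2 * k) *\<^sub>R jerk P \<gamma> g c t = 0)"


subsection \<open>The adjoint tractor bundle\<close>

text \<open>Components \<open>(\<sigma>\<^sub>b, \<mu>\<^sub>b\<^sub>c, \<nu>, \<rho>\<^sub>b)\<close> in a chart, in the presence of a metric.\<close>

type_synonym quad = "(real^2) \<times> (real^2^2) \<times> real \<times> (real^2)"

text \<open>\<open>wedge \<alpha> \<beta>\<close> is \<open>2 \<alpha>\<^sub>[\<^sub>b \<beta>\<^sub>c\<^sub>]\<close>.\<close>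

definition wedge :: "real^2 \<Rightarrow> real^2 \<Rightarrow> real^2^2" where
  "wedge \<alpha> \<beta> = (\<chi> b c. \<alpha> $ b * \<beta> $ c - \<alpha> $ c * \<beta> $ b)"

fun quad_pull :: "real^2^2 \<Rightarrow> quad \<Rightarrow> quad" where
  "quad_pull J (\<sigma>, \<mu>, \<nu>, \<rho>) = (pull1 J \<sigma>, pull2 J \<mu>, \<nu>, pull1 J \<rho>)"

fun quad_rescale ::
    "'a tensor2 \<Rightarrow> 'a chart \<Rightarrow> 'a \<Rightarrow> real \<Rightarrow> real^2 \<Rightarrow> quad \<Rightarrow> quad" where
  "quad_rescale g c p w Y (\<sigma>, \<mu>, \<nu>, \<rho>) =
     (w\<^sup>2 *\<^sub>R \<sigma>,
      w\<^sup>2 *\<^sub>R (\<mu> + wedge Y \<sigma>),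
      \<nu> + form_inner g c p Y \<sigma>,
      \<rho> + raise g c p Y v* \<mu> - \<nu> *\<^sub>R Y - form_inner g c p Y \<sigma> *\<^sub>R Y
        + (1/2 * form_inner g c p Y Y) *\<^sub>R \<sigma>)"

text \<open>An adjoint tractor assigns components to every metric in the conformal class and every
  chart around the point, subject to the transformation laws.\<close>

type_synonym 'a tractor = "'a tensor2 \<Rightarrow> 'a chart \<Rightarrow> quad"

definition adjoint_fibre :: "'a chart set \<Rightarrow> 'a tensor2 set \<Rightarrow> 'a \<Rightarrow> 'a tractor set" where
  "adjoint_fibre A C p = {X.
     (\<forall>g\<in>C. \<forall>c\<in>A. p \<in> cdom c \<longrightarrow> (case X g c of (\<sigma>, \<mu>, \<nu>, \<rho>) \<Rightarrow> transpose \<mu> = - \<mu>)) \<and>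
     (\<forall>g\<in>C. \<forall>c\<in>A. \<forall>d\<in>A. p \<in> cdom c \<inter> cdom d \<longrightarrow>
        X g c = quad_pull (transition c d p) (X g d)) \<and>
     (\<forall>g\<in>C. \<forall>h\<in>C. \<forall>\<Omega>. rescaling A \<Omega> g h \<longrightarrow> (\<forall>c\<in>A. p \<in> cdom c \<longrightarrow>
        X h c = quad_rescale g c p (\<Omega> p) (Upsilon \<Omega> c p) (X g c)))}"

definition tractor_deriv ::
    "('a tensor2 \<Rightarrow> 'a tensor2) \<Rightarrow> (real \<Rightarrow> 'a) \<Rightarrow> 'a tensor2 \<Rightarrow> 'a chart \<Rightarrow> (real \<Rightarrow> quad) \<Rightarrow> real \<Rightarrow> quad" where
  "tractor_deriv P \<gamma> g c F t =
     (let \<sigma> = (\<lambda>s. fst (F s)); \<mu> = (\<lambda>s. fst (snd (F s)));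
          \<nu> = (\<lambda>s. fst (snd (snd (F s)))); \<rho> = (\<lambda>s. snd (snd (snd (F s))));
          U = Uvec \<gamma> g c t; U' = Uform \<gamma> g c t; PU = U v* P g c (\<gamma> t) in
      (D1 \<gamma> g c \<sigma> t - U v* \<mu> t - \<nu> t *\<^sub>R U',
       D2 \<gamma> g c \<mu> t - wedge U' (\<rho> t) + wedge PU (\<sigma> t),
       D0 \<gamma> g c \<nu> t + U \<bullet> \<rho> t + form_inner g c (\<gamma> t) PU (\<sigma> t),
       D1 \<gamma> g c \<rho> t - \<mu> t *v raise g c (\<gamma> t) PU - \<nu> t *\<^sub>R PU))"

definition section_along ::
    "'a chart set \<Rightarrow> 'a tensor2 set \<Rightarrow> real set \<Rightarrow> (real \<Rightarrow> 'a) \<Rightarrow>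
     (real \<Rightarrow> 'a tractor set) \<Rightarrow> (real \<Rightarrow> 'a tractor) \<Rightarrow> bool" where
  "section_along A C I \<gamma> L S \<longleftrightarrow> (\<forall>t\<in>I. S t \<in> L t) \<and>
     (\<forall>g\<in>C. \<forall>c\<in>A. smooth_on {t\<in>I. \<gamma> t \<in> cdom c} (\<lambda>t. S t g c))"

text \<open>Whether a family \<open>L\<close> of subspaces of the fibres along \<open>\<gamma>\<close> is preserved by the
  derivative computed with the metric \<open>h\<close>: the resulting quadruple must be the
  \<open>h\<close>-representative of an element of \<open>L t\<close>. (The derivative is invariant only up to weight.)\<close>

definition preserved ::
    "'a chart set \<Rightarrow> 'a tensor2 set \<Rightarrow> ('a tensor2 \<Rightarrow> 'a tensor2) \<Rightarrow> real set \<Rightarrow> (real \<Rightarrow> 'a) \<Rightarrow>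
     'a tensor2 \<Rightarrow> (real \<Rightarrow> 'a tractor set) \<Rightarrow> bool" where
  "preserved A C P I \<gamma> h L \<longleftrightarrow> (\<forall>S. section_along A C I \<gamma> L S \<longrightarrow>
     (\<forall>t\<in>I. \<exists>X\<in>L t. \<forall>c\<in>A. \<gamma> t \<in> cdom c \<longrightarrow>
        X h c = tractor_deriv P \<gamma> h c (\<lambda>s. S s h c) t))"

definition jerk_tractor ::
    "'a chart set \<Rightarrow> ('a tensor2 \<Rightarrow> 'a tensor2) \<Rightarrow> (real \<Rightarrow> 'a) \<Rightarrow> 'a tensor2 \<Rightarrow> 'a chart \<Rightarrow> real \<Rightarrow> quad" where
  "jerk_tractor A P \<gamma> g c t =
     (Uform \<gamma> g c t,
      wedge (Uform \<gamma> g c t) (accel \<gamma> g c t),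
      kappa A P \<gamma> g t,
      jerk P \<gamma> g c t
        + (1/2 * (form_inner g c (\<gamma> t) (accel \<gamma> g c t) (accel \<gamma> g c t) - (kappa A P \<gamma> g t)\<^sup>2)) *\<^sub>R Uform \<gamma> g c t
        + kappa A P \<gamma> g t *\<^sub>R accel \<gamma> g c t)"

definition jerk_line ::
    "'a chart set \<Rightarrow> 'a tensor2 set \<Rightarrow> ('a tensor2 \<Rightarrow> 'a tensor2) \<Rightarrow> (real \<Rightarrow> 'a) \<Rightarrow>
     'a tensor2 \<Rightarrow> real \<Rightarrow> 'a tractor set" where
  "jerk_line A C P \<gamma> g t = {X \<in> adjoint_fibre A C (\<gamma> t).
     \<exists>r. \<forall>c\<in>A. \<gamma> t \<in> cdom c \<longrightarrow> X g c = r *\<^sub>R jerk_tractor A P \<gamma> g c t}"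

end

theory Submission
  imports Defs
begin

text \<open>Write \<open>\<Sigma>\<close> for the displayed quadruple and \<open>E\<close> for the left-hand side of the asserted equation.
  The definitions of \<open>J\<close> and \<open>\<kappa>\<close> give
  \<open>\<partial>\<Sigma> = - \<kappa> \<Sigma> + E (0, 0, 1, A - \<kappa> U)\<close>, so by the Leibniz rule a section \<open>r \<Sigma>\<close> is mapped into the
  line iff \<open>r E = 0\<close>. Under \<open>g \<mapsto> \<Omega>\<^sup>2 g\<close>, with \<open>u = U\<^sup>a \<Upsilon>\<^sub>a\<close>, one has
  \<open>A \<mapsto> A - \<Upsilon> + u U\<close>, \<open>J \<mapsto> J/\<Omega>\<close>, \<open>\<kappa> \<mapsto> (\<kappa> + u)/\<Omega>\<close> and \<open>E \<mapsto> E/\<Omega>\<^sup>2\<close>,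
  and \<open>\<Sigma>\<close> rescales with weight one, so that \<open>speed \<cdot> \<Sigma>\<close> is a nowhere vanishing section.\<close>

section \<open>Calculus of smooth functions\<close>

text \<open>All quantities are component functions in charts, so two invariances must be earned
  before these formulas have a meaning: under change of chart, because \<open>kappa\<close> is a
  definite description ranging over all charts at once, and under change of metric, because an
  element of \<open>adjoint_fibre\<close> carries components for every metric of the class. Both
  rest on the behaviour of the covariant derivative \<open>D1\<close>. Its Christoffel terms are
  rewritten with symbols of the first kind contracted with raised covectors. No derivative of the
  inverse metric then has to be computed, and metric compatibility, change of chart and rescaling
  become elementary algebra. Dimension two enters through one fact: the covectors orthogonal to U
  form a line, which contains both J and \<partial>J + (A.J) U; hence \<kappa> exists. The equation
  E = 0 is forced because the error term has zero first slot while the first slot of \<Sigma> is U,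
  so no multiple of \<Sigma> can absorb it.\<close>

lemma n_times_differentiable_on_cong:
  assumes "open S" "\<And>x. x \<in> S \<Longrightarrow> f x = g x" "n_times_differentiable_on n S f"
  shows "n_times_differentiable_on n S g"
  using assms(2,3)
proof (induction n arbitrary: f g)
  case 0
  then show ?case by (simp cong: continuous_on_cong)
next
  case (Suc n)
  have d: "(g has_derivative frechet_derivative f (at x)) (at x)" if "x \<in> S" for x
  proof (rule has_derivative_transform_within_open[OF _ assms(1) that Suc.prems(1)])
    show "(f has_derivative frechet_derivative f (at x)) (at x)"
      using Suc.prems(2) that unfolding n_times_differentiable_on.simps frechet_derivative_works by blast
  qed
  have e: "frechet_derivative g (at x) = frechet_derivative f (at x)" if "x \<in> S" for x
    using frechet_derivative_at[OF d[OF that]] by simp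
  have "n_times_differentiable_on n S (\<lambda>x. frechet_derivative g (at x) v)" for v
    using Suc.prems(2) e by (rule_tac Suc.IH[of "\<lambda>x. frechet_derivative f (at x) v"]) simp_all
  then show ?case using d unfolding n_times_differentiable_on.simps differentiable_def by blast
qed

text \<open>Product, quotient and chain rules deliver explicit derivatives rather than
  \<open>frechet_derivative\<close>. With this rule a closure proof exhibits such a derivative and
  checks its directional values at order \<open>n\<close>.\<close>

lemma n_times_differentiable_on_SucI:
  assumes "open S" "\<And>x. x \<in> S \<Longrightarrow> (f has_derivative f' x) (at x)"
    and "\<And>v. n_times_differentiable_on n S (\<lambda>x. f' x v)"
  shows "n_times_differentiable_on (Suc n) S f"
proof -
  have "frechet_derivative f (at x) = f' x" if "x \<in> S" for x
    using frechet_derivative_at[OF assms(2)[OF that]] by simp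
  then have "n_times_differentiable_on n S (\<lambda>x. frechet_derivative f (at x) v)" for v
    by (intro n_times_differentiable_on_cong[OF assms(1) _ assms(3)[of v]]) auto
  then show ?thesis using assms(2) by (auto simp: differentiable_def)
qed

text \<open>At \<open>Suc n\<close> the definition speaks only of derivatives, so losing one order
  is itself an induction, whose base is that differentiable functions are continuous.\<close>

lemma n_times_differentiable_on_SucD:
  "n_times_differentiable_on (Suc n) S f \<Longrightarrow> n_times_differentiable_on n S f"
proof (induction n arbitrary: f)
  case 0
  then show ?case
    by (auto intro!: continuous_at_imp_continuous_on differentiable_imp_continuous_within)
next
  case (Suc n)
  then show ?case by (subst n_times_differentiable_on.simps(2), subst (asm) (2) n_times_differentiable_on.simps(2)) blast
qed

lemma n_times_differentiable_on_Suc_has_derivative: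
  "n_times_differentiable_on (Suc n) S f \<Longrightarrow> x \<in> S \<Longrightarrow>
    (f has_derivative frechet_derivative f (at x)) (at x)"
  by (simp add: frechet_derivative_works)

lemma n_times_differentiable_on_const:
  "open S \<Longrightarrow> n_times_differentiable_on n S (\<lambda>x. c)"
  by (induction n arbitrary: c) auto

lemma n_times_differentiable_on_bounded_linear:
  assumes "open S" "bounded_linear L" "n_times_differentiable_on n S f"
  shows "n_times_differentiable_on n S (\<lambda>x. L (f x))"
  using assms(3)
proof (induction n arbitrary: f)
  case 0
  then show ?case using assms(2) by (simp add: bounded_linear.continuous_on)
next
  case (Suc n)
  show ?case
  proof (rule n_times_differentiable_on_SucI[OF assms(1)])
    show "((\<lambda>x. L (f x)) has_derivative (\<lambda>v. L (frechet_derivative f (at x) v))) (at x)" if "x \<in> S" for x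
      by (rule bounded_linear.has_derivative[OF assms(2) n_times_differentiable_on_Suc_has_derivative[OF Suc.prems that]])
  qed (use Suc in auto)
qed

lemma n_times_differentiable_on_add:
  assumes "open S" "n_times_differentiable_on n S f" "n_times_differentiable_on n S g"
  shows "n_times_differentiable_on n S (\<lambda>x. f x + g x)"
  using assms(2,3)
proof (induction n arbitrary: f g)
  case 0
  then show ?case by (simp add: continuous_on_add)
next
  case (Suc n)
  show ?case
  proof (rule n_times_differentiable_on_SucI[OF assms(1)])
    show "((\<lambda>x. f x + g x) has_derivative
        (\<lambda>v. frechet_derivative f (at x) v + frechet_derivative g (at x) v)) (at x)" if "x \<in> S" for x
      by (rule has_derivative_add[OF n_times_differentiable_on_Suc_has_derivative[OF Suc.prems(1) that]
            n_times_differentiable_on_Suc_has_derivative[OF Suc.prems(2) that]])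
  qed (use Suc in auto)
qed

lemma n_times_differentiable_on_bilinear:
  assumes "open S" "bounded_bilinear B" "n_times_differentiable_on n S f" "n_times_differentiable_on n S g"
  shows "n_times_differentiable_on n S (\<lambda>x. B (f x) (g x))"
  using assms(3,4)
proof (induction n arbitrary: f g)
  case 0
  then show ?case using assms(2) by (simp add: bounded_bilinear.continuous_on)
next
  case (Suc n)
  show ?case
  proof (rule n_times_differentiable_on_SucI[OF assms(1)])
    show "((\<lambda>x. B (f x) (g x)) has_derivative
        (\<lambda>v. B (f x) (frechet_derivative g (at x) v) + B (frechet_derivative f (at x) v) (g x))) (at x)"
      if "x \<in> S" for x
      by (rule bounded_bilinear.FDERIV[OF assms(2) n_times_differentiable_on_Suc_has_derivative[OF Suc.prems(1) that]
            n_times_differentiable_on_Suc_has_derivative[OF Suc.prems(2) that]])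
    \<comment> \<open>Each summand contains one undifferentiated factor, known at order
      \<open>Suc n\<close>; it has to be lowered by one order before the induction hypothesis
      applies.\<close>
    show "n_times_differentiable_on n S (\<lambda>x. B (f x) (frechet_derivative g (at x) v)
        + B (frechet_derivative f (at x) v) (g x))" for v
      using Suc.prems
      by (intro n_times_differentiable_on_add[OF assms(1)] Suc.IH
          Suc.prems[THEN n_times_differentiable_on_SucD]) simp_all
  qed
qed

text \<open>The derivative of 1/f is -(1/f) f' (1/f), which involves 1/f again, so the induction
  hypothesis for the same f closes the step.\<close>

lemma n_times_differentiable_on_inverse:
  fixes f :: "'a::real_normed_vector \<Rightarrow> real"
  assumes "open S" "\<And>x. x \<in> S \<Longrightarrow> f x \<noteq> 0" "n_times_differentiable_on n S f"
  shows "n_times_differentiable_on n S (\<lambda>x. inverse (f x))"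
  using assms(3)
proof (induction n)
  case 0
  then show ?case using assms(2) by (simp add: continuous_on_inverse)
next
  case (Suc n)
  have inv: "n_times_differentiable_on n S (\<lambda>x. inverse (f x))"
    by (rule Suc.IH[OF n_times_differentiable_on_SucD[OF Suc.prems]])
  show ?case
  proof (rule n_times_differentiable_on_SucI[OF assms(1)])
    show "((\<lambda>x. inverse (f x)) has_derivative
        (\<lambda>v. - (inverse (f x) * frechet_derivative f (at x) v * inverse (f x)))) (at x)"
      if "x \<in> S" for x
      by (rule Deriv.has_derivative_inverse[OF assms(2)[OF that]
            n_times_differentiable_on_Suc_has_derivative[OF Suc.prems that]])
    show "n_times_differentiable_on n S (\<lambda>x. - (inverse (f x) * frechet_derivative f (at x) v * inverse (f x)))" for v
      using Suc.prems inv
      by (intro n_times_differentiable_on_bounded_linear[OF assms(1), of uminus]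
          n_times_differentiable_on_bilinear[OF assms(1) bounded_bilinear_mult]) 
        (auto simp: bounded_linear_minus bounded_linear_ident)
  qed
qed

text \<open>Here the derivative f' / (2 sqrt f) reproduces sqrt f, so the induction hypothesis
  combines with the closure under inverses.\<close>

lemma n_times_differentiable_on_sqrt:
  fixes f :: "'a::real_normed_vector \<Rightarrow> real"
  assumes "open S" "\<And>x. x \<in> S \<Longrightarrow> f x > 0" "n_times_differentiable_on n S f"
  shows "n_times_differentiable_on n S (\<lambda>x. sqrt (f x))"
  using assms(3)
proof (induction n)
  case 0
  then show ?case by (simp add: continuous_on_real_sqrt)
next
  case (Suc n)
  have s: "n_times_differentiable_on n S (\<lambda>x. sqrt (f x))"
    by (rule Suc.IH[OF n_times_differentiable_on_SucD[OF Suc.prems]])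
  have inv: "n_times_differentiable_on n S (\<lambda>x. inverse (sqrt (f x)))"
    by (rule n_times_differentiable_on_inverse[OF assms(1) _ s]) (use assms(2) in force)
  show ?case
  proof (rule n_times_differentiable_on_SucI[OF assms(1)])
    show "((\<lambda>x. sqrt (f x)) has_derivative
        (\<lambda>v. (1/2) * (inverse (sqrt (f x)) * frechet_derivative f (at x) v))) (at x)"
      if "x \<in> S" for x
      using assms(2)[OF that] n_times_differentiable_on_Suc_has_derivative[OF Suc.prems that]
      by (auto simp: field_simps intro!: derivative_eq_intros)
    show "n_times_differentiable_on n S (\<lambda>x. (1/2) * (inverse (sqrt (f x)) * frechet_derivative f (at x) v))" for v
      using Suc.prems inv
      by (intro n_times_differentiable_on_bounded_linear[OF assms(1) bounded_linear_mult_right]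
          n_times_differentiable_on_bilinear[OF assms(1) bounded_bilinear_mult]) auto
  qed
qed

lemma n_times_differentiable_on_sum:
  assumes "open S" "\<And>i. i \<in> K \<Longrightarrow> n_times_differentiable_on n S (f i)"
  shows "n_times_differentiable_on n S (\<lambda>x. \<Sum>i\<in>K. f i x)"
  using assms(2)
proof (induction K rule: infinite_finite_induct)
  case (insert i K)
  then show ?case
    by (simp add: n_times_differentiable_on_add[OF assms(1)])
qed (auto simp: n_times_differentiable_on_const[OF assms(1)])

lemma n_times_differentiable_on_compose:
  fixes f :: "'b::euclidean_space \<Rightarrow> 'c::real_normed_vector" and \<phi> :: "'a::real_normed_vector \<Rightarrow> 'b"
  assumes "open S" "open T" "\<phi> ` T \<subseteq> S" "n_times_differentiable_on n T \<phi>" "n_times_differentiable_on n S f"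
  shows "n_times_differentiable_on n T (f \<circ> \<phi>)"
  using assms(4,5)
proof (induction n arbitrary: f)
  case 0
  then show ?case
    using assms(3) by (metis n_times_differentiable_on.simps(1) continuous_on_compose continuous_on_subset)
next
  case (Suc n)
  have \<phi>: "n_times_differentiable_on n T \<phi>" by (rule n_times_differentiable_on_SucD[OF Suc.prems(1)])
  show ?case
  proof (rule n_times_differentiable_on_SucI[OF assms(2)])
    fix x assume x: "x \<in> T"
    then have fx: "\<phi> x \<in> S" using assms(3) by auto
    have f: "(f has_derivative frechet_derivative f (at (\<phi> x))) (at (\<phi> x))"
      using Suc.prems(2) fx by (simp add: frechet_derivative_works)
    interpret bounded_linear "frechet_derivative f (at (\<phi> x))"
      using f by (rule has_derivative_bounded_linear)
    have "(f \<circ> \<phi> has_derivative frechet_derivative f (at (\<phi> x)) \<circ> frechet_derivative \<phi> (at x)) (at x)"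
      using f Suc.prems(1) x by (intro diff_chain_at) (auto simp: frechet_derivative_works)
    \<comment> \<open>The definition differentiates f in fixed directions only, whereas the chain
      rule produces a direction moving with x. Expanding it in the orthonormal basis leaves fixed
      directions with scalar coefficients; this is where the Euclidean structure is used.\<close>
    moreover have "frechet_derivative f (at (\<phi> x)) \<circ> frechet_derivative \<phi> (at x) =
        (\<lambda>v. \<Sum>b\<in>Basis. (frechet_derivative \<phi> (at x) v \<bullet> b) *\<^sub>R frechet_derivative f (at (\<phi> x)) b)"
    proof
      show "(frechet_derivative f (at (\<phi> x)) \<circ> frechet_derivative \<phi> (at x)) v =
        (\<Sum>b\<in>Basis. (frechet_derivative \<phi> (at x) v \<bullet> b) *\<^sub>R frechet_derivative f (at (\<phi> x)) b)" for v
        unfolding o_def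
        by (subst euclidean_representation[of "frechet_derivative \<phi> (at x) v", symmetric])
          (simp only: sum scaleR)
    qed
    ultimately show "(f \<circ> \<phi> has_derivative (\<lambda>v. \<Sum>b\<in>Basis. (frechet_derivative \<phi> (at x) v \<bullet> b) *\<^sub>R
        ((\<lambda>y. frechet_derivative f (at y) b) \<circ> \<phi>) x)) (at x)"
      by (simp add: o_def)
  next
    show "n_times_differentiable_on n T (\<lambda>x. \<Sum>b\<in>Basis. (frechet_derivative \<phi> (at x) v \<bullet> b) *\<^sub>R
        ((\<lambda>y. frechet_derivative f (at y) b) \<circ> \<phi>) x)" for v
      using Suc.prems
      by (intro n_times_differentiable_on_sum n_times_differentiable_on_bilinear[OF _ bounded_bilinear_scaleR]
        n_times_differentiable_on_bounded_linear[OF _ bounded_linear_inner_left] Suc.IH \<phi> assms(2)) auto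
  qed
qed

section \<open>Closure properties of smooth functions on an open set\<close>

lemma smooth_on_cong:
  "open S \<Longrightarrow> (\<And>x. x \<in> S \<Longrightarrow> f x = g x) \<Longrightarrow> smooth_on S f \<Longrightarrow> smooth_on S g"
  unfolding smooth_on_def using n_times_differentiable_on_cong by blast

lemma smooth_on_frechet_derivative:
  "smooth_on S f \<Longrightarrow> smooth_on S (\<lambda>x. frechet_derivative f (at x) v)"
  unfolding smooth_on_def by (metis n_times_differentiable_on.simps(2))

lemma smooth_on_differentiable: "smooth_on S f \<Longrightarrow> x \<in> S \<Longrightarrow> f differentiable (at x)"
  unfolding smooth_on_def by (metis n_times_differentiable_on.simps(2))

lemma smooth_on_continuous_on: "smooth_on S f \<Longrightarrow> continuous_on S f"
  unfolding smooth_on_def by (metis n_times_differentiable_on.simps(1))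

lemma smooth_on_has_vector_derivative:
  "smooth_on S f \<Longrightarrow> t \<in> S \<Longrightarrow> (f has_vector_derivative vector_derivative f (at t)) (at t)"
  using smooth_on_differentiable vector_derivative_works by blast

lemma smooth_on_vector_derivative:
  assumes "open S" "smooth_on S f"
  shows "smooth_on S (\<lambda>t. vector_derivative f (at t))"
  by (rule smooth_on_cong[OF assms(1) _ smooth_on_frechet_derivative[OF assms(2), of 1]])
    (use assms(2) in \<open>simp add: frechet_derivative_eq_vector_derivative smooth_on_differentiable\<close>)

lemma smooth_on_bounded_linear:
  "open S \<Longrightarrow> bounded_linear L \<Longrightarrow> smooth_on S f \<Longrightarrow> smooth_on S (\<lambda>x. L (f x))"
  unfolding smooth_on_def using n_times_differentiable_on_bounded_linear by blast

lemma smooth_on_bilinear: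
  "open S \<Longrightarrow> bounded_bilinear B \<Longrightarrow> smooth_on S f \<Longrightarrow> smooth_on S g \<Longrightarrow> smooth_on S (\<lambda>x. B (f x) (g x))"
  unfolding smooth_on_def using n_times_differentiable_on_bilinear by blast

named_theorems smooth_intros

lemma smooth_on_const [smooth_intros]: "open S \<Longrightarrow> smooth_on S (\<lambda>x. c)"
  unfolding smooth_on_def by (simp add: n_times_differentiable_on_const)

lemma smooth_on_add [smooth_intros]:
  "open S \<Longrightarrow> smooth_on S f \<Longrightarrow> smooth_on S g \<Longrightarrow> smooth_on S (\<lambda>x. f x + g x)"
  unfolding smooth_on_def by (simp add: n_times_differentiable_on_add)

lemma smooth_on_uminus [smooth_intros]: "open S \<Longrightarrow> smooth_on S f \<Longrightarrow> smooth_on S (\<lambda>x. - f x)"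
  by (rule smooth_on_bounded_linear) (auto simp: bounded_linear_minus bounded_linear_ident)

lemma smooth_on_diff [smooth_intros]:
  "open S \<Longrightarrow> smooth_on S f \<Longrightarrow> smooth_on S g \<Longrightarrow> smooth_on S (\<lambda>x. f x - g x)"
  using smooth_on_add[OF _ _ smooth_on_uminus, of S f g] by simp

lemma smooth_on_mult [smooth_intros]:
  fixes f g :: "'a::real_normed_vector \<Rightarrow> real"
  shows "open S \<Longrightarrow> smooth_on S f \<Longrightarrow> smooth_on S g \<Longrightarrow> smooth_on S (\<lambda>x. f x * g x)"
  by (rule smooth_on_bilinear[OF _ bounded_bilinear_mult])

lemma smooth_on_scaleR [smooth_intros]:
  "open S \<Longrightarrow> smooth_on S f \<Longrightarrow> smooth_on S g \<Longrightarrow> smooth_on S (\<lambda>x. f x *\<^sub>R g x)"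
  by (rule smooth_on_bilinear[OF _ bounded_bilinear_scaleR])

lemma smooth_on_inner [smooth_intros]:
  "open S \<Longrightarrow> smooth_on S f \<Longrightarrow> smooth_on S g \<Longrightarrow> smooth_on S (\<lambda>x. f x \<bullet> g x)"
  by (rule smooth_on_bilinear[OF _ bounded_bilinear_inner])

lemma smooth_on_inverse [smooth_intros]:
  fixes f :: "'a::real_normed_vector \<Rightarrow> real"
  shows "open S \<Longrightarrow> smooth_on S f \<Longrightarrow> (\<And>x. x \<in> S \<Longrightarrow> f x \<noteq> 0) \<Longrightarrow> smooth_on S (\<lambda>x. inverse (f x))"
  unfolding smooth_on_def using n_times_differentiable_on_inverse by blast

lemma smooth_on_divide [smooth_intros]:
  fixes f :: "'a::real_normed_vector \<Rightarrow> real"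
  shows "open S \<Longrightarrow> smooth_on S f \<Longrightarrow> smooth_on S g \<Longrightarrow> (\<And>x. x \<in> S \<Longrightarrow> g x \<noteq> 0) \<Longrightarrow>
    smooth_on S (\<lambda>x. f x / g x)"
  unfolding divide_inverse by (intro smooth_intros) auto

lemma smooth_on_power [smooth_intros]:
  fixes f :: "'a::real_normed_vector \<Rightarrow> real"
  shows "open S \<Longrightarrow> smooth_on S f \<Longrightarrow> smooth_on S (\<lambda>x. f x ^ n)"
  by (induction n) (auto intro: smooth_intros)

lemma smooth_on_sqrt [smooth_intros]:
  fixes f :: "'a::real_normed_vector \<Rightarrow> real"
  shows "open S \<Longrightarrow> smooth_on S f \<Longrightarrow> (\<And>x. x \<in> S \<Longrightarrow> f x > 0) \<Longrightarrow> smooth_on S (\<lambda>x. sqrt (f x))"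
  unfolding smooth_on_def using n_times_differentiable_on_sqrt by blast

lemma smooth_on_sum [smooth_intros]:
  "open S \<Longrightarrow> (\<And>i. i \<in> K \<Longrightarrow> smooth_on S (f i)) \<Longrightarrow> smooth_on S (\<lambda>x. \<Sum>i\<in>K. f i x)"
  unfolding smooth_on_def by (simp add: n_times_differentiable_on_sum)

lemma smooth_on_compose:
  fixes f :: "'b::euclidean_space \<Rightarrow> 'c::real_normed_vector"
  shows "open S \<Longrightarrow> open T \<Longrightarrow> \<phi> ` T \<subseteq> S \<Longrightarrow> smooth_on T \<phi> \<Longrightarrow> smooth_on S f \<Longrightarrow> smooth_on T (f \<circ> \<phi>)"
  unfolding smooth_on_def using n_times_differentiable_on_compose by blast

text \<open>A vector is the finite sum of its components embedded by \<open>axis\<close>;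
  boundedness of these embeddings reduces smoothness of vectors and matrices to that of their
  entries.\<close>

lemma bounded_linear_axis: "bounded_linear (axis i :: 'a::real_normed_vector \<Rightarrow> 'a^'n)"
proof (rule bounded_linear_intro[where K = 1])
  show "axis i (x + y) = axis i x + axis i y" for x y :: 'a
    by (simp add: vec_eq_iff axis_def)
  show "axis i (r *\<^sub>R x) = r *\<^sub>R axis i x" for r and x :: 'a
    by (simp add: vec_eq_iff axis_def)
  show "norm (axis i x :: 'a^'n) \<le> norm x * 1" for x :: 'a
  proof -
    have "norm (axis i x :: 'a^'n) \<le> (\<Sum>j\<in>UNIV. norm ((axis i x :: 'a^'n) $ j))"
      unfolding norm_vec_def by (rule L2_set_le_sum) simp
    also have "\<dots> = (\<Sum>j\<in>UNIV. if j = i then norm x else 0)"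
      by (intro sum.cong) (auto simp: axis_def)
    finally show ?thesis by simp
  qed
qed

lemma smooth_on_nth [smooth_intros]:
  "open S \<Longrightarrow> smooth_on S f \<Longrightarrow> smooth_on S (\<lambda>x. f x $ i)"
  by (rule smooth_on_bounded_linear[OF _ bounded_linear_vec_nth])

lemma smooth_on_vec_lambda [smooth_intros]:
  fixes f :: "'a::real_normed_vector \<Rightarrow> 'n::finite \<Rightarrow> 'b::real_normed_vector"
  assumes "open S" "\<And>i. smooth_on S (\<lambda>x. f x i)"
  shows "smooth_on S (\<lambda>x. \<chi> i. f x i)"
proof -
  have "(\<chi> i. f x i) = (\<Sum>i\<in>UNIV. axis i (f x i))" for x
    by (simp add: vec_eq_iff axis_def if_distrib cong: if_cong)
  then show ?thesis
    using assms by (auto intro!: smooth_intros smooth_on_bounded_linear[OF _ bounded_linear_axis])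
qed

lemma smooth_on_componentwise:
  "open S \<Longrightarrow> smooth_on S (f :: _ \<Rightarrow> 'b::real_normed_vector^'n) \<longleftrightarrow> (\<forall>i. smooth_on S (\<lambda>x. f x $ i))"
  using smooth_on_vec_lambda[of S "\<lambda>x i. f x $ i"] smooth_on_nth[of S f] by auto

lemma smooth_on_fst: "open S \<Longrightarrow> smooth_on S f \<Longrightarrow> smooth_on S (\<lambda>x. fst (f x))"
  by (rule smooth_on_bounded_linear[OF _ bounded_linear_fst])

lemma smooth_on_Pair [smooth_intros]:
  assumes "open S" "smooth_on S f" "smooth_on S g"
  shows "smooth_on S (\<lambda>x. (f x, g x))"
proof -
  have "smooth_on S (\<lambda>x. (f x, 0) + (0, g x))"
    using assms by (intro smooth_on_add smooth_on_bounded_linear[of _ "\<lambda>y. (y, 0)"]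
        smooth_on_bounded_linear[of _ "\<lambda>y. (0, y)"])
      (auto intro!: bounded_linear_Pair bounded_linear_ident bounded_linear_zero)
  then show ?thesis by simp
qed

text \<open>The second difference over the parallelogram with sides tu and tv is symmetric in u and
  v. Two mean value steps, one along each side, express it by an iterated derivative at a nearby
  point, which prepares the symmetry of mixed derivatives.\<close>

lemma second_difference_mean_value:
  fixes f :: "'a::real_normed_vector \<Rightarrow> real"
  assumes "ball x e \<subseteq> S" "t > 0" "t * (norm u + norm v) < e"
    and f: "\<And>y. y \<in> S \<Longrightarrow> f differentiable (at y)"
    and f': "\<And>y. y \<in> S \<Longrightarrow> (\<lambda>y. frechet_derivative f (at y) u) differentiable (at y)"
  shows "\<exists>y. dist y x \<le> t * (norm u + norm v) \<and>
    f (x + t *\<^sub>R u + t *\<^sub>R v) - f (x + t *\<^sub>R u) - f (x + t *\<^sub>R v) + f x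
      = t^2 * frechet_derivative (\<lambda>y. frechet_derivative f (at y) u) (at y) v"
proof -
  define fu where "fu = (\<lambda>y. frechet_derivative f (at y) u)"
  have nm: "norm (r *\<^sub>R u + s *\<^sub>R v) \<le> t * (norm u + norm v)" if "0 \<le> r" "r \<le> t" "0 \<le> s" "s \<le> t" for r s
  proof -
    have "norm (r *\<^sub>R u + s *\<^sub>R v) \<le> norm (r *\<^sub>R u) + norm (s *\<^sub>R v)" by (rule norm_triangle_ineq)
    also have "\<dots> \<le> t * norm u + t * norm v" using that by (auto intro!: add_mono mult_right_mono)
    finally show ?thesis by (simp add: algebra_simps)
  qed
  have inS: "x + r *\<^sub>R u + s *\<^sub>R v \<in> S" if "0 \<le> r" "r \<le> t" "0 \<le> s" "s \<le> t" for r s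
  proof -
    have "dist x (x + r *\<^sub>R u + s *\<^sub>R v) < e"
      using nm[OF that] assms(3) dist_add_cancel[of x 0 "r *\<^sub>R u + s *\<^sub>R v"]
      by (simp add: add.assoc)
    then show ?thesis using assms(1) by auto
  qed
  have du: "((\<lambda>r. f (x + r *\<^sub>R u + s *\<^sub>R v)) has_real_derivative fu (x + r *\<^sub>R u + s *\<^sub>R v)) (at r)"
    if "0 \<le> r" "r \<le> t" "0 \<le> s" "s \<le> t" for r s
  proof -
    have d: "(f has_derivative frechet_derivative f (at (x + r *\<^sub>R u + s *\<^sub>R v))) (at (x + r *\<^sub>R u + s *\<^sub>R v))"
      using f[OF inS[OF that]] by (simp add: frechet_derivative_works)
    have "((\<lambda>r. x + r *\<^sub>R u + s *\<^sub>R v) has_derivative (\<lambda>h. h *\<^sub>R u)) (at r)"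
      by (auto intro!: derivative_eq_intros)
    from diff_chain_at[OF this d]
    show ?thesis
      using linear_frechet_derivative[OF f[OF inS[OF that]]]
      by (simp add: o_def has_field_derivative_def fu_def linear_cmul mult_commute_abs)
  qed
  have dv: "((\<lambda>s. fu (x + r *\<^sub>R u + s *\<^sub>R v)) has_real_derivative
      frechet_derivative fu (at (x + r *\<^sub>R u + s *\<^sub>R v)) v) (at s)"
    if "0 \<le> r" "r \<le> t" "0 \<le> s" "s \<le> t" for r s
  proof -
    have df: "fu differentiable at (x + r *\<^sub>R u + s *\<^sub>R v)" unfolding fu_def by (rule f'[OF inS[OF that]])
    have "((\<lambda>s. x + r *\<^sub>R u + s *\<^sub>R v) has_derivative (\<lambda>h. h *\<^sub>R v)) (at s)"
      by (auto intro!: derivative_eq_intros)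
    from diff_chain_at[OF this df[unfolded frechet_derivative_works]]
    show ?thesis
      using linear_frechet_derivative[OF df]
      by (simp add: o_def has_field_derivative_def linear_cmul mult_commute_abs)
  qed
  \<comment> \<open>Mean value theorem in the direction u, applied to the increment of f across the
    side tv; the next step treats the direction v.\<close>
  obtain r where r: "0 < r" "r < t" and
    eq1: "(f (x + t *\<^sub>R u + t *\<^sub>R v) - f (x + t *\<^sub>R u + 0 *\<^sub>R v)) - (f (x + 0 *\<^sub>R u + t *\<^sub>R v) - f (x + 0 *\<^sub>R u + 0 *\<^sub>R v))
      = (t - 0) * (fu (x + r *\<^sub>R u + t *\<^sub>R v) - fu (x + r *\<^sub>R u + 0 *\<^sub>R v))"
    using MVT2[OF assms(2), of "\<lambda>r. f (x + r *\<^sub>R u + t *\<^sub>R v) - f (x + r *\<^sub>R u + 0 *\<^sub>R v)"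
        "\<lambda>r. fu (x + r *\<^sub>R u + t *\<^sub>R v) - fu (x + r *\<^sub>R u + 0 *\<^sub>R v)"]
      DERIV_diff[OF du[of _ t] du[of _ 0]] assms(2) by fastforce
  obtain s where s: "0 < s" "s < t" and
    eq2: "fu (x + r *\<^sub>R u + t *\<^sub>R v) - fu (x + r *\<^sub>R u + 0 *\<^sub>R v)
      = (t - 0) * frechet_derivative fu (at (x + r *\<^sub>R u + s *\<^sub>R v)) v"
    using MVT2[OF assms(2), of "\<lambda>s. fu (x + r *\<^sub>R u + s *\<^sub>R v)"
        "\<lambda>s. frechet_derivative fu (at (x + r *\<^sub>R u + s *\<^sub>R v)) v"] dv[of r] r
    by fastforce
  show ?thesis
  proof (intro exI conjI)
    show "dist (x + r *\<^sub>R u + s *\<^sub>R v) x \<le> t * (norm u + norm v)"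
      using nm[of r s] r s by (simp add: dist_norm add.assoc)
    show "f (x + t *\<^sub>R u + t *\<^sub>R v) - f (x + t *\<^sub>R u) - f (x + t *\<^sub>R v) + f x
      = t^2 * frechet_derivative (\<lambda>y. frechet_derivative f (at y) u) (at (x + r *\<^sub>R u + s *\<^sub>R v)) v"
      using eq1 eq2 unfolding fu_def[symmetric] by (simp add: power2_eq_square)
  qed
qed

text \<open>Evaluating the symmetric second difference in both orders shows that the two iterated
  derivatives take the same value at two points near x; continuity of both transfers the equality to
  x up to any \<epsilon>.\<close>

lemma smooth_on_mixed_derivatives:
  fixes f :: "'a::real_normed_vector \<Rightarrow> real"
  assumes "open S" "smooth_on S f" "x \<in> S"
  shows "frechet_derivative (\<lambda>y. frechet_derivative f (at y) u) (at x) v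
    = frechet_derivative (\<lambda>y. frechet_derivative f (at y) v) (at x) u"
proof -
  define a where "a = (\<lambda>u v y. frechet_derivative (\<lambda>y. frechet_derivative f (at y) u) (at y) v)"
  have cont: "isCont (a u v) x" for u v
    using assms smooth_on_continuous_on[OF smooth_on_frechet_derivative[OF smooth_on_frechet_derivative[OF assms(2), of u], of v]]
    by (simp add: a_def continuous_on_eq_continuous_at)
  obtain e where e: "e > 0" "ball x e \<subseteq> S" using assms open_contains_ball by blast
  \<comment> \<open>The summand 1 keeps M positive when u and v vanish; the factor 2 in the later
    choice of \<open>t\<close> makes t M strictly smaller than both radii.\<close>
  define M where "M = norm u + norm v + 1"
  have M: "M > 0" by (simp add: M_def add_nonneg_pos)
  have le: "\<bar>a u v x - a v u x\<bar> \<le> \<epsilon>" if "\<epsilon> > 0" for \<epsilon>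
  proof -
    obtain d where d: "d > 0" "\<And>y. dist y x < d \<Longrightarrow> dist (a u v y) (a u v x) < \<epsilon>/2"
        "\<And>y. dist y x < d \<Longrightarrow> dist (a v u y) (a v u x) < \<epsilon>/2"
    proof -
      obtain d1 where "d1 > 0" "\<And>y. dist y x < d1 \<Longrightarrow> dist (a u v y) (a u v x) < \<epsilon>/2"
        using cont[of u v] that half_gt_zero[OF \<open>\<epsilon> > 0\<close>] unfolding continuous_at_eps_delta by metis
      moreover obtain d2 where "d2 > 0" "\<And>y. dist y x < d2 \<Longrightarrow> dist (a v u y) (a v u x) < \<epsilon>/2"
        using cont[of v u] that half_gt_zero[OF \<open>\<epsilon> > 0\<close>] unfolding continuous_at_eps_delta by metis
      ultimately show ?thesis using that[of "min d1 d2"] by auto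
    qed
    define t where "t = min e d / (2 * M)"
    have t: "t > 0" using e d M by (simp add: t_def)
    have "t * (norm u + norm v) < t * M" using t by (simp add: M_def)
    moreover have "t * M < min e d" using M e(1) d(1) by (auto simp: t_def min_def)
    ultimately have tl: "t * (norm u + norm v) < e" "t * (norm u + norm v) < d" by auto
    note sd = smooth_on_differentiable[OF assms(2)]
      smooth_on_differentiable[OF smooth_on_frechet_derivative[OF assms(2)]]
    obtain y where y: "dist y x \<le> t * (norm u + norm v)"
      "f (x + t *\<^sub>R u + t *\<^sub>R v) - f (x + t *\<^sub>R u) - f (x + t *\<^sub>R v) + f x = t^2 * a u v y"
      using second_difference_mean_value[OF e(2) t tl(1) sd] unfolding a_def by blast
    obtain z where z: "dist z x \<le> t * (norm v + norm u)"
      "f (x + t *\<^sub>R v + t *\<^sub>R u) - f (x + t *\<^sub>R v) - f (x + t *\<^sub>R u) + f x = t^2 * a v u z"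
      using second_difference_mean_value[OF e(2) t _ sd, of v u] tl(1) unfolding a_def
      by (metis add.commute)
    have "t^2 * a u v y = t^2 * a v u z"
      using y(2) z(2) by (simp add: add.commute add.left_commute algebra_simps)
    then have "a u v y = a v u z" using t by simp
    moreover have "dist (a u v y) (a u v x) < \<epsilon>/2" using d(2) y(1) tl by auto
    moreover have "dist (a v u z) (a v u x) < \<epsilon>/2" using d(3) z(1) tl by (auto simp: add.commute)
    ultimately show ?thesis unfolding dist_real_def by arith
  qed
  have "\<bar>a u v x - a v u x\<bar> \<le> 0"
    by (rule field_le_epsilon) (use le in simp)
  then have "a u v x = a v u x" by simp
  then show ?thesis by (simp add: a_def)
qed

section \<open>Covariant differentiation along a curve in one chart\<close>

lemma
  fixes G :: "'a::semiring_1^'n^'m"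
  assumes "invertible G"
  shows matrix_inv_right: "G ** matrix_inv G = mat 1" and matrix_inv_left: "matrix_inv G ** G = mat 1"
  using assms someI_ex[of "\<lambda>B. G ** B = mat 1 \<and> B ** G = mat 1"]
  unfolding invertible_def matrix_inv_def by auto

text \<open>The adjugate formula makes the entries of the inverse metric rational in those of the
  metric; smoothness and symmetry of the inverse are both read off from it.\<close>

lemma matrix_inv_2:
  fixes G :: "real^2^2"
  assumes "det G \<noteq> 0"
  shows "matrix_inv G = (1 / det G) *\<^sub>R vector [vector [G$2$2, - G$1$2], vector [- G$2$1, G$1$1]]"
    (is "_ = ?B")
proof -
  define D where "D = det G"
  have D: "D \<noteq> 0" "G$1$1 * G$2$2 = D + G$1$2 * G$2$1" using assms by (simp_all add: D_def det_2)
  have right: "G ** ?B = mat 1"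
    unfolding D_def[symmetric] using D
    by (simp add: vec_eq_iff forall_2 matrix_matrix_mult_def sum_2 mat_def vector_2 field_simps)
  have left: "matrix_inv G ** G = mat 1"
    using assms by (simp add: invertible_det_nz matrix_inv_left)
  have "matrix_inv G = matrix_inv G ** (G ** ?B)" unfolding right by simp
  also have "\<dots> = ?B" unfolding matrix_mul_assoc left by simp
  finally show ?thesis .
qed

text \<open>The pointwise content of \<open>riemannian_metric\<close>, separated so that index
  algebra at a point involves neither the atlas nor smoothness.\<close>

definition inner_product_matrix :: "real^2^2 \<Rightarrow> bool" where
  "inner_product_matrix G \<longleftrightarrow> transpose G = G \<and> (\<forall>v. v \<noteq> 0 \<longrightarrow> v \<bullet> (G *v v) > 0)"

lemma inner_product_matrix_det:
  assumes "inner_product_matrix G"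
  shows "det G \<noteq> 0"
proof -
  have "v = 0" if "G *v v = 0" for v
    using assms that unfolding inner_product_matrix_def by force
  then show ?thesis
    using matrix_left_invertible_ker invertible_left_inverse invertible_det_nz by metis
qed

lemma transpose_symD:
  assumes "transpose (M :: real^2^2) = M"
  shows "M $ 2 $ 1 = M $ 1 $ 2"
proof -
  have "transpose M $ 1 $ 2 = M $ 1 $ 2" using assms by simp
  then show ?thesis by (simp add: transpose_def)
qed

lemma form_inner_add_left: "form_inner g c p (\<alpha> + \<beta>) \<eta> = form_inner g c p \<alpha> \<eta> + form_inner g c p \<beta> \<eta>"
  and form_inner_diff_left: "form_inner g c p (\<alpha> - \<beta>) \<eta> = form_inner g c p \<alpha> \<eta> - form_inner g c p \<beta> \<eta>"
  and form_inner_add_right: "form_inner g c p \<eta> (\<alpha> + \<beta>) = form_inner g c p \<eta> \<alpha> + form_inner g c p \<eta> \<beta>"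
  and form_inner_diff_right: "form_inner g c p \<eta> (\<alpha> - \<beta>) = form_inner g c p \<eta> \<alpha> - form_inner g c p \<eta> \<beta>"
  and form_inner_scaleR_left: "form_inner g c p (r *\<^sub>R \<alpha>) \<eta> = r * form_inner g c p \<alpha> \<eta>"
  and form_inner_scaleR_right: "form_inner g c p \<eta> (r *\<^sub>R \<alpha>) = r * form_inner g c p \<eta> \<alpha>"
  and form_inner_minus_left: "form_inner g c p (- \<alpha>) \<eta> = - form_inner g c p \<alpha> \<eta>"
  and form_inner_minus_right: "form_inner g c p \<eta> (- \<alpha>) = - form_inner g c p \<eta> \<alpha>"
  and form_inner_zero_left: "form_inner g c p 0 \<eta> = 0"
  and form_inner_zero_right: "form_inner g c p \<eta> 0 = 0"
  unfolding form_inner_def raise_def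
  by (simp_all add: matrix_vector_mult_def inner_vec_def sum_2 algebra_simps)

lemmas form_inner_linear = form_inner_add_left form_inner_diff_left form_inner_add_right
  form_inner_diff_right form_inner_scaleR_left form_inner_scaleR_right form_inner_minus_left
  form_inner_minus_right form_inner_zero_left form_inner_zero_right

lemma wedge_add_left: "wedge (\<alpha> + \<beta>) \<eta> = wedge \<alpha> \<eta> + wedge \<beta> \<eta>"
  and wedge_diff_left: "wedge (\<alpha> - \<beta>) \<eta> = wedge \<alpha> \<eta> - wedge \<beta> \<eta>"
  and wedge_add_right: "wedge \<eta> (\<alpha> + \<beta>) = wedge \<eta> \<alpha> + wedge \<eta> \<beta>"
  and wedge_diff_right: "wedge \<eta> (\<alpha> - \<beta>) = wedge \<eta> \<alpha> - wedge \<eta> \<beta>"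
  and wedge_scaleR_left: "wedge (r *\<^sub>R \<alpha>) \<eta> = r *\<^sub>R wedge \<alpha> \<eta>"
  and wedge_scaleR_right: "wedge \<eta> (r *\<^sub>R \<alpha>) = r *\<^sub>R wedge \<eta> \<alpha>"
  and wedge_self: "wedge \<alpha> \<alpha> = 0"
  by (simp_all add: wedge_def vec_eq_iff algebra_simps)

lemmas wedge_linear = wedge_add_left wedge_diff_left wedge_add_right wedge_diff_right
  wedge_scaleR_left wedge_scaleR_right wedge_self

lemma wedge_swap: "wedge \<alpha> \<beta> = - wedge \<beta> \<alpha>"
  by (simp add: wedge_def vec_eq_iff)

lemma transpose_wedge: "transpose (wedge \<alpha> \<beta>) = - wedge \<alpha> \<beta>"
  by (simp add: wedge_def vec_eq_iff transpose_def)

lemma vector_mult_wedge: "v v* wedge \<alpha> \<beta> = (v \<bullet> \<alpha>) *\<^sub>R \<beta> - (v \<bullet> \<beta>) *\<^sub>R \<alpha>"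
  by (simp add: wedge_def vec_eq_iff vector_matrix_mult_def inner_vec_def sum_2 forall_2 algebra_simps)

lemma wedge_mult_vector: "wedge \<alpha> \<beta> *v v = (v \<bullet> \<beta>) *\<^sub>R \<alpha> - (v \<bullet> \<alpha>) *\<^sub>R \<beta>"
  by (simp add: wedge_def vec_eq_iff matrix_vector_mult_def inner_vec_def sum_2 forall_2 algebra_simps)

lemma raise_lower: "inner_product_matrix (g c p) \<Longrightarrow> raise g c p (g c p *v v) = v"
  unfolding raise_def using inner_product_matrix_det[of "g c p"]
  by (simp add: matrix_vector_mul_assoc matrix_inv_left invertible_det_nz)

lemma lower_raise: "inner_product_matrix (g c p) \<Longrightarrow> g c p *v raise g c p \<omega> = \<omega>"
  unfolding raise_def using inner_product_matrix_det[of "g c p"]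
  by (simp add: matrix_vector_mul_assoc matrix_inv_right invertible_det_nz)

lemma matrix_inv_sym: "inner_product_matrix G \<Longrightarrow> matrix_inv G $ i $ j = matrix_inv G $ j $ i"
  using inner_product_matrix_det[of G] transpose_symD[of G] exhaust_2[of i] exhaust_2[of j]
  by (auto simp: matrix_inv_2 inner_product_matrix_def vector_2)

lemma form_inner_commute:
  assumes "inner_product_matrix (g c p)"
  shows "form_inner g c p \<alpha> \<beta> = form_inner g c p \<beta> \<alpha>"
  using matrix_inv_sym[OF assms, of 1 2]
  by (simp add: form_inner_def raise_def inner_vec_def matrix_vector_mult_def sum_2 algebra_simps)

text \<open>Contractions with the vector U become inner products with the covector U, so that a
  single bilinear form carries the later index computations.\<close>

lemma inner_eq_form_inner:
  assumes "inner_product_matrix (g c p)"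
  shows "v \<bullet> \<omega> = form_inner g c p (g c p *v v) \<omega>"
proof -
  have "v \<bullet> \<omega> = form_inner g c p \<omega> (g c p *v v)"
    by (simp add: form_inner_def raise_lower[of g c p v, OF assms] inner_commute)
  then show ?thesis by (simp add: form_inner_commute[of g c p, OF assms])
qed

lemma raise_inner:
  assumes "inner_product_matrix (g c p)"
  shows "raise g c p \<alpha> \<bullet> \<beta> = form_inner g c p \<alpha> \<beta>"
  using form_inner_commute[of g c p, OF assms] by (simp add: form_inner_def inner_commute)

lemma form_inner_pos:
  assumes "inner_product_matrix (g c p)" "\<alpha> \<noteq> 0"
  shows "form_inner g c p \<alpha> \<alpha> > 0"
proof -
  define v where "v = raise g c p \<alpha>"
  have v: "\<alpha> = g c p *v v" using lower_raise[of g c p, OF assms(1)] by (simp add: v_def)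
  then have "v \<noteq> 0" using assms(2) by auto
  then have "v \<bullet> (g c p *v v) > 0" using assms(1) by (auto simp: inner_product_matrix_def)
  also have "v \<bullet> (g c p *v v) = \<alpha> \<bullet> v" by (simp only: v[symmetric] inner_commute)
  finally show ?thesis unfolding form_inner_def v_def .
qed

text \<open>Dimension two is used here: the covectors annihilating the nonzero vector obtained by
  raising \<open>\<eta>\<close> form a line. Pairing with \<open>\<beta>\<close> then gives the
  coefficient.\<close>

lemma form_inner_orthogonal_parallel:
  assumes "inner_product_matrix (g c p)" "\<eta> \<noteq> 0" "\<beta> \<noteq> 0"
    and "form_inner g c p \<eta> \<alpha> = 0" "form_inner g c p \<eta> \<beta> = 0"
  shows "\<alpha> = (form_inner g c p \<alpha> \<beta> / form_inner g c p \<beta> \<beta>) *\<^sub>R \<beta>"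
proof -
  define u where "u = raise g c p \<eta>"
  have "u \<noteq> 0" using lower_raise[of g c p, OF assms(1), of \<eta>] assms(2) by (auto simp: u_def)
  then have u: "u$1 \<noteq> 0 \<or> u$2 \<noteq> 0" by (auto simp: vec_eq_iff forall_2)
  have "u \<bullet> \<alpha> = 0" "u \<bullet> \<beta> = 0" using assms raise_inner[of g c p, OF assms(1)] by (auto simp: u_def)
  then have e: "u$1 * \<alpha>$1 + u$2 * \<alpha>$2 = 0" "u$1 * \<beta>$1 + u$2 * \<beta>$2 = 0"
    by (auto simp: inner_vec_def sum_2)
  have *: "\<alpha>$1 * \<beta>$2 = \<alpha>$2 * \<beta>$1"
  proof -
    \<comment> \<open>Eliminating between the two linear equations shows that each component of u
      kills the determinant of the two covectors, and one component is nonzero.\<close>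
    have "u$1 * (\<alpha>$1 * \<beta>$2 - \<alpha>$2 * \<beta>$1) = 0" "u$2 * (\<alpha>$1 * \<beta>$2 - \<alpha>$2 * \<beta>$1) = 0"
      using e by algebra+
    then show ?thesis using u by auto
  qed
  obtain r where r: "\<alpha> = r *\<^sub>R \<beta>"
  proof (cases "\<beta>$1 = 0")
    case True
    then have "\<beta>$2 \<noteq> 0" using assms(3) by (auto simp: vec_eq_iff forall_2)
    then show ?thesis using that[of "\<alpha>$2 / \<beta>$2"] * True by (auto simp: vec_eq_iff forall_2 field_simps)
  next
    case False
    then show ?thesis using that[of "\<alpha>$1 / \<beta>$1"] * by (auto simp: vec_eq_iff forall_2 field_simps)
  qed
  then show ?thesis using form_inner_pos[of g c p, OF assms(1,3)] by (simp add: form_inner_linear)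
qed

text \<open>Christoffel symbols of the first kind, lowered index first; they are linear in the
  derivatives of the metric and free of its inverse.\<close>

definition christoffel1 :: "'a tensor2 \<Rightarrow> 'a chart \<Rightarrow> 'a \<Rightarrow> 2 \<Rightarrow> 2 \<Rightarrow> 2 \<Rightarrow> real" where
  "christoffel1 g c p l i j = (1/2) *
     (partial_deriv c (\<lambda>q. g c q $ j $ l) p i + partial_deriv c (\<lambda>q. g c q $ i $ l) p j
      - partial_deriv c (\<lambda>q. g c q $ i $ j) p l)"

text \<open>Symmetry of the inverse metric allows it to be moved from the symbol onto the covector,
  where it raises the index.\<close>

lemma christoffel_contract:
  assumes "inner_product_matrix (g c p)"
  shows "(\<Sum>k\<in>UNIV. christoffel g c p k i j * \<omega> $ k) =
    (\<Sum>l\<in>UNIV. raise g c p \<omega> $ l * christoffel1 g c p l i j)"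
  using matrix_inv_sym[OF assms, of 1 2]
  by (simp add: christoffel_def christoffel1_def[abs_def] raise_def matrix_vector_mult_def sum_2 algebra_simps)

section \<open>Coordinate expressions and partial derivatives\<close>

lemma smooth_surfaceD:
  assumes "smooth_surface A" "c \<in> A"
  shows "open (cdom c)" "open (coord c ` cdom c)"
    "homeomorphism (cdom c) (coord c ` cdom c) (coord c) (cinv c)"
  using assms by (auto simp: smooth_surface_def)

lemma cinv_coord: "smooth_surface A \<Longrightarrow> c \<in> A \<Longrightarrow> p \<in> cdom c \<Longrightarrow> cinv c (coord c p) = p"
  using smooth_surfaceD(3) by (metis homeomorphism_def)

lemma coord_cinv: "smooth_surface A \<Longrightarrow> c \<in> A \<Longrightarrow> y \<in> coord c ` cdom c \<Longrightarrow> coord c (cinv c y) = y"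
  using smooth_surfaceD(3) by (metis homeomorphism_def)

lemma smooth_on_partial_deriv:
  assumes "smooth_surface A" "c \<in> A" "smooth_on (coord c ` cdom c) (f \<circ> cinv c)"
  shows "smooth_on (coord c ` cdom c) ((\<lambda>p. partial_deriv c f p i) \<circ> cinv c)"
  by (rule smooth_on_cong[OF smooth_surfaceD(2)[OF assms(1,2)] _
        smooth_on_frechet_derivative[OF assms(3), of "axis i 1"]])
    (simp add: partial_deriv_def coord_cinv[OF assms(1,2)])

lemma frechet_derivative_sum_axis:
  fixes f :: "real^2 \<Rightarrow> real"
  assumes "f differentiable (at x)"
  shows "frechet_derivative f (at x) w = (\<Sum>i\<in>UNIV. w $ i * frechet_derivative f (at x) (axis i 1))"
proof -
  interpret linear "frechet_derivative f (at x)"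
    by (rule linear_frechet_derivative[OF assms])
  have "w = (\<Sum>i\<in>UNIV. w $ i *\<^sub>R axis i 1)"
    by (simp add: vec_eq_iff sum_2 forall_2 axis_def)
  then have "frechet_derivative f (at x) w = frechet_derivative f (at x) (\<Sum>i\<in>UNIV. w $ i *\<^sub>R axis i 1)"
    by simp
  then show ?thesis by (simp add: sum scaleR)
qed

lemma has_vector_derivative_nth:
  "(f has_vector_derivative v) (at t) \<Longrightarrow> ((\<lambda>s. f s $ i) has_vector_derivative v $ i) (at t)"
  by (rule bounded_linear.has_vector_derivative[OF bounded_linear_vec_nth])

locale chart_curve =
  fixes A :: "'a::{t2_space,second_countable_topology} chart set"
    and I :: "real set" and \<gamma> :: "real \<Rightarrow> 'a" and c :: "'a chart" and g :: "'a tensor2"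
  assumes surf: "smooth_surface A" and curve: "smooth_curve A I \<gamma>"
    and cA: "c \<in> A" and metric: "riemannian_metric A g"
begin

text \<open>Components carry no information outside the chart domain, so statements are confined to
  these parameters; the set is open, hence derivatives at its points depend on values inside it
  only.\<close>

definition T where "T = {t\<in>I. \<gamma> t \<in> cdom c}"

definition vel where "vel t = vector_derivative (coord c \<circ> \<gamma>) (at t)"

abbreviation "U \<equiv> Uvec \<gamma> g c"
abbreviation "Uf \<equiv> Uform \<gamma> g c"
abbreviation "sp \<equiv> speed \<gamma> g c"
abbreviation "acc \<equiv> accel \<gamma> g c"
abbreviation "d0 \<equiv> D0 \<gamma> g c"
abbreviation "d1 \<equiv> D1 \<gamma> g c"
abbreviation "d2 \<equiv> D2 \<gamma> g c"
abbreviation ip :: "real \<Rightarrow> real^2 \<Rightarrow> real^2 \<Rightarrow> real" where "ip t \<equiv> form_inner g c (\<gamma> t)"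

lemma open_T: "open T"
proof -
  have "open (I \<inter> \<gamma> -` cdom c)"
    using curve smooth_surfaceD(1)[OF surf cA]
    by (auto simp: smooth_curve_def intro: continuous_open_preimage)
  then show ?thesis by (simp add: T_def Int_def vimage_def)
qed

lemma T_cdom: "t \<in> T \<Longrightarrow> \<gamma> t \<in> cdom c"
  by (simp add: T_def)

lemma smooth_coord: "smooth_on T (coord c \<circ> \<gamma>)"
  using curve cA by (simp add: smooth_curve_def T_def)

lemma smooth_vel: "smooth_on T vel"
  using smooth_on_vector_derivative[OF open_T smooth_coord] by (simp add: vel_def[abs_def])

lemma vel_nonzero: "t \<in> T \<Longrightarrow> vel t \<noteq> 0"
  using curve cA by (auto simp: smooth_curve_def T_def vel_def)

lemma smooth_on_curve:
  assumes "smooth_on (coord c ` cdom c) (f \<circ> cinv c)"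
  shows "smooth_on T (\<lambda>t. f (\<gamma> t))"
proof -
  have "smooth_on T ((f \<circ> cinv c) \<circ> (coord c \<circ> \<gamma>))"
    by (rule smooth_on_compose[OF smooth_surfaceD(2)[OF surf cA] open_T _ smooth_coord assms])
      (auto simp: T_def)
  then show ?thesis
    by (rule smooth_on_cong[OF open_T, rotated]) (simp add: T_cdom cinv_coord[OF surf cA])
qed

lemma vector_derivative_along_curve:
  assumes d: "(f \<circ> cinv c) differentiable (at (coord c (\<gamma> t)))" and t: "t \<in> T"
  shows "((\<lambda>s. f (\<gamma> s)) has_vector_derivative (\<Sum>i\<in>UNIV. vel t $ i * partial_deriv c f (\<gamma> t) i)) (at t)"
proof -
  have "((f \<circ> cinv c) \<circ> (coord c \<circ> \<gamma>) has_vector_derivative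
      frechet_derivative (f \<circ> cinv c) (at (coord c (\<gamma> t))) (vel t)) (at t)"
    using vector_derivative_diff_chain_within[of "coord c \<circ> \<gamma>" "vel t" t UNIV "f \<circ> cinv c"]
      smooth_on_has_vector_derivative[OF smooth_coord t] d
    by (simp add: vel_def frechet_derivative_works has_derivative_at_withinI)
  then have "((\<lambda>s. f (\<gamma> s)) has_vector_derivative
      frechet_derivative (f \<circ> cinv c) (at (coord c (\<gamma> t))) (vel t)) (at t)"
    by (rule has_vector_derivative_transform_within_open[OF _ open_T t])
      (simp add: T_cdom cinv_coord[OF surf cA])
  then show ?thesis
    unfolding frechet_derivative_sum_axis[OF d, of "vel t"] partial_deriv_def .
qed

lemma differentiable_chart:
  "smooth_on (coord c ` cdom c) f \<Longrightarrow> t \<in> T \<Longrightarrow> f differentiable (at (coord c (\<gamma> t)))"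
  by (erule smooth_on_differentiable) (simp add: T_def)

lemma smooth_metric_chart: "smooth_on (coord c ` cdom c) ((\<lambda>q. g c q $ i $ j) \<circ> cinv c)"
proof -
  have "smooth_on (coord c ` cdom c) (g c \<circ> cinv c)"
    using metric cA by (auto simp: riemannian_metric_def symmetric_tensor2_def smooth_field_def)
  from smooth_on_nth[OF smooth_surfaceD(2)[OF surf cA] smooth_on_nth[OF smooth_surfaceD(2)[OF surf cA] this]]
  show ?thesis by (simp add: o_def)
qed

text \<open>Symmetry of \<open>g c\<close> is known on the chart domain only; the two entries have
  equal derivatives because they coincide on the open coordinate image.\<close>

lemma partial_deriv_metric_sym:
  assumes "p \<in> cdom c"
  shows "partial_deriv c (\<lambda>q. g c q $ 2 $ 1) p k = partial_deriv c (\<lambda>q. g c q $ 1 $ 2) p k"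
proof -
  have "cinv c y \<in> cdom c" if "y \<in> coord c ` cdom c" for y
    using that cinv_coord[OF surf cA] by auto
  then have eq: "((\<lambda>q. g c q $ 2 $ 1) \<circ> cinv c) y = ((\<lambda>q. g c q $ 1 $ 2) \<circ> cinv c) y" if "y \<in> coord c ` cdom c" for y
    using metric cA that unfolding riemannian_metric_def symmetric_tensor2_def o_def
    by (intro transpose_symD) blast
  show ?thesis
    unfolding partial_deriv_def
    using frechet_derivative_transform_within_open[OF smooth_on_differentiable[OF smooth_metric_chart] smooth_surfaceD(2)[OF surf cA] _ eq]
      assms by (metis image_eqI)
qed

lemma metric_sym: "p \<in> cdom c \<Longrightarrow> g c p $ 2 $ 1 = g c p $ 1 $ 2"
  using metric cA unfolding riemannian_metric_def symmetric_tensor2_def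
  by (intro transpose_symD) blast

lemma metric_inner_product: "t \<in> T \<Longrightarrow> inner_product_matrix (g c (\<gamma> t))"
  using metric cA T_cdom unfolding riemannian_metric_def symmetric_tensor2_def inner_product_matrix_def
  by blast

lemma smooth_metric: "smooth_on T (\<lambda>t. g c (\<gamma> t))"
  using smooth_on_curve[OF smooth_metric_chart] by (auto simp: smooth_on_componentwise open_T)

lemma smooth_christoffel1: "smooth_on T (\<lambda>t. christoffel1 g c (\<gamma> t) l i j)"
  unfolding christoffel1_def
  by (intro smooth_intros open_T smooth_on_curve smooth_on_partial_deriv[OF surf cA] smooth_metric_chart)

lemma smooth_matrix_vector:
  assumes "smooth_on T M" "smooth_on T v"
  shows "smooth_on T (\<lambda>t. (M t :: real^2^2) *v v t)"
  unfolding matrix_vector_mult_def by (intro smooth_intros open_T assms)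

lemma smooth_matrix_inv: "smooth_on T (\<lambda>t. matrix_inv (g c (\<gamma> t)))"
proof -
  have "smooth_on T (\<lambda>t. (1 / det (g c (\<gamma> t))) *\<^sub>R (vector [vector [g c (\<gamma> t)$2$2, - g c (\<gamma> t)$1$2],
      vector [- g c (\<gamma> t)$2$1, g c (\<gamma> t)$1$1]] :: real^2^2))"
    unfolding smooth_on_componentwise[OF open_T]
    by (auto simp: forall_2 vector_2 det_2[symmetric] intro!: smooth_intros open_T smooth_metric inner_product_matrix_det metric_inner_product)
      (auto simp: det_2 intro!: smooth_intros open_T smooth_metric)
  then show ?thesis
    by (rule smooth_on_cong[OF open_T, rotated]) (simp add: matrix_inv_2 inner_product_matrix_det metric_inner_product)
qed

lemma smooth_raise: "smooth_on T \<omega> \<Longrightarrow> smooth_on T (\<lambda>t. raise g c (\<gamma> t) (\<omega> t))"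
  unfolding raise_def by (intro smooth_matrix_vector smooth_matrix_inv)

lemma smooth_ip: "smooth_on T \<alpha> \<Longrightarrow> smooth_on T \<beta> \<Longrightarrow> smooth_on T (\<lambda>t. ip t (\<alpha> t) (\<beta> t))"
  unfolding form_inner_def by (intro smooth_intros open_T smooth_raise)

lemma speed_sq_pos: "t \<in> T \<Longrightarrow> vel t \<bullet> (g c (\<gamma> t) *v vel t) > 0"
  using metric_inner_product vel_nonzero by (auto simp: inner_product_matrix_def)

lemma speed_eq: "sp t = sqrt (vel t \<bullet> (g c (\<gamma> t) *v vel t))"
  by (simp add: speed_def vel_def Let_def)

lemma speed_pos: "t \<in> T \<Longrightarrow> sp t > 0"
  using speed_sq_pos by (simp add: speed_eq)

lemma smooth_speed: "smooth_on T sp"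
proof -
  have "smooth_on T (\<lambda>t. sqrt (vel t \<bullet> (g c (\<gamma> t) *v vel t)))"
    by (intro smooth_intros open_T smooth_vel smooth_matrix_vector smooth_metric speed_sq_pos)
  then show ?thesis by (simp add: speed_eq[abs_def])
qed

lemma Uvec_eq: "U t = (1 / sp t) *\<^sub>R vel t"
  by (simp add: Uvec_def vel_def inverse_eq_divide)

lemma smooth_Uvec: "smooth_on T U"
  unfolding Uvec_eq[abs_def] by (intro smooth_intros open_T smooth_vel smooth_speed) (use speed_pos in force)

lemma smooth_Uform: "smooth_on T Uf"
  unfolding Uform_def[abs_def] by (intro smooth_matrix_vector smooth_metric smooth_Uvec)

text \<open>A normal form for computation: velocity in place of U, symbols of the first kind, and
  the speed as one common denominator. Smoothness, metric compatibility, change of chart and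
  rescaling all start from it.\<close>

lemma D1_eq:
  assumes "t \<in> T"
  shows "d1 \<omega> t $ b = (vector_derivative \<omega> (at t) $ b
    - (\<Sum>a\<in>UNIV. \<Sum>l\<in>UNIV. vel t $ a * raise g c (\<gamma> t) (\<omega> t) $ l * christoffel1 g c (\<gamma> t) l a b)) / sp t"
proof -
  have "(\<Sum>a\<in>UNIV. \<Sum>k\<in>UNIV. U t $ a * christoffel g c (\<gamma> t) k a b * \<omega> t $ k)
      = (\<Sum>a\<in>UNIV. U t $ a * (\<Sum>k\<in>UNIV. christoffel g c (\<gamma> t) k a b * \<omega> t $ k))"
    by (simp add: sum_distrib_left mult.assoc)
  also have "\<dots> = (\<Sum>a\<in>UNIV. \<Sum>l\<in>UNIV. vel t $ a * raise g c (\<gamma> t) (\<omega> t) $ l * christoffel1 g c (\<gamma> t) l a b) / sp t"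
    unfolding christoffel_contract[of g c, OF metric_inner_product[OF assms]]
    by (simp add: Uvec_eq sum_distrib_left sum_divide_distrib mult.assoc)
  finally show ?thesis by (simp add: D1_def diff_divide_distrib)
qed

lemma smooth_D1:
  assumes "smooth_on T \<omega>"
  shows "smooth_on T (d1 \<omega>)"
proof -
  have "smooth_on T (\<lambda>t. \<chi> b. (vector_derivative \<omega> (at t) $ b
    - (\<Sum>a\<in>UNIV. \<Sum>l\<in>UNIV. vel t $ a * raise g c (\<gamma> t) (\<omega> t) $ l * christoffel1 g c (\<gamma> t) l a b)) / sp t)"
    by (intro smooth_intros open_T smooth_on_vector_derivative smooth_speed smooth_vel smooth_raise assms
        smooth_christoffel1) (use speed_pos in force)
  then show ?thesis by (rule smooth_on_cong[OF open_T, rotated]) (simp add: vec_eq_iff D1_eq)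
qed

section \<open>Sum and product rules for the derivative along the curve\<close>

lemma D0_mult:
  assumes "smooth_on T f" "smooth_on T h" "t \<in> T"
  shows "d0 (\<lambda>s. f s * h s) t = d0 f t * h t + f t * d0 h t"
  unfolding D0_def
  using vector_derivative_at[OF has_vector_derivative_mult[OF smooth_on_has_vector_derivative[OF assms(1,3)]
      smooth_on_has_vector_derivative[OF assms(2,3)]]]
  by (simp add: add_divide_distrib)

lemma D0_add:
  assumes "smooth_on T f" "smooth_on T h" "t \<in> T"
  shows "d0 (\<lambda>s. f s + h s) t = d0 f t + d0 h t"
  unfolding D0_def
  using vector_derivative_at[OF has_vector_derivative_add[OF smooth_on_has_vector_derivative[OF assms(1,3)]
      smooth_on_has_vector_derivative[OF assms(2,3)]]]
  by (simp add: add_divide_distrib)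

lemma vector_derivative_cong_T:
  assumes "smooth_on T f" "\<And>s. s \<in> T \<Longrightarrow> f s = h s" "t \<in> T"
  shows "vector_derivative h (at t) = vector_derivative f (at t)"
  by (rule vector_derivative_at, rule has_vector_derivative_transform_within_open[OF _ open_T assms(3,2)])
    (rule smooth_on_has_vector_derivative[OF assms(1,3)])

lemma D0_cong: "smooth_on T f \<Longrightarrow> (\<And>s. s \<in> T \<Longrightarrow> f s = h s) \<Longrightarrow> t \<in> T \<Longrightarrow> d0 h t = d0 f t"
  unfolding D0_def using vector_derivative_cong_T by metis

lemma D1_cong: "smooth_on T f \<Longrightarrow> (\<And>s. s \<in> T \<Longrightarrow> f s = h s) \<Longrightarrow> t \<in> T \<Longrightarrow> d1 h t = d1 f t"
  unfolding D1_def using vector_derivative_cong_T[of f h t] by simp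

lemma D0_const: "d0 (\<lambda>s. k) t = 0"
  by (simp add: D0_def)

lemma D1_add:
  assumes "smooth_on T \<alpha>" "smooth_on T \<beta>" "t \<in> T"
  shows "d1 (\<lambda>s. \<alpha> s + \<beta> s) t = d1 \<alpha> t + d1 \<beta> t"
proof -
  have "vector_derivative (\<lambda>s. \<alpha> s + \<beta> s) (at t) = vector_derivative \<alpha> (at t) + vector_derivative \<beta> (at t)"
    using assms by (intro vector_derivative_at has_vector_derivative_add smooth_on_has_vector_derivative)
  then show ?thesis by (simp add: D1_def vec_eq_iff sum_2 add_divide_distrib algebra_simps)
qed

lemma D1_scaleR:
  assumes "smooth_on T f" "smooth_on T \<beta>" "t \<in> T"
  shows "d1 (\<lambda>s. f s *\<^sub>R \<beta> s) t = d0 f t *\<^sub>R \<beta> t + f t *\<^sub>R d1 \<beta> t"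
proof -
  have "vector_derivative (\<lambda>s. f s *\<^sub>R \<beta> s) (at t) = f t *\<^sub>R vector_derivative \<beta> (at t) + vector_derivative f (at t) *\<^sub>R \<beta> t"
    using assms smooth_on_has_vector_derivative[OF assms(1,3)]
    by (intro vector_derivative_at has_vector_derivative_scaleR smooth_on_has_vector_derivative)
      (auto simp: has_real_derivative_iff_has_vector_derivative)
  then show ?thesis by (simp add: D1_def D0_def vec_eq_iff sum_2 add_divide_distrib algebra_simps)
qed

lemma D1_minus:
  assumes "smooth_on T \<beta>" "t \<in> T"
  shows "d1 (\<lambda>s. - \<beta> s) t = - d1 \<beta> t"
  using D1_scaleR[OF smooth_on_const[OF open_T] assms, of "- 1"] by (simp add: D0_const)

lemma D1_diff:
  assumes "smooth_on T \<alpha>" "smooth_on T \<beta>" "t \<in> T"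
  shows "d1 (\<lambda>s. \<alpha> s - \<beta> s) t = d1 \<alpha> t - d1 \<beta> t"
  using D1_add[OF assms(1) smooth_on_uminus[OF open_T assms(2)] assms(3)] D1_minus[OF assms(2,3)] by simp

text \<open>Sections of the jerk line have wedge products in their two-form slot, and for these the
  connection terms distribute over the two factors.\<close>

lemma D2_wedge:
  assumes "smooth_on T \<alpha>" "smooth_on T \<beta>" "t \<in> T"
  shows "d2 (\<lambda>s. wedge (\<alpha> s) (\<beta> s)) t = wedge (d1 \<alpha> t) (\<beta> t) + wedge (\<alpha> t) (d1 \<beta> t)"
proof -
  have sm: "smooth_on T (\<lambda>s. wedge (\<alpha> s) (\<beta> s))"
    unfolding wedge_def by (intro smooth_intros open_T assms)
  have W: "vector_derivative (\<lambda>s. wedge (\<alpha> s) (\<beta> s)) (at t) $ i $ j =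
      vector_derivative \<alpha> (at t) $ i * \<beta> t $ j + \<alpha> t $ i * vector_derivative \<beta> (at t) $ j
      - (vector_derivative \<alpha> (at t) $ j * \<beta> t $ i + \<alpha> t $ j * vector_derivative \<beta> (at t) $ i)" for i j
  proof -
    note d = smooth_on_has_vector_derivative[OF assms(1,3)] smooth_on_has_vector_derivative[OF assms(2,3)]
    have "((\<lambda>s. wedge (\<alpha> s) (\<beta> s) $ i $ j) has_vector_derivative
        \<alpha> t $ i * vector_derivative \<beta> (at t) $ j + vector_derivative \<alpha> (at t) $ i * \<beta> t $ j
        - (\<alpha> t $ j * vector_derivative \<beta> (at t) $ i + vector_derivative \<alpha> (at t) $ j * \<beta> t $ i)) (at t)"
      unfolding wedge_def using d
      by (simp, intro has_vector_derivative_diff has_vector_derivative_mult has_vector_derivative_nth)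
    from vector_derivative_unique_at[OF this has_vector_derivative_nth[OF has_vector_derivative_nth[OF smooth_on_has_vector_derivative[OF sm assms(3)]]]]
    show ?thesis by (simp add: algebra_simps)
  qed
  have "d2 (\<lambda>s. wedge (\<alpha> s) (\<beta> s)) t $ i $ j = (wedge (d1 \<alpha> t) (\<beta> t) + wedge (\<alpha> t) (d1 \<beta> t)) $ i $ j" for i j
    by (simp only: D2_def vec_lambda_beta W)
      (simp add: D1_def wedge_def sum_2 diff_divide_distrib add_divide_distrib algebra_simps)
  then show ?thesis by (simp add: vec_eq_iff)
qed

text \<open>Compatibility of the Levi-Civita connection with the metric. Writing both covectors as
  lowered vectors, \<open>\<alpha> = G a\<close> and \<open>\<beta> = G b\<close>, replaces
  derivatives of the inverse metric by derivatives of G.\<close>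

lemma D0_form_inner:
  assumes "smooth_on T \<alpha>" "smooth_on T \<beta>" "t \<in> T"
  shows "d0 (\<lambda>s. ip s (\<alpha> s) (\<beta> s)) t = ip t (d1 \<alpha> t) (\<beta> t) + ip t (\<alpha> t) (d1 \<beta> t)"
proof -
  define G where "G = (\<lambda>s. g c (\<gamma> s))"
  define a where "a = (\<lambda>s. raise g c (\<gamma> s) (\<alpha> s))"
  define b where "b = (\<lambda>s. raise g c (\<gamma> s) (\<beta> s))"
  have sm: "smooth_on T a" "smooth_on T b" "smooth_on T G"
    unfolding a_def b_def G_def by (intro smooth_raise assms smooth_metric)+
  define G' where "G' = (\<lambda>i j. \<Sum>k\<in>UNIV. vel t $ k * partial_deriv c (\<lambda>q. g c q $ i $ j) (\<gamma> t) k)"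
  have dG: "((\<lambda>s. G s $ i $ j) has_vector_derivative G' i j) (at t)" for i j
    unfolding G_def G'_def by (rule vector_derivative_along_curve[OF differentiable_chart[OF smooth_metric_chart assms(3)] assms(3)])
  define a' where "a' = vector_derivative a (at t)"
  define b' where "b' = vector_derivative b (at t)"
  define \<alpha>' where "\<alpha>' = vector_derivative \<alpha> (at t)"
  define \<beta>' where "\<beta>' = vector_derivative \<beta> (at t)"
  have da: "((\<lambda>s. a s $ i) has_vector_derivative a' $ i) (at t)"
    and db: "((\<lambda>s. b s $ i) has_vector_derivative b' $ i) (at t)"
    and d\<alpha>: "((\<lambda>s. \<alpha> s $ i) has_vector_derivative \<alpha>' $ i) (at t)"
    and d\<beta>: "((\<lambda>s. \<beta> s $ i) has_vector_derivative \<beta>' $ i) (at t)" for i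
    unfolding a'_def b'_def \<alpha>'_def \<beta>'_def
    using has_vector_derivative_nth[OF smooth_on_has_vector_derivative] sm(1,2) assms by blast+
  have lower: "\<alpha> s $ i = (\<Sum>j\<in>UNIV. G s $ i $ j * a s $ j)"
    "\<beta> s $ i = (\<Sum>j\<in>UNIV. G s $ i $ j * b s $ j)" if "s \<in> T" for s i
    using lower_raise[of g c, OF metric_inner_product[OF that], of "\<alpha> s"] lower_raise[of g c, OF metric_inner_product[OF that], of "\<beta> s"]
    by (auto simp: a_def b_def G_def matrix_vector_mult_def vec_eq_iff)
  \<comment> \<open>Differentiating the lowering relation expresses the derivative of a covector by
    that of its raised vector plus the derivative of the metric.\<close>
  have d_lower: "\<omega>' i = (\<Sum>j\<in>UNIV. G t $ i $ j * w' $ j + G' i j * w t $ j)"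
    if "\<And>s. s \<in> T \<Longrightarrow> \<omega> s $ i = (\<Sum>j\<in>UNIV. G s $ i $ j * w s $ j)"
      "((\<lambda>s. \<omega> s $ i) has_vector_derivative \<omega>' i) (at t)"
      "\<And>i. ((\<lambda>s. w s $ i) has_vector_derivative w' $ i) (at t)" for \<omega> w :: "real \<Rightarrow> real^2" and w' \<omega>' and i
  proof -
    have "((\<lambda>s. \<Sum>j\<in>UNIV. G s $ i $ j * w s $ j) has_vector_derivative
        (\<Sum>j\<in>UNIV. G t $ i $ j * w' $ j + G' i j * w t $ j)) (at t)"
      by (intro has_vector_derivative_sum has_vector_derivative_mult dG that(3))
    then have "((\<lambda>s. \<omega> s $ i) has_vector_derivative
        (\<Sum>j\<in>UNIV. G t $ i $ j * w' $ j + G' i j * w t $ j)) (at t)"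
      by (rule has_vector_derivative_transform_within_open[OF _ open_T assms(3)]) (simp add: that(1))
    then show ?thesis using that(2) vector_derivative_unique_at by blast
  qed
  have \<alpha>': "\<alpha>' $ i = (\<Sum>j\<in>UNIV. G t $ i $ j * a' $ j + G' i j * a t $ j)"
    and \<beta>': "\<beta>' $ i = (\<Sum>j\<in>UNIV. G t $ i $ j * b' $ j + G' i j * b t $ j)" for i
    by (rule d_lower[where \<omega>' = "\<lambda>i. \<alpha>' $ i", OF lower(1) d\<alpha> da] d_lower[where \<omega>' = "\<lambda>i. \<beta>' $ i", OF lower(2) d\<beta> db]; assumption)+
  have "((\<lambda>s. \<Sum>i\<in>UNIV. \<alpha> s $ i * b s $ i) has_vector_derivative (\<Sum>i\<in>UNIV. \<alpha> t $ i * b' $ i + \<alpha>' $ i * b t $ i)) (at t)"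
    by (intro has_vector_derivative_sum has_vector_derivative_mult d\<alpha> db)
  then have dip: "vector_derivative (\<lambda>s. ip s (\<alpha> s) (\<beta> s)) (at t) = (\<Sum>i\<in>UNIV. \<alpha> t $ i * b' $ i + \<alpha>' $ i * b t $ i)"
    by (simp add: vector_derivative_at form_inner_def inner_vec_def b_def)
  have Gsym: "G t $ 2 $ 1 = G t $ 1 $ 2" using metric_sym[OF T_cdom[OF assms(3)]] by (simp add: G_def)
  have sym': "partial_deriv c (\<lambda>q. g c q $ 2 $ 1) (\<gamma> t) k = partial_deriv c (\<lambda>q. g c q $ 1 $ 2) (\<gamma> t) k" for k
    by (rule partial_deriv_metric_sym[OF T_cdom[OF assms(3)]])
  have r: "raise g c (\<gamma> t) (\<alpha> t) = a t" "raise g c (\<gamma> t) (\<beta> t) = b t" by (simp_all add: a_def b_def)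
  have ip1: "ip t (d1 \<alpha> t) (\<beta> t) = (\<Sum>i\<in>UNIV. d1 \<alpha> t $ i * b t $ i)"
    by (simp add: form_inner_def b_def inner_vec_def)
  have ip2: "ip t (\<alpha> t) (d1 \<beta> t) = (\<Sum>i\<in>UNIV. a t $ i * d1 \<beta> t $ i)"
    using raise_inner[of g c, OF metric_inner_product[OF assms(3)], of "\<alpha> t"] by (simp add: a_def inner_vec_def)
  define N where "N = (\<lambda>\<omega>' w i. \<omega>' i - (\<Sum>k\<in>UNIV. \<Sum>l\<in>UNIV. vel t $ k * w $ l * christoffel1 g c (\<gamma> t) l k i))"
  have D: "d1 \<alpha> t $ i = N (\<lambda>i. \<alpha>' $ i) (a t) i / sp t" "d1 \<beta> t $ i = N (\<lambda>i. \<beta>' $ i) (b t) i / sp t" for i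
    unfolding D1_eq[OF assms(3)] r N_def \<alpha>'_def \<beta>'_def by simp_all
  \<comment> \<open>The remaining terms match by Gamma_{l,ki} + Gamma_{i,kl} = d_k g_{il}, which the
    definition of the symbols yields after cancellation.\<close>
  have "(\<Sum>i\<in>UNIV. \<alpha> t $ i * b' $ i + \<alpha>' $ i * b t $ i)
      = (\<Sum>i\<in>UNIV. N (\<lambda>i. \<alpha>' $ i) (a t) i * b t $ i) + (\<Sum>i\<in>UNIV. a t $ i * N (\<lambda>i. \<beta>' $ i) (b t) i)"
    unfolding N_def \<alpha>' \<beta>' lower(1)[OF assms(3)] G'_def christoffel1_def
    by (simp add: sum_2 Gsym sym' field_simps)
  then show ?thesis
    unfolding D0_def dip ip1 ip2 D by (simp add: add_divide_distrib sum_divide_distrib)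
qed

end

section \<open>Change of chart\<close>

lemma partial_deriv_mult:
  assumes "(f \<circ> cinv c) differentiable (at (coord c p))" "(h \<circ> cinv c) differentiable (at (coord c p))"
    and "cinv c (coord c p) = p"
  shows "partial_deriv c (\<lambda>q. f q * h q) p i = partial_deriv c f p i * h p + f p * partial_deriv c h p i"
proof -
  have "((\<lambda>y. (f \<circ> cinv c) y * (h \<circ> cinv c) y) has_derivative
      (\<lambda>v. (f \<circ> cinv c) (coord c p) * frechet_derivative (h \<circ> cinv c) (at (coord c p)) v
        + frechet_derivative (f \<circ> cinv c) (at (coord c p)) v * (h \<circ> cinv c) (coord c p))) (at (coord c p))"
    by (intro has_derivative_mult assms(1,2)[unfolded frechet_derivative_works])
  from fun_cong[OF frechet_derivative_at[OF this], of "axis i 1"] show ?thesis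
    using assms(3) by (simp add: partial_deriv_def o_def)
qed

lemma partial_deriv_add:
  assumes "(f \<circ> cinv c) differentiable (at (coord c p))" "(h \<circ> cinv c) differentiable (at (coord c p))"
  shows "partial_deriv c (\<lambda>q. f q + h q) p i = partial_deriv c f p i + partial_deriv c h p i"
proof -
  have "((\<lambda>y. (f \<circ> cinv c) y + (h \<circ> cinv c) y) has_derivative
      (\<lambda>v. frechet_derivative (f \<circ> cinv c) (at (coord c p)) v
        + frechet_derivative (h \<circ> cinv c) (at (coord c p)) v)) (at (coord c p))"
    by (intro has_derivative_add assms(1,2)[unfolded frechet_derivative_works])
  from fun_cong[OF frechet_derivative_at[OF this], of "axis i 1"] show ?thesis
    by (simp add: partial_deriv_def o_def)
qed

section \<open>Pull-back of covectors and two-tensors\<close>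

lemma pull1_nth: "pull1 J \<omega> $ b = (\<Sum>k\<in>UNIV. J $ k $ b * \<omega> $ k)"
  by (simp add: pull1_def matrix_vector_mult_def transpose_def)

lemma pull2_nth: "pull2 J M $ i $ j = (\<Sum>m\<in>UNIV. \<Sum>n\<in>UNIV. J $ m $ i * M $ m $ n * J $ n $ j)"
  by (simp add: pull2_def matrix_matrix_mult_def transpose_def sum_2 algebra_simps)

lemma pull1_linear:
  "pull1 J (\<alpha> + \<beta>) = pull1 J \<alpha> + pull1 J \<beta>"
  "pull1 J (\<alpha> - \<beta>) = pull1 J \<alpha> - pull1 J \<beta>"
  "pull1 J (r *\<^sub>R \<alpha>) = r *\<^sub>R pull1 J \<alpha>"
  "pull1 J 0 = 0"
  by (simp_all add: vec_eq_iff pull1_nth sum_2 algebra_simps)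

lemma pull2_wedge: "pull2 J (wedge \<alpha> \<beta>) = wedge (pull1 J \<alpha>) (pull1 J \<beta>)"
  by (simp add: vec_eq_iff pull1_nth pull2_nth wedge_def sum_2 algebra_simps)

lemma pull2_scaleR: "pull2 J (r *\<^sub>R M) = r *\<^sub>R pull2 J M"
  by (simp add: vec_eq_iff pull2_nth sum_2 algebra_simps)

lemma pull2_vector: "pull2 J M *v v = pull1 J (M *v (J *v v))"
  by (simp add: vec_eq_iff pull1_nth pull2_nth matrix_vector_mult_def sum_2 algebra_simps)

locale two_charts =
  C: chart_curve A I \<gamma> c g + D: chart_curve A I \<gamma> d g
  for A :: "'a::{t2_space,second_countable_topology} chart set" and I \<gamma> c d g
begin

definition overlap where "overlap = coord c ` (cdom c \<inter> cdom d)"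

definition J where "J p = transition c d p"

text \<open>Second derivatives of the transition map from c to d, the source of the inhomogeneous
  term in the law for the Christoffel symbols.\<close>

definition H where "H m i k p = partial_deriv c (\<lambda>q. J q $ m $ i) p k"

lemma open_overlap: "open overlap"
proof -
  note hc = smooth_surfaceD[OF C.surf C.cA]
  have cont: "continuous_on (coord c ` cdom c) (cinv c)" and im: "cinv c ` coord c ` cdom c = cdom c"
    using hc(3) by (auto simp: homeomorphism_def)
  have "open (coord c ` cdom c \<inter> cinv c -` cdom d)"
    by (rule continuous_open_preimage[OF cont hc(2) smooth_surfaceD(1)[OF D.surf D.cA]])
  moreover have "coord c ` cdom c \<inter> cinv c -` cdom d = overlap"
    using cinv_coord[OF C.surf C.cA] by (auto simp: overlap_def)
  ultimately show ?thesis by simp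
qed

lemma overlap_cinv: "y \<in> overlap \<Longrightarrow> coord c (cinv c y) = y"
  by (auto simp: overlap_def cinv_coord[OF C.surf C.cA])

lemma smooth_transition: "smooth_on overlap (coord d \<circ> cinv c)"
  using C.surf C.cA D.cA by (auto simp: smooth_surface_def overlap_def)

lemma smooth_transition_nth: "smooth_on overlap ((\<lambda>q. coord d q $ m) \<circ> cinv c)"
  using smooth_on_nth[OF open_overlap smooth_transition] by (simp add: o_def)

lemma J_eq:
  assumes "p \<in> cdom c \<inter> cdom d"
  shows "J p $ m $ i = partial_deriv c (\<lambda>q. coord d q $ m) p i"
proof -
  have x: "coord c p \<in> overlap" using assms by (simp add: overlap_def)
  have d: "(coord d \<circ> cinv c has_derivative frechet_derivative (coord d \<circ> cinv c) (at (coord c p))) (at (coord c p))"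
    using smooth_on_differentiable[OF smooth_transition x] by (simp add: frechet_derivative_works)
  have "((\<lambda>q. coord d q $ m) \<circ> cinv c has_derivative
      (\<lambda>v. frechet_derivative (coord d \<circ> cinv c) (at (coord c p)) v $ m)) (at (coord c p))"
    using bounded_linear.has_derivative[OF bounded_linear_vec_nth d] by (simp add: o_def)
  from fun_cong[OF frechet_derivative_at[OF this], of "axis i 1"] show ?thesis
    by (simp add: partial_deriv_def J_def transition_def jacobian_def matrix_def)
qed

lemma J_chart_eq:
  "y \<in> overlap \<Longrightarrow> ((\<lambda>q. J q $ m $ i) \<circ> cinv c) y
    = frechet_derivative ((\<lambda>q. coord d q $ m) \<circ> cinv c) (at y) (axis i 1)"
  using J_eq[of "cinv c y" m i] overlap_cinv[of y] cinv_coord[OF C.surf C.cA]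
  by (auto simp: overlap_def partial_deriv_def)

lemma smooth_J: "smooth_on overlap ((\<lambda>q. J q $ m $ i) \<circ> cinv c)"
  by (rule smooth_on_cong[OF open_overlap J_chart_eq[symmetric] smooth_on_frechet_derivative[OF smooth_transition_nth]])

lemma frechet_derivative_J:
  assumes "y \<in> overlap"
  shows "frechet_derivative ((\<lambda>q. J q $ m $ i) \<circ> cinv c) (at y)
    = frechet_derivative (\<lambda>y. frechet_derivative ((\<lambda>q. coord d q $ m) \<circ> cinv c) (at y) (axis i 1)) (at y)"
  by (rule frechet_derivative_transform_within_open[OF smooth_on_differentiable[OF smooth_J assms] open_overlap assms J_chart_eq])

text \<open>Near the point the entries of \<open>J\<close> are directional derivatives of the scalar
  coordinates of d, so this is the symmetry of mixed derivatives.\<close>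

lemma H_sym: "p \<in> cdom c \<inter> cdom d \<Longrightarrow> H m i k p = H m k i p"
  unfolding H_def partial_deriv_def
  using smooth_on_mixed_derivatives[OF open_overlap smooth_transition_nth, of "coord c p" m "axis i 1" "axis k 1"]
  by (simp add: frechet_derivative_J overlap_def)

text \<open>Smoothness is given in chart d while the derivative is taken in chart c; on the overlap
  the two coordinate expressions differ by the transition map.\<close>

lemma partial_deriv_chain:
  assumes "smooth_on (coord d ` cdom d) (f \<circ> cinv d)" "p \<in> cdom c \<inter> cdom d"
  shows "(f \<circ> cinv c) differentiable (at (coord c p))"
    and "partial_deriv c f p k = (\<Sum>e\<in>UNIV. J p $ e $ k * partial_deriv d f p e)"
proof -
  have x: "coord c p \<in> overlap" using assms by (simp add: overlap_def)
  have cc: "cinv c (coord c p) = p" using cinv_coord[OF C.surf C.cA] assms(2) by simp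
  have d1: "(coord d \<circ> cinv c) differentiable (at (coord c p))"
    by (rule smooth_on_differentiable[OF smooth_transition x])
  have d2: "(f \<circ> cinv d) differentiable (at (coord d p))"
    by (rule smooth_on_differentiable[OF assms(1)]) (use assms(2) in auto)
  have "((f \<circ> cinv d) \<circ> (coord d \<circ> cinv c) has_derivative
      frechet_derivative (f \<circ> cinv d) (at (coord d p)) \<circ> frechet_derivative (coord d \<circ> cinv c) (at (coord c p)))
      (at (coord c p))"
    using d1 d2 cc by (intro diff_chain_at) (simp_all add: frechet_derivative_works)
  then have D: "(f \<circ> cinv c has_derivative
      frechet_derivative (f \<circ> cinv d) (at (coord d p)) \<circ> frechet_derivative (coord d \<circ> cinv c) (at (coord c p)))
      (at (coord c p))"
    by (rule has_derivative_transform_within_open[OF _ open_overlap x])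
      (auto simp: overlap_def cinv_coord[OF C.surf C.cA] cinv_coord[OF D.surf D.cA])
  then show "(f \<circ> cinv c) differentiable (at (coord c p))" by (auto simp: differentiable_def)
  have "partial_deriv c f p k = frechet_derivative (f \<circ> cinv d) (at (coord d p))
      (frechet_derivative (coord d \<circ> cinv c) (at (coord c p)) (axis k 1))"
    using frechet_derivative_at[OF D] by (simp add: partial_deriv_def o_def fun_eq_iff)
  also have "\<dots> = (\<Sum>e\<in>UNIV. J p $ e $ k * partial_deriv d f p e)"
    by (subst frechet_derivative_sum_axis[OF d2])
      (simp add: partial_deriv_def J_def transition_def jacobian_def matrix_def)
  finally show "partial_deriv c f p k = (\<Sum>e\<in>UNIV. J p $ e $ k * partial_deriv d f p e)" .
qed

lemma metric_pull: "p \<in> cdom c \<inter> cdom d \<Longrightarrow> g c p = pull2 (J p) (g d p)"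
  using C.metric C.cA D.cA unfolding riemannian_metric_def symmetric_tensor2_def J_def by blast

lemma partial_deriv_metric:
  assumes p: "p \<in> cdom c \<inter> cdom d"
  shows "partial_deriv c (\<lambda>q. g c q $ i $ j) p k = (\<Sum>m\<in>UNIV. \<Sum>n\<in>UNIV.
    H m i k p * g d p $ m $ n * J p $ n $ j
    + J p $ m $ i * (\<Sum>e\<in>UNIV. J p $ e $ k * partial_deriv d (\<lambda>q. g d q $ m $ n) p e) * J p $ n $ j
    + J p $ m $ i * g d p $ m $ n * H n j k p)"
proof -
  have x: "coord c p \<in> overlap" using p by (simp add: overlap_def)
  have cc: "cinv c (coord c p) = p" using cinv_coord[OF C.surf C.cA] p by simp
  define f where "f = (\<lambda>m n q. J q $ m $ i * g d q $ m $ n * J q $ n $ j)"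
  have dJ: "((\<lambda>q. J q $ m $ i) \<circ> cinv c) differentiable (at (coord c p))" for m i
    by (rule smooth_on_differentiable[OF smooth_J x])
  note dg = partial_deriv_chain[OF D.smooth_metric_chart p]
  have dJg: "((\<lambda>q. J q $ m $ i * g d q $ m $ n) \<circ> cinv c) differentiable (at (coord c p))" for m n
    using differentiable_mult[OF dJ dg(1)] by (simp add: o_def)
  have df: "(f m n \<circ> cinv c) differentiable (at (coord c p))" for m n
    using differentiable_mult[OF dJg dJ] by (simp add: o_def f_def)
  have df2: "((\<lambda>q. f m 1 q + f m 2 q) \<circ> cinv c) differentiable (at (coord c p))" for m
    using differentiable_add[OF df df] by (simp add: o_def)
  have pf: "partial_deriv c (f m n) p k = H m i k p * g d p $ m $ n * J p $ n $ j
    + J p $ m $ i * (\<Sum>e\<in>UNIV. J p $ e $ k * partial_deriv d (\<lambda>q. g d q $ m $ n) p e) * J p $ n $ j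
    + J p $ m $ i * g d p $ m $ n * H n j k p" for m n
    unfolding f_def partial_deriv_mult[OF dJg dJ cc] partial_deriv_mult[OF dJ dg(1) cc] dg(2) H_def
    by (simp add: algebra_simps)
  have "partial_deriv c (\<lambda>q. g c q $ i $ j) p k
      = partial_deriv c (\<lambda>q. (f 1 1 q + f 1 2 q) + (f 2 1 q + f 2 2 q)) p k"
  proof -
    \<comment> \<open>The pull-back law is available on the common domain only, so the derivatives
      are compared on its open coordinate image.\<close>
    have eq: "((\<lambda>q. g c q $ i $ j) \<circ> cinv c) y
        = ((\<lambda>q. (f 1 1 q + f 1 2 q) + (f 2 1 q + f 2 2 q)) \<circ> cinv c) y" if "y \<in> overlap" for y
    proof -
      have "cinv c y \<in> cdom c \<inter> cdom d"
        using that cinv_coord[OF C.surf C.cA] by (auto simp: overlap_def)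
      then show ?thesis by (simp add: metric_pull pull2_nth f_def sum_2)
    qed
    have "((\<lambda>q. g c q $ i $ j) \<circ> cinv c) differentiable (at (coord c p))"
      by (rule smooth_on_differentiable[OF C.smooth_metric_chart]) (use p in auto)
    from frechet_derivative_transform_within_open[OF this open_overlap x eq]
    show ?thesis by (simp only: partial_deriv_def)
  qed
  also have "\<dots> = (\<Sum>m\<in>UNIV. \<Sum>n\<in>UNIV. partial_deriv c (f m n) p k)"
    by (simp add: partial_deriv_add[OF df2 df2] partial_deriv_add[OF df df] sum_2)
  finally show ?thesis unfolding pf .
qed

text \<open>Differentiating the pulled-back metric gives six products with second derivatives of the
  transition map. By the symmetries of \<open>H\<close> and of the metric four of them cancel in
  pairs, and the other two coincide and absorb the factor 1/2.\<close>

lemma christoffel1_pull: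
  assumes p: "p \<in> cdom c \<inter> cdom d"
  shows "christoffel1 g c p l i j = (\<Sum>m\<in>UNIV. J p $ m $ l *
    ((\<Sum>a\<in>UNIV. \<Sum>b\<in>UNIV. J p $ a $ i * J p $ b $ j * christoffel1 g d p m a b)
      + (\<Sum>n\<in>UNIV. g d p $ m $ n * H n i j p)))"
proof -
  have H21: "H m 2 1 p = H m 1 2 p" for m by (rule H_sym[OF p])
  have s: "g d p $ 2 $ 1 = g d p $ 1 $ 2" using D.metric_sym p by simp
  have s': "partial_deriv d (\<lambda>q. g d q $ 2 $ 1) p k = partial_deriv d (\<lambda>q. g d q $ 1 $ 2) p k" for k
    using D.partial_deriv_metric_sym p by simp
  \<comment> \<open>With concrete indices the symmetries of \<open>H\<close> and of the metric act
    as rewrite rules from 21 to 12, which makes the cancellation visible to simplification.\<close>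
  consider "i = 1" "j = 1" "l = 1" | "i = 1" "j = 1" "l = 2" | "i = 1" "j = 2" "l = 1" | "i = 1" "j = 2" "l = 2"
    | "i = 2" "j = 1" "l = 1" | "i = 2" "j = 1" "l = 2" | "i = 2" "j = 2" "l = 1" | "i = 2" "j = 2" "l = 2"
    using exhaust_2 by metis
  then show ?thesis
    by cases (simp_all add: christoffel1_def partial_deriv_metric[OF p] sum_2 H21 s s' field_simps)
qed

lemma vel_eq:
  assumes "t \<in> C.T" "t \<in> D.T"
  shows "D.vel t = J (\<gamma> t) *v C.vel t"
proof -
  have p: "\<gamma> t \<in> cdom c \<inter> cdom d" using assms C.T_cdom D.T_cdom by simp
  have "((\<lambda>s. coord d (\<gamma> s) $ m) has_vector_derivative
      (\<Sum>i\<in>UNIV. C.vel t $ i * partial_deriv c (\<lambda>q. coord d q $ m) (\<gamma> t) i)) (at t)" for m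
    by (rule C.vector_derivative_along_curve[OF smooth_on_differentiable[OF smooth_transition_nth] assms(1)])
      (use p in \<open>simp add: overlap_def\<close>)
  moreover have "((\<lambda>s. coord d (\<gamma> s) $ m) has_vector_derivative D.vel t $ m) (at t)" for m
    using has_vector_derivative_nth[OF smooth_on_has_vector_derivative[OF D.smooth_coord assms(2)]]
    by (simp add: D.vel_def)
  ultimately have "D.vel t $ m = (\<Sum>i\<in>UNIV. C.vel t $ i * partial_deriv c (\<lambda>q. coord d q $ m) (\<gamma> t) i)" for m
    using vector_derivative_unique_at by blast
  then show ?thesis
    by (simp add: vec_eq_iff matrix_vector_mult_def J_eq[OF p] mult.commute)
qed

section \<open>Curve quantities under change of chart\<close>

lemma J_inner: "(J p *v v) \<bullet> \<omega> = v \<bullet> pull1 (J p) \<omega>"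
  by (simp add: inner_vec_def matrix_vector_mult_def pull1_nth sum_2 algebra_simps)

lemma metric_vector_pull:
  "p \<in> cdom c \<inter> cdom d \<Longrightarrow> g c p *v v = pull1 (J p) (g d p *v (J p *v v))"
  by (simp add: metric_pull pull2_vector)

lemma speed_chart: "t \<in> C.T \<Longrightarrow> t \<in> D.T \<Longrightarrow> speed \<gamma> g c t = speed \<gamma> g d t"
  unfolding C.speed_eq D.speed_eq
  using C.T_cdom D.T_cdom by (simp add: vel_eq J_inner metric_vector_pull)

lemma Uvec_chart:
  assumes "t \<in> C.T" "t \<in> D.T"
  shows "Uvec \<gamma> g d t = J (\<gamma> t) *v Uvec \<gamma> g c t"
  unfolding C.Uvec_eq D.Uvec_eq speed_chart[OF assms] vel_eq[OF assms]
  by (simp add: vec_eq_iff matrix_vector_mult_def sum_2 algebra_simps)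

lemma Uform_chart:
  "t \<in> C.T \<Longrightarrow> t \<in> D.T \<Longrightarrow> Uform \<gamma> g c t = pull1 (J (\<gamma> t)) (Uform \<gamma> g d t)"
  unfolding Uform_def using C.T_cdom D.T_cdom by (simp add: Uvec_chart metric_vector_pull)

text \<open>The relation det g_c = (det J)^2 det g_d and nondegeneracy of the metric show that J is
  invertible.\<close>

lemma pull1_J_inj:
  assumes "t \<in> C.T" "t \<in> D.T" "pull1 (J (\<gamma> t)) \<alpha> = pull1 (J (\<gamma> t)) \<beta>"
  shows "\<alpha> = \<beta>"
proof -
  have p: "\<gamma> t \<in> cdom c \<inter> cdom d" using assms C.T_cdom D.T_cdom by simp
  have "det (g c (\<gamma> t)) \<noteq> 0" by (rule inner_product_matrix_det[OF C.metric_inner_product[OF assms(1)]])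
  then have "det (J (\<gamma> t)) \<noteq> 0"
    by (auto simp: metric_pull[OF p] pull2_def det_mul)
  then have "invertible (transpose (J (\<gamma> t)))" by (simp add: invertible_det_nz)
  then show ?thesis using assms(3) inj_matrix_vector_mult unfolding pull1_def inj_def by blast
qed

text \<open>A raised covector is characterised by what it lowers to, so it suffices to lower with
  \<open>g d\<close> and cancel the pull-back.\<close>

lemma raise_chart:
  assumes "t \<in> C.T" "t \<in> D.T"
  shows "J (\<gamma> t) *v raise g c (\<gamma> t) (pull1 (J (\<gamma> t)) \<omega>) = raise g d (\<gamma> t) \<omega>"
proof -
  have p: "\<gamma> t \<in> cdom c \<inter> cdom d" using assms C.T_cdom D.T_cdom by simp
  let ?w = "raise g c (\<gamma> t) (pull1 (J (\<gamma> t)) \<omega>)"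
  have "g c (\<gamma> t) *v ?w = pull1 (J (\<gamma> t)) \<omega>"
    by (rule lower_raise[of g c "\<gamma> t", OF C.metric_inner_product[OF assms(1)]])
  then have "g d (\<gamma> t) *v (J (\<gamma> t) *v ?w) = \<omega>"
    unfolding metric_vector_pull[OF p] by (rule pull1_J_inj[OF assms])
  then show ?thesis
    using raise_lower[of g d "\<gamma> t" "J (\<gamma> t) *v ?w", OF D.metric_inner_product[OF assms(2)]] by simp
qed

lemma form_inner_chart:
  assumes "t \<in> C.T" "t \<in> D.T"
  shows "form_inner g c (\<gamma> t) (pull1 (J (\<gamma> t)) \<alpha>) (pull1 (J (\<gamma> t)) \<beta>) = form_inner g d (\<gamma> t) \<alpha> \<beta>"
proof -
  have "form_inner g c (\<gamma> t) (pull1 (J (\<gamma> t)) \<alpha>) (pull1 (J (\<gamma> t)) \<beta>)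
      = (J (\<gamma> t) *v raise g c (\<gamma> t) (pull1 (J (\<gamma> t)) \<beta>)) \<bullet> \<alpha>"
    unfolding form_inner_def J_inner by (rule inner_commute)
  then show ?thesis unfolding raise_chart[OF assms] form_inner_def by (simp add: inner_commute)
qed

text \<open>Differentiating a pulled-back covector produces a term with the derivative of J; it is
  compensated by the inhomogeneous term of the Christoffel symbols.\<close>

lemma D1_chart:
  assumes t: "t \<in> C.T" "t \<in> D.T" and sm: "smooth_on C.T \<alpha>" "smooth_on D.T \<omega>"
    and eq: "\<And>s. s \<in> C.T \<Longrightarrow> s \<in> D.T \<Longrightarrow> \<alpha> s = pull1 (J (\<gamma> s)) (\<omega> s)"
  shows "D1 \<gamma> g c \<alpha> t = pull1 (J (\<gamma> t)) (D1 \<gamma> g d \<omega> t)"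
proof -
  have p: "\<gamma> t \<in> cdom c \<inter> cdom d" using t C.T_cdom D.T_cdom by simp
  define \<omega>' where "\<omega>' = vector_derivative \<omega> (at t)"
  define w where "w = raise g c (\<gamma> t) (\<alpha> t)"
  define v where "v = C.vel t"
  define j where "j = J (\<gamma> t)"
  define u where "u = raise g d (\<gamma> t) (\<omega> t)"
  have u: "u = j *v w" using raise_chart[OF t] eq[OF t] by (simp add: u_def j_def w_def)
  have dJ: "((\<lambda>s. J (\<gamma> s) $ k $ b) has_vector_derivative (\<Sum>a\<in>UNIV. v $ a * H k b a (\<gamma> t))) (at t)" for k b
    unfolding H_def v_def
    by (rule C.vector_derivative_along_curve[OF smooth_on_differentiable[OF smooth_J] t(1)])
      (use p in \<open>simp add: overlap_def\<close>)
  have d\<omega>: "((\<lambda>s. \<omega> s $ k) has_vector_derivative \<omega>' $ k) (at t)" for k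
    unfolding \<omega>'_def by (rule has_vector_derivative_nth[OF smooth_on_has_vector_derivative[OF sm(2) t(2)]])
  have opn: "open (C.T \<inter> D.T)" using C.open_T D.open_T by auto
  have d\<alpha>: "vector_derivative \<alpha> (at t) $ b
      = (\<Sum>k\<in>UNIV. j $ k $ b * \<omega>' $ k + (\<Sum>a\<in>UNIV. v $ a * H k b a (\<gamma> t)) * \<omega> t $ k)" for b
  proof -
    have "((\<lambda>s. \<Sum>k\<in>UNIV. J (\<gamma> s) $ k $ b * \<omega> s $ k) has_vector_derivative
        (\<Sum>k\<in>UNIV. J (\<gamma> t) $ k $ b * \<omega>' $ k + (\<Sum>a\<in>UNIV. v $ a * H k b a (\<gamma> t)) * \<omega> t $ k)) (at t)"
      by (intro has_vector_derivative_sum has_vector_derivative_mult dJ d\<omega>)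
    then have "((\<lambda>s. \<alpha> s $ b) has_vector_derivative
        (\<Sum>k\<in>UNIV. J (\<gamma> t) $ k $ b * \<omega>' $ k + (\<Sum>a\<in>UNIV. v $ a * H k b a (\<gamma> t)) * \<omega> t $ k)) (at t)"
      by (rule has_vector_derivative_transform_within_open[OF _ opn]) (use t eq in \<open>auto simp: pull1_nth\<close>)
    from vector_derivative_unique_at[OF has_vector_derivative_nth[OF smooth_on_has_vector_derivative[OF sm(1) t(1)]] this]
    show ?thesis by (simp add: j_def)
  qed
  \<comment> \<open>Expressing \<open>\<omega>\<close> through its raised components u gives the
    derivative of J the same shape, H times g times u, as the inhomogeneous term of
    \<open>christoffel1_pull\<close>, so that both cancel.\<close>
  have \<omega>: "\<omega> t $ n = (\<Sum>m\<in>UNIV. g d (\<gamma> t) $ n $ m * u $ m)" for n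
    using lower_raise[of g d "\<gamma> t" "\<omega> t", OF D.metric_inner_product[OF t(2)]]
    by (simp add: u_def matrix_vector_mult_def vec_eq_iff)
  have gs: "g d (\<gamma> t) $ 2 $ 1 = g d (\<gamma> t) $ 1 $ 2" using D.metric_sym p by simp
  have H21: "H m 2 1 (\<gamma> t) = H m 1 2 (\<gamma> t)" for m by (rule H_sym[OF p])
  have "vector_derivative \<alpha> (at t) $ b - (\<Sum>a\<in>UNIV. \<Sum>l\<in>UNIV. v $ a * w $ l * christoffel1 g c (\<gamma> t) l a b)
      = (\<Sum>k\<in>UNIV. j $ k $ b * (\<omega>' $ k -
          (\<Sum>a\<in>UNIV. \<Sum>l\<in>UNIV. (j *v v) $ a * u $ l * christoffel1 g d (\<gamma> t) l a k)))" for b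
    using exhaust_2[of b]
    by (auto simp: d\<alpha> \<omega> u christoffel1_pull[OF p] j_def[symmetric] matrix_vector_mult_def sum_2 gs H21 algebra_simps)
  then have "D1 \<gamma> g c \<alpha> t $ b = pull1 (J (\<gamma> t)) (D1 \<gamma> g d \<omega> t) $ b" for b
    unfolding C.D1_eq[OF t(1)] pull1_nth D.D1_eq[OF t(2)]
    by (simp add: w_def v_def vel_eq[OF t] j_def u_def \<omega>'_def speed_chart[OF t] sum_divide_distrib)
  then show ?thesis by (simp add: vec_eq_iff)
qed

end

section \<open>Normalised jerk and its tractor\<close>

lemma symmetric_tensor2D:
  assumes "symmetric_tensor2 A S" "c \<in> A"
  shows "smooth_on (coord c ` cdom c) (S c \<circ> cinv c)"
    and "p \<in> cdom c \<Longrightarrow> transpose (S c p) = S c p"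
    and "d \<in> A \<Longrightarrow> p \<in> cdom c \<inter> cdom d \<Longrightarrow> S c p = pull2 (transition c d p) (S d p)"
  using assms unfolding symmetric_tensor2_def smooth_field_def by blast+

lemma symmetric_vector_matrix: "transpose M = M \<Longrightarrow> v v* (M :: real^2^2) = M *v v"
  by (metis transpose_matrix_vector)

locale jerk_curve = chart_curve A I \<gamma> c g
  for A :: "'a::{t2_space,second_countable_topology} chart set" and I \<gamma> c g +
  fixes P :: "'a tensor2 \<Rightarrow> 'a tensor2"
  assumes rho: "symmetric_tensor2 A (P g)"
    and jerk_nonzero: "\<And>t. t \<in> T \<Longrightarrow> jerk P \<gamma> g c t \<noteq> 0"
begin

abbreviation "jk \<equiv> jerk P \<gamma> g c"

definition PU where "PU t = P g c (\<gamma> t) *v U t"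

text \<open>The equation for \<kappa> paired with J; the U-term drops because U and J are
  orthogonal. The closed formula in one chart makes smoothness evident.\<close>

definition kap where "kap t = - ip t (d1 jk t) (jk t) / (2 * ip t (jk t) (jk t))"

section \<open>Orthogonality relations between U, A and J\<close>

lemma ip_commute: "t \<in> T \<Longrightarrow> ip t \<alpha> \<beta> = ip t \<beta> \<alpha>"
  by (rule form_inner_commute[of g c "\<gamma> t", OF metric_inner_product])

lemma U_inner: "t \<in> T \<Longrightarrow> U t \<bullet> \<omega> = ip t (Uf t) \<omega>"
  unfolding Uform_def by (rule inner_eq_form_inner[of g c "\<gamma> t", OF metric_inner_product])

lemma smooth_PU: "smooth_on T PU"
proof -
  have "smooth_on T (\<lambda>t. P g c (\<gamma> t))"
    by (rule smooth_on_curve[OF symmetric_tensor2D(1)[OF rho cA]])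
  then show ?thesis unfolding PU_def[abs_def] by (intro smooth_matrix_vector smooth_Uvec)
qed

lemma accel_eq: "acc t = d1 Uf t"
  by (simp add: accel_def)

lemma smooth_accel: "smooth_on T acc"
  unfolding accel_eq[abs_def] by (intro smooth_D1 smooth_Uform)

lemma jerk_eq:
  assumes "t \<in> T"
  shows "jk t = d1 acc t + (ip t (acc t) (acc t) + ip t (Uf t) (PU t)) *\<^sub>R Uf t - PU t"
  using U_inner[OF assms, of "PU t"] by (simp add: jerk_def PU_def)

lemma smooth_jerk: "smooth_on T jk"
proof -
  have "smooth_on T (\<lambda>t. d1 acc t + (ip t (acc t) (acc t) + ip t (Uf t) (PU t)) *\<^sub>R Uf t - PU t)"
    by (intro smooth_intros open_T smooth_D1 smooth_accel smooth_Uform smooth_PU smooth_ip)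
  then show ?thesis by (rule smooth_on_cong[OF open_T, rotated]) (simp add: jerk_eq)
qed

lemma ip_UU: "t \<in> T \<Longrightarrow> ip t (Uf t) (Uf t) = 1"
proof -
  assume t: "t \<in> T"
  have "ip t (Uf t) (Uf t) = U t \<bullet> Uf t" by (simp add: U_inner t)
  also have "\<dots> = (vel t \<bullet> (g c (\<gamma> t) *v vel t)) / (sp t)^2"
    by (simp add: Uform_def Uvec_eq matrix_vector_mult_scaleR power2_eq_square)
  also have "\<dots> = 1" using speed_sq_pos[OF t] by (simp add: speed_eq)
  finally show ?thesis .
qed

lemma Uform_nonzero: "t \<in> T \<Longrightarrow> Uf t \<noteq> 0"
  using ip_UU[of t] by (auto simp: form_inner_linear)

text \<open>Applied in turn to the pairs (U, U), (U, A) and (U, J), this yields the U-components of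
  A, of the derivative of A and of the derivative of J.\<close>

lemma ip_constant:
  assumes "smooth_on T \<alpha>" "smooth_on T \<beta>" "t \<in> T" "\<And>s. s \<in> T \<Longrightarrow> ip s (\<alpha> s) (\<beta> s) = k"
  shows "ip t (d1 \<alpha> t) (\<beta> t) + ip t (\<alpha> t) (d1 \<beta> t) = 0"
proof -
  have "d0 (\<lambda>s. ip s (\<alpha> s) (\<beta> s)) t = d0 (\<lambda>s. k) t"
    by (rule D0_cong[OF smooth_on_const[OF open_T] _ assms(3)]) (simp add: assms(4))
  then show ?thesis by (simp add: D0_form_inner[OF assms(1-3)] D0_const)
qed

lemma ip_UA: "t \<in> T \<Longrightarrow> ip t (Uf t) (acc t) = 0"
  using ip_constant[OF smooth_Uform smooth_Uform _ ip_UU, of t] ip_commute[of t "Uf t" "acc t"]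
  by (simp add: accel_eq)

lemma ip_UdA: "t \<in> T \<Longrightarrow> ip t (Uf t) (d1 acc t) = - ip t (acc t) (acc t)"
  using ip_constant[OF smooth_Uform smooth_accel _ ip_UA, of t]
  by (simp add: accel_eq[symmetric])

text \<open>The U-component of the derivative of A is minus the squared length of A, which the
  normalising term of the jerk removes; the two Rho-terms cancel each other.\<close>

lemma ip_UJ: "t \<in> T \<Longrightarrow> ip t (Uf t) (jk t) = 0"
  by (simp add: jerk_eq form_inner_linear ip_UdA ip_UU)

lemma ip_UdJ: "t \<in> T \<Longrightarrow> ip t (Uf t) (d1 jk t) = - ip t (acc t) (jk t)"
  using ip_constant[OF smooth_Uform smooth_jerk _ ip_UJ, of t]
  by (simp add: accel_eq[symmetric])

lemma ip_JJ: "t \<in> T \<Longrightarrow> ip t (jk t) (jk t) > 0"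
  by (rule form_inner_pos[of g c "\<gamma> t", OF metric_inner_product jerk_nonzero])

text \<open>The first two terms together are orthogonal to U, as is J, hence they are parallel to J
  in dimension two; pairing with J identifies the factor as -2 \<open>kap\<close>.\<close>

lemma kap_eq:
  assumes t: "t \<in> T"
  shows "d1 jk t + ip t (acc t) (jk t) *\<^sub>R Uf t + (2 * kap t) *\<^sub>R jk t = 0"
proof -
  let ?\<alpha> = "d1 jk t + ip t (acc t) (jk t) *\<^sub>R Uf t"
  have "ip t (Uf t) ?\<alpha> = 0" by (simp add: form_inner_linear ip_UdJ ip_UU t)
  from form_inner_orthogonal_parallel[of g c "\<gamma> t", OF metric_inner_product[OF t] Uform_nonzero[OF t] jerk_nonzero[OF t] this ip_UJ[OF t]]
  have "?\<alpha> = (ip t (d1 jk t) (jk t) / ip t (jk t) (jk t)) *\<^sub>R jk t"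
    by (simp add: form_inner_linear ip_UJ t)
  then show ?thesis by (simp add: kap_def)
qed

lemma kap_unique:
  assumes t: "t \<in> T" and eq: "d1 jk t + ip t (acc t) (jk t) *\<^sub>R Uf t + (2 * k) *\<^sub>R jk t = 0"
  shows "k = kap t"
proof -
  have "(2 * k) *\<^sub>R jk t = (2 * kap t) *\<^sub>R jk t"
    using eq kap_eq[OF t] by (metis add_left_cancel)
  then show ?thesis using jerk_nonzero[OF t] by simp
qed

lemma smooth_kap: "smooth_on T kap"
  unfolding kap_def[abs_def]
  by (intro smooth_intros open_T smooth_ip smooth_D1 smooth_jerk) (use ip_JJ in force)

end

text \<open>Since \<open>kappa\<close> quantifies over all charts, identifying it with the one-chart
  formula \<open>kap\<close> takes independence of the chart. Assuming the identity here lets the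
  calculus proceed in one chart; \<open>kappa_curve_C\<close> supplies it for every metric of the
  class.\<close>

locale kappa_curve = jerk_curve A I \<gamma> c g P
  for A :: "'a::{t2_space,second_countable_topology} chart set" and I \<gamma> c g P +
  assumes kappa: "t \<in> T \<Longrightarrow> kappa A P \<gamma> g t = kap t"
begin

section \<open>Derivative of the jerk tractor in one chart\<close>

abbreviation "\<Sigma> \<equiv> jerk_tractor A P \<gamma> g c"

definition bottom where
  "bottom t = jk t + (1/2 * (ip t (acc t) (acc t) - (kap t)\<^sup>2)) *\<^sub>R Uf t + kap t *\<^sub>R acc t"

definition chart_obstruction where
  "chart_obstruction t = d0 (kappa A P \<gamma> g) t + 1/2 * (ip t (acc t) (acc t) + (kappa A P \<gamma> g t)\<^sup>2)
    + U t \<bullet> (P g c (\<gamma> t) *v U t)"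

lemma chart_obstruction_eq:
  assumes "t \<in> T"
  shows "chart_obstruction t = d0 kap t + 1/2 * (ip t (acc t) (acc t) + (kap t)\<^sup>2) + ip t (Uf t) (PU t)"
proof -
  have "d0 (kappa A P \<gamma> g) t = d0 kap t"
    by (rule D0_cong[OF smooth_kap _ assms]) (simp add: kappa)
  then show ?thesis using U_inner[OF assms, of "PU t"] by (simp add: chart_obstruction_def PU_def kappa assms)
qed

lemma tractor_eq: "t \<in> T \<Longrightarrow> \<Sigma> t = (Uf t, wedge (Uf t) (acc t), kap t, bottom t)"
  by (simp add: jerk_tractor_def kappa bottom_def)

lemma smooth_bottom: "smooth_on T bottom"
  unfolding bottom_def[abs_def]
  by (intro smooth_intros open_T smooth_jerk smooth_kap smooth_accel smooth_Uform smooth_ip)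

lemma smooth_tractor: "smooth_on T \<Sigma>"
proof -
  have "smooth_on T (\<lambda>t. (Uf t, wedge (Uf t) (acc t), kap t, bottom t))"
    unfolding wedge_def
    by (intro smooth_intros open_T smooth_bottom smooth_kap smooth_accel smooth_Uform)
  then show ?thesis by (rule smooth_on_cong[OF open_T, rotated]) (simp add: tractor_eq)
qed

lemma raise_ip: "t \<in> T \<Longrightarrow> raise g c (\<gamma> t) \<alpha> \<bullet> \<beta> = ip t \<alpha> \<beta>"
  by (rule raise_inner[of g c "\<gamma> t", OF metric_inner_product])

lemma D1_jerk: "t \<in> T \<Longrightarrow> d1 jk t = - (ip t (acc t) (jk t) *\<^sub>R Uf t) - (2 * kap t) *\<^sub>R jk t"
  using kap_eq[of t] by (simp add: algebra_simps eq_neg_iff_add_eq_0)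

lemma D1_accel: "t \<in> T \<Longrightarrow> d1 acc t = jk t - (ip t (acc t) (acc t) + ip t (Uf t) (PU t)) *\<^sub>R Uf t + PU t"
  by (simp add: jerk_eq)

lemma D1_bottom:
  assumes t: "t \<in> T"
  shows "d1 bottom t = d1 jk t + (ip t (d1 acc t) (acc t) - kap t * d0 kap t) *\<^sub>R Uf t
    + (1/2 * (ip t (acc t) (acc t) - (kap t)\<^sup>2)) *\<^sub>R acc t + d0 kap t *\<^sub>R acc t + kap t *\<^sub>R d1 acc t"
proof -
  \<comment> \<open>The difference is spelled as a sum and the square as a product, the shapes to
    which the rules for \<open>D0\<close> apply.\<close>
  define q where "q = (\<lambda>s. 1/2 * (ip s (acc s) (acc s) + - (kap s * kap s)))"
  have sq: "smooth_on T q" "smooth_on T (\<lambda>s. ip s (acc s) (acc s))" "smooth_on T (\<lambda>s. - (kap s * kap s))"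
    "smooth_on T (\<lambda>s. kap s * kap s)" "smooth_on T (\<lambda>s. ip s (acc s) (acc s) + - (kap s * kap s))"
    unfolding q_def by (intro smooth_intros open_T smooth_kap smooth_accel smooth_ip)+
  note c = smooth_on_const[OF open_T]
  have "d0 (\<lambda>s. - (kap s * kap s)) t = - (2 * kap t * d0 kap t)"
    using D0_mult[OF c[of "-1"] sq(4) t] D0_mult[OF smooth_kap smooth_kap t] by (simp add: D0_const)
  then have dq: "d0 q t = ip t (d1 acc t) (acc t) - kap t * d0 kap t"
    unfolding q_def using D0_mult[OF c[of "1/2"] sq(5) t] D0_add[OF sq(2,3) t]
      D0_form_inner[OF smooth_accel smooth_accel t] ip_commute[OF t, of "acc t" "d1 acc t"]
    by (simp add: D0_const)
  have "bottom = (\<lambda>s. (jk s + q s *\<^sub>R Uf s) + kap s *\<^sub>R acc s)"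
    by (simp add: bottom_def q_def fun_eq_iff power2_eq_square)
  moreover have "smooth_on T (\<lambda>s. q s *\<^sub>R Uf s)" "smooth_on T (\<lambda>s. jk s + q s *\<^sub>R Uf s)" "smooth_on T (\<lambda>s. kap s *\<^sub>R acc s)"
    by (intro smooth_intros open_T sq smooth_jerk smooth_Uform smooth_kap smooth_accel)+
  ultimately show ?thesis
    using t by (simp add: D1_add D1_scaleR smooth_jerk smooth_Uform smooth_accel smooth_kap sq dq accel_eq[symmetric])
      (simp add: q_def power2_eq_square)
qed

text \<open>An arbitrary coefficient r is carried along because preservation concerns all sections;
  the section is prescribed on \<open>T\<close> only, where its components have a meaning.\<close>

lemma tractor_deriv_multiple:
  assumes t: "t \<in> T" and r: "smooth_on T r" and F: "\<And>s. s \<in> T \<Longrightarrow> F s = r s *\<^sub>R \<Sigma> s"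
  shows "tractor_deriv P \<gamma> g c F t = (d0 r t - r t * kap t) *\<^sub>R \<Sigma> t
    + (0, 0, r t * chart_obstruction t, (r t * chart_obstruction t) *\<^sub>R (acc t - kap t *\<^sub>R Uf t))"
proof -
  have F': "F s = (r s *\<^sub>R Uf s, wedge (r s *\<^sub>R Uf s) (acc s), r s * kap s, r s *\<^sub>R bottom s)" if "s \<in> T" for s
    by (simp add: F[OF that] tractor_eq[OF that] wedge_linear)
  have sm: "smooth_on T (\<lambda>s. r s *\<^sub>R Uf s)" "smooth_on T (\<lambda>s. wedge (r s *\<^sub>R Uf s) (acc s))"
    "smooth_on T (\<lambda>s. r s * kap s)" "smooth_on T (\<lambda>s. r s *\<^sub>R bottom s)"
    unfolding wedge_def by (intro smooth_intros open_T r smooth_Uform smooth_accel smooth_kap smooth_bottom)+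
  have d\<sigma>: "d1 (\<lambda>s. fst (F s)) t = d0 r t *\<^sub>R Uf t + r t *\<^sub>R acc t"
    using D1_cong[OF sm(1) _ t, of "\<lambda>s. fst (F s)"] D1_scaleR[OF r smooth_Uform t]
    by (simp add: F' accel_eq)
  have d\<mu>: "d2 (\<lambda>s. fst (snd (F s))) t
      = wedge (d0 r t *\<^sub>R Uf t + r t *\<^sub>R acc t) (acc t) + wedge (r t *\<^sub>R Uf t) (d1 acc t)"
  proof -
    have "d2 (\<lambda>s. fst (snd (F s))) t = d2 (\<lambda>s. wedge (r s *\<^sub>R Uf s) (acc s)) t"
      unfolding D2_def using vector_derivative_cong_T[OF sm(2) _ t, of "\<lambda>s. fst (snd (F s))"] t
      by (simp add: F')
    then show ?thesis
      by (simp add: D2_wedge[OF sm(1) smooth_accel t] D1_scaleR[OF r smooth_Uform t] accel_eq[symmetric])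
  qed
  have d\<nu>: "d0 (\<lambda>s. fst (snd (snd (F s)))) t = d0 r t * kap t + r t * d0 kap t"
    using D0_cong[OF sm(3) _ t, of "\<lambda>s. fst (snd (snd (F s)))"] D0_mult[OF r smooth_kap t]
    by (simp add: F')
  have d\<rho>: "d1 (\<lambda>s. snd (snd (snd (F s)))) t = d0 r t *\<^sub>R bottom t + r t *\<^sub>R d1 bottom t"
    using D1_cong[OF sm(4) _ t, of "\<lambda>s. snd (snd (snd (F s)))"] D1_scaleR[OF r smooth_bottom t]
    by (simp add: F')
  \<comment> \<open>The connection contracts the first index of the Rho-tensor, \<open>PU\<close>
    the second; symmetry reconciles them.\<close>
  have PUv: "U t v* P g c (\<gamma> t) = PU t"
    unfolding PU_def by (rule symmetric_vector_matrix[OF symmetric_tensor2D(2)[OF rho cA T_cdom[OF t]]])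
  note comm = ip_commute[OF t, of "PU t" "Uf t"] ip_commute[OF t, of "acc t" "Uf t"]
    ip_commute[OF t, of "acc t" "jk t"] ip_commute[OF t, of "acc t" "PU t"]
    ip_commute[OF t, of "jk t" "Uf t"]
  note vals = ip_UU[OF t] ip_UA[OF t] ip_UJ[OF t] U_inner[OF t] raise_ip[OF t] comm
  \<comment> \<open>Contracting the two-form slot with U returns r A, which cancels the derivative
    of U; only multiples of U are left.\<close>
  have 1: "d0 r t *\<^sub>R Uf t + r t *\<^sub>R acc t - U t v* wedge (r t *\<^sub>R Uf t) (acc t) - (r t * kap t) *\<^sub>R Uf t
      = (d0 r t - r t * kap t) *\<^sub>R Uf t"
    by (simp add: vector_mult_wedge vals form_inner_linear algebra_simps)
  \<comment> \<open>J cancels between the derivative of A and the bottom slot, and the two wedges of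
    U with P U cancel each other; the term \<kappa> A of the bottom slot gives the
    remainder.\<close>
  have 2: "wedge (d0 r t *\<^sub>R Uf t + r t *\<^sub>R acc t) (acc t) + wedge (r t *\<^sub>R Uf t) (d1 acc t)
      - wedge (Uf t) (r t *\<^sub>R bottom t) + wedge (PU t) (r t *\<^sub>R Uf t)
      = (d0 r t - r t * kap t) *\<^sub>R wedge (Uf t) (acc t)"
    by (simp add: D1_accel[OF t] bottom_def wedge_linear wedge_swap[of "PU t"] algebra_simps)
  \<comment> \<open>U is orthogonal to A and J, so the bottom slot contributes (A.A - \<kappa>^2)/2.
    Splitting off -\<kappa>^2 for the multiple of \<Sigma> reverses the sign of the square and
    completes E.\<close>
  have 3: "d0 r t * kap t + r t * d0 kap t + U t \<bullet> (r t *\<^sub>R bottom t) + ip t (PU t) (r t *\<^sub>R Uf t)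
      = (d0 r t - r t * kap t) * kap t + r t * chart_obstruction t"
    unfolding bottom_def chart_obstruction_eq[OF t] U_inner[OF t] form_inner_linear vals power2_eq_square
    by (simp add: field_simps)
  \<comment> \<open>J occurs with -2\<kappa> from its own derivative and +\<kappa> from the
    derivative of A. The terms (A.J) U, (A.PU) U and \<kappa> PU cancel in pairs.\<close>
  have 4: "d0 r t *\<^sub>R bottom t + r t *\<^sub>R d1 bottom t - wedge (r t *\<^sub>R Uf t) (acc t) *v raise g c (\<gamma> t) (PU t)
        - (r t * kap t) *\<^sub>R PU t
      = (d0 r t - r t * kap t) *\<^sub>R bottom t + (r t * chart_obstruction t) *\<^sub>R (acc t - kap t *\<^sub>R Uf t)"
    unfolding D1_bottom[OF t] D1_jerk[OF t] D1_accel[OF t] bottom_def chart_obstruction_eq[OF t] wedge_mult_vector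
    by (simp add: vals form_inner_linear vec_eq_iff power2_eq_square field_simps)
  show ?thesis
    unfolding tractor_deriv_def Let_def PUv d\<sigma> d\<mu> d\<nu> d\<rho> tractor_eq[OF t]
    by (simp only: F'[OF t] fst_conv snd_conv 1 2 3 4 scaleR_Pair add_Pair) simp
qed

end

locale two_jerk_charts =
  two_charts A I \<gamma> c d g + C: jerk_curve A I \<gamma> c g P + D: jerk_curve A I \<gamma> d g P
  for A :: "'a::{t2_space,second_countable_topology} chart set" and I \<gamma> c d g P
begin

lemma accel_chart:
  assumes "t \<in> C.T" "t \<in> D.T"
  shows "accel \<gamma> g c t = pull1 (J (\<gamma> t)) (accel \<gamma> g d t)"
  unfolding accel_def
  by (rule D1_chart[OF assms C.smooth_Uform D.smooth_Uform Uform_chart])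

lemma PU_chart:
  assumes "t \<in> C.T" "t \<in> D.T"
  shows "C.PU t = pull1 (J (\<gamma> t)) (D.PU t)"
  using symmetric_tensor2D(3)[OF C.rho C.cA D.cA, of "\<gamma> t"] C.T_cdom[OF assms(1)] D.T_cdom[OF assms(2)]
  by (simp add: C.PU_def D.PU_def Uvec_chart[OF assms] pull2_vector J_def)

lemma jerk_chart:
  assumes "t \<in> C.T" "t \<in> D.T"
  shows "jerk P \<gamma> g c t = pull1 (J (\<gamma> t)) (jerk P \<gamma> g d t)"
proof -
  have "D1 \<gamma> g c (accel \<gamma> g c) t = pull1 (J (\<gamma> t)) (D1 \<gamma> g d (accel \<gamma> g d) t)"
    by (rule D1_chart[OF assms C.smooth_accel D.smooth_accel accel_chart])
  then show ?thesis
    by (simp add: C.jerk_eq[OF assms(1)] D.jerk_eq[OF assms(2)] pull1_linear accel_chart[OF assms]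
        PU_chart[OF assms] Uform_chart[OF assms] form_inner_chart[OF assms])
qed

text \<open>Through this a solution found in one chart solves the equation in every chart, as the
  definite description of \<open>kappa\<close> demands.\<close>

lemma kap_chart:
  assumes "t \<in> C.T" "t \<in> D.T"
  shows "C.kap t = D.kap t"
proof -
  have "D1 \<gamma> g c (jerk P \<gamma> g c) t = pull1 (J (\<gamma> t)) (D1 \<gamma> g d (jerk P \<gamma> g d) t)"
    by (rule D1_chart[OF assms C.smooth_jerk D.smooth_jerk jerk_chart])
  then show ?thesis
    by (simp add: C.kap_def D.kap_def jerk_chart[OF assms] form_inner_chart[OF assms])
qed

end

section \<open>Conformal rescaling\<close>

text \<open>\<open>G\<close> carries the original metric and \<open>K\<close> the rescaled one, in a
  common chart, so each transformation law becomes an identity between the two families of curve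
  quantities.\<close>

locale conformal_curves =
  G: kappa_curve A I \<gamma> c g P + K: kappa_curve A I \<gamma> c h P
  for A :: "'a::{t2_space,second_countable_topology} chart set" and I \<gamma> c g h P +
  fixes \<Omega> :: "'a \<Rightarrow> real"
  assumes rescaling: "rescaling A \<Omega> g h"
    and rho_rescaling: "p \<in> cdom c \<Longrightarrow> P h c p = P g c p - cov_deriv_form g c (Upsilon \<Omega> c) p
          + (\<chi> a b. Upsilon \<Omega> c p $ a * Upsilon \<Omega> c p $ b)
          - (1/2 * form_inner g c p (Upsilon \<Omega> c p) (Upsilon \<Omega> c p)) *\<^sub>R g c p"
begin

abbreviation "T \<equiv> G.T"

definition w where "w t = \<Omega> (\<gamma> t)"
definition Y where "Y t = Upsilon \<Omega> c (\<gamma> t)"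
definition u where "u t = G.ip t (G.Uf t) (Y t)"

lemma factor_pos: "p \<in> cdom c \<Longrightarrow> \<Omega> p > 0"
  using rescaling G.cA by (auto simp: rescaling_def surface_def)

lemma metric_eq: "p \<in> cdom c \<Longrightarrow> h c p = (\<Omega> p)\<^sup>2 *\<^sub>R g c p"
  using rescaling G.cA by (auto simp: rescaling_def)

lemma smooth_factor: "smooth_on (coord c ` cdom c) (\<Omega> \<circ> cinv c)"
  using rescaling G.cA by (auto simp: rescaling_def smooth_field_def)

lemma w_pos: "t \<in> T \<Longrightarrow> w t > 0"
  by (simp add: w_def factor_pos G.T_cdom)

lemma open_V: "open (coord c ` cdom c)"
  by (rule smooth_surfaceD(2)[OF G.surf G.cA])

lemma smooth_Upsilon: "smooth_on (coord c ` cdom c) ((\<lambda>p. Upsilon \<Omega> c p $ a) \<circ> cinv c)"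
proof -
  have "smooth_on (coord c ` cdom c) (\<lambda>y. ((\<lambda>p. partial_deriv c \<Omega> p a) \<circ> cinv c) y / (\<Omega> \<circ> cinv c) y)"
    by (intro smooth_intros open_V smooth_factor smooth_on_partial_deriv[OF G.surf G.cA])
      (use factor_pos cinv_coord[OF G.surf G.cA] in force)
  then show ?thesis by (simp add: Upsilon_def o_def)
qed

lemma smooth_w: "smooth_on T w"
  unfolding w_def[abs_def] by (rule G.smooth_on_curve[OF smooth_factor])

lemma smooth_Y: "smooth_on T Y"
  unfolding Y_def[abs_def] smooth_on_componentwise[OF G.open_T]
  using G.smooth_on_curve[OF smooth_Upsilon] by blast

lemma smooth_u: "smooth_on T u"
  unfolding u_def[abs_def] by (intro G.smooth_ip G.smooth_Uform smooth_Y)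

text \<open>Since the derivative of \<Omega> is \<Omega> \<Upsilon>, the factor \<Omega>^2 comes out
  in front; raising an index with the rescaled metric later removes it.\<close>

lemma partial_deriv_rescaled:
  assumes p: "p \<in> cdom c"
  shows "partial_deriv c (\<lambda>q. h c q $ i $ j) p k
    = (\<Omega> p)\<^sup>2 * (2 * Upsilon \<Omega> c p $ k * g c p $ i $ j + partial_deriv c (\<lambda>q. g c q $ i $ j) p k)"
proof -
  have x: "coord c p \<in> coord c ` cdom c" using p by simp
  have cc: "cinv c (coord c p) = p" using cinv_coord[OF G.surf G.cA] p by simp
  have d: "(\<Omega> \<circ> cinv c) differentiable (at (coord c p))"
    "((\<lambda>q. g c q $ i $ j) \<circ> cinv c) differentiable (at (coord c p))"
    by (rule smooth_on_differentiable[OF smooth_factor x] smooth_on_differentiable[OF G.smooth_metric_chart x])+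
  have dd: "((\<lambda>q. \<Omega> q * \<Omega> q) \<circ> cinv c) differentiable (at (coord c p))"
    using differentiable_mult[OF d(1) d(1)] by (simp add: o_def)
  have eq: "((\<lambda>q. h c q $ i $ j) \<circ> cinv c) y = ((\<lambda>q. (\<Omega> q * \<Omega> q) * g c q $ i $ j) \<circ> cinv c) y"
    if "y \<in> coord c ` cdom c" for y
    using that cinv_coord[OF G.surf G.cA] by (auto simp: metric_eq power2_eq_square)
  have "partial_deriv c (\<lambda>q. h c q $ i $ j) p k = partial_deriv c (\<lambda>q. (\<Omega> q * \<Omega> q) * g c q $ i $ j) p k"
    unfolding partial_deriv_def
    using frechet_derivative_transform_within_open[OF smooth_on_differentiable[OF K.smooth_metric_chart x] open_V x eq]
    by (simp only:)
  then show ?thesis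
    unfolding partial_deriv_mult[OF dd d(2) cc] partial_deriv_mult[OF d(1) d(1) cc]
    using factor_pos[OF p] by (simp add: Upsilon_def power2_eq_square field_simps)
qed

lemma christoffel1_rescaled:
  assumes p: "p \<in> cdom c"
  shows "christoffel1 h c p l i j = (\<Omega> p)\<^sup>2 * (christoffel1 g c p l i j + Upsilon \<Omega> c p $ i * g c p $ j $ l
    + Upsilon \<Omega> c p $ j * g c p $ i $ l - Upsilon \<Omega> c p $ l * g c p $ i $ j)"
  by (simp add: christoffel1_def partial_deriv_rescaled[OF p] field_simps)

lemma raise_rescaled:
  assumes "t \<in> T"
  shows "raise h c (\<gamma> t) \<omega> = (1 / (w t)\<^sup>2) *\<^sub>R raise g c (\<gamma> t) \<omega>"
proof -
  have "h c (\<gamma> t) *v ((1 / (w t)\<^sup>2) *\<^sub>R raise g c (\<gamma> t) \<omega>) = g c (\<gamma> t) *v raise g c (\<gamma> t) \<omega>"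
    using w_pos[OF assms] metric_eq[OF G.T_cdom[OF assms]]
    by (simp add: w_def scaleR_matrix_vector_assoc[symmetric] matrix_vector_mult_scaleR)
  then show ?thesis
    using lower_raise[of g c "\<gamma> t" \<omega>, OF G.metric_inner_product[OF assms]]
      raise_lower[of h c "\<gamma> t" "(1 / (w t)\<^sup>2) *\<^sub>R raise g c (\<gamma> t) \<omega>", OF K.metric_inner_product[OF assms]] by simp
qed

lemma form_inner_rescaled: "t \<in> T \<Longrightarrow> K.ip t \<alpha> \<beta> = G.ip t \<alpha> \<beta> / (w t)\<^sup>2"
  by (simp add: form_inner_def raise_rescaled)

lemma speed_rescaled: "t \<in> T \<Longrightarrow> K.sp t = w t * G.sp t"
  unfolding G.speed_eq K.speed_eq
  using w_pos[of t] by (simp add: metric_eq G.T_cdom w_def scaleR_matrix_vector_assoc[symmetric] real_sqrt_mult)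

lemma Uvec_rescaled: "t \<in> T \<Longrightarrow> K.U t = (1 / w t) *\<^sub>R G.U t"
  by (simp add: G.Uvec_eq K.Uvec_eq speed_rescaled)

lemma Uform_rescaled: "t \<in> T \<Longrightarrow> K.Uf t = w t *\<^sub>R G.Uf t"
  unfolding Uform_def using w_pos[of t]
  by (simp add: Uvec_rescaled metric_eq G.T_cdom w_def scaleR_matrix_vector_assoc[symmetric]
      matrix_vector_mult_scaleR power2_eq_square)

lemma D0_rescaled: "t \<in> T \<Longrightarrow> K.d0 f t = G.d0 f t / w t"
  by (simp add: D0_def speed_rescaled mult.commute)

lemma u_eq: "t \<in> T \<Longrightarrow> u t = G.U t \<bullet> Y t"
  by (simp add: u_def G.U_inner)

lemma D0_w: "t \<in> T \<Longrightarrow> G.d0 w t = w t * u t"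
proof -
  assume t: "t \<in> T"
  have "(w has_vector_derivative (\<Sum>i\<in>UNIV. G.vel t $ i * partial_deriv c \<Omega> (\<gamma> t) i)) (at t)"
    unfolding w_def[abs_def]
    by (rule G.vector_derivative_along_curve[OF G.differentiable_chart[OF smooth_factor t] t])
  then have "vector_derivative w (at t) = w t * (G.vel t \<bullet> Y t)"
    using w_pos[OF t] by (simp add: vector_derivative_at Y_def Upsilon_def w_def inner_vec_def sum_2 field_simps)
  then show ?thesis by (simp add: D0_def u_eq t G.Uvec_eq)
qed

text \<open>Both connections share the parameter derivative of \<open>\<omega>\<close>, so the
  change comes from the Christoffel difference and from the factor w in the speed.\<close>

lemma D1_rescaled:
  assumes t: "t \<in> T"
  shows "K.d1 \<omega> t = (1 / w t) *\<^sub>R (G.d1 \<omega> t - u t *\<^sub>R \<omega> t - G.ip t (G.Uf t) (\<omega> t) *\<^sub>R Y t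
    + G.ip t (Y t) (\<omega> t) *\<^sub>R G.Uf t)"
proof -
  define a where "a = raise g c (\<gamma> t) (\<omega> t)"
  have \<omega>: "\<omega> t $ i = (\<Sum>j\<in>UNIV. g c (\<gamma> t) $ i $ j * a $ j)" for i
    using lower_raise[of g c "\<gamma> t" "\<omega> t", OF G.metric_inner_product[OF t]]
    by (simp add: a_def matrix_vector_mult_def vec_eq_iff)
  have i1: "G.ip t (G.Uf t) (\<omega> t) = (1 / G.sp t) * (\<Sum>i\<in>UNIV. G.vel t $ i * \<omega> t $ i)"
    by (simp add: G.U_inner[OF t, symmetric] G.Uvec_eq inner_vec_def sum_divide_distrib)
  have i2: "G.ip t (Y t) (\<omega> t) = (\<Sum>i\<in>UNIV. Y t $ i * a $ i)"
    by (simp add: form_inner_def inner_vec_def a_def)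
  have i3: "u t = (1 / G.sp t) * (\<Sum>i\<in>UNIV. G.vel t $ i * Y t $ i)"
    by (simp add: u_eq[OF t] G.Uvec_eq inner_vec_def sum_divide_distrib)
  have i4: "G.Uf t $ b = (1 / G.sp t) * (\<Sum>i\<in>UNIV. g c (\<gamma> t) $ b $ i * G.vel t $ i)" for b
    by (simp add: Uform_def G.Uvec_eq matrix_vector_mult_scaleR) (simp add: matrix_vector_mult_def)
  have gs: "g c (\<gamma> t) $ 2 $ 1 = g c (\<gamma> t) $ 1 $ 2" by (rule G.metric_sym[OF G.T_cdom[OF t]])
  have W: "w t > 0" by (rule w_pos[OF t])
  have S: "G.sp t > 0" by (rule G.speed_pos[OF t])
  have chr: "christoffel1 h c (\<gamma> t) l i j = (w t)\<^sup>2 * (christoffel1 g c (\<gamma> t) l i j + Y t $ i * g c (\<gamma> t) $ j $ l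
    + Y t $ j * g c (\<gamma> t) $ i $ l - Y t $ l * g c (\<gamma> t) $ i $ j)" for l i j
    unfolding w_def Y_def by (rule christoffel1_rescaled[OF G.T_cdom[OF t]])
  define E where "E = (\<lambda>b. \<Sum>k\<in>UNIV. \<Sum>l\<in>UNIV. G.vel t $ k * a $ l * christoffel1 g c (\<gamma> t) l k b)"
  have "(\<Sum>k\<in>UNIV. \<Sum>l\<in>UNIV. G.vel t $ k * raise h c (\<gamma> t) (\<omega> t) $ l * christoffel1 h c (\<gamma> t) l k b)
      = (\<Sum>k\<in>UNIV. \<Sum>l\<in>UNIV. G.vel t $ k * a $ l * (christoffel1 g c (\<gamma> t) l k b + Y t $ k * g c (\<gamma> t) $ b $ l
    + Y t $ b * g c (\<gamma> t) $ k $ l - Y t $ l * g c (\<gamma> t) $ k $ b))" for b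
    unfolding chr raise_rescaled[OF t] a_def[symmetric] using W by (simp add: sum_2)
  also have "\<dots> b = E b + (\<Sum>k\<in>UNIV. G.vel t $ k * Y t $ k) * \<omega> t $ b + (\<Sum>k\<in>UNIV. G.vel t $ k * \<omega> t $ k) * Y t $ b
      - (\<Sum>l\<in>UNIV. Y t $ l * a $ l) * (\<Sum>k\<in>UNIV. g c (\<gamma> t) $ b $ k * G.vel t $ k)" for b
    using exhaust_2[of b] by (auto simp: E_def \<omega> sum_2 gs algebra_simps)
  finally have E': "(\<Sum>k\<in>UNIV. \<Sum>l\<in>UNIV. G.vel t $ k * raise h c (\<gamma> t) (\<omega> t) $ l * christoffel1 h c (\<gamma> t) l k b)
      = E b + (\<Sum>k\<in>UNIV. G.vel t $ k * Y t $ k) * \<omega> t $ b + (\<Sum>k\<in>UNIV. G.vel t $ k * \<omega> t $ k) * Y t $ b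
      - (\<Sum>l\<in>UNIV. Y t $ l * a $ l) * (\<Sum>k\<in>UNIV. g c (\<gamma> t) $ b $ k * G.vel t $ k)" for b .
  have E: "(\<Sum>k\<in>UNIV. \<Sum>l\<in>UNIV. G.vel t $ k * a $ l * christoffel1 g c (\<gamma> t) l k b) = E b" for b
    by (simp add: E_def)
  \<comment> \<open>Naming the four contractions reduces the claim to a rational identity in w and
    the speed.\<close>
  define vY where "vY = (\<Sum>k\<in>UNIV. G.vel t $ k * Y t $ k)"
  define v\<omega> where "v\<omega> = (\<Sum>k\<in>UNIV. G.vel t $ k * \<omega> t $ k)"
  define aY where "aY = (\<Sum>l\<in>UNIV. Y t $ l * a $ l)"
  define gv where "gv b = (\<Sum>k\<in>UNIV. g c (\<gamma> t) $ b $ k * G.vel t $ k)" for b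
  have "K.d1 \<omega> t $ b = (1 / w t) * (G.d1 \<omega> t $ b - u t * \<omega> t $ b - G.ip t (G.Uf t) (\<omega> t) * Y t $ b
    + G.ip t (Y t) (\<omega> t) * G.Uf t $ b)" for b
    unfolding K.D1_eq[OF t] G.D1_eq[OF t] i1 i2 i3 i4 speed_rescaled[OF t] E' a_def[symmetric] E
      vY_def[symmetric] v\<omega>_def[symmetric] aY_def[symmetric] gv_def[symmetric]
    using W S by (simp add: field_simps)
  then show ?thesis by (simp add: vec_eq_iff)
qed

text \<open>Along the curve \<open>Y\<close> restricts a covector field of the surface, so the chain
  rule turns its derivative into a contraction of the first index of \<nabla>\<Upsilon>.\<close>

lemma D1_Y:
  assumes t: "t \<in> T"
  shows "G.d1 Y t = G.U t v* cov_deriv_form g c (Upsilon \<Omega> c) (\<gamma> t)"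
proof -
  have "vector_derivative Y (at t) $ b = (\<Sum>a\<in>UNIV. G.vel t $ a * partial_deriv c (\<lambda>q. Upsilon \<Omega> c q $ b) (\<gamma> t) a)" for b
    using vector_derivative_unique_at[OF has_vector_derivative_nth[OF smooth_on_has_vector_derivative[OF smooth_Y t]]]
      G.vector_derivative_along_curve[OF G.differentiable_chart[OF smooth_Upsilon t] t]
    by (auto simp: Y_def)
  then show ?thesis
    by (simp add: vec_eq_iff D1_def cov_deriv_form_def vector_matrix_mult_def G.Uvec_eq sum_2 Y_def
        add_divide_distrib diff_divide_distrib algebra_simps)
qed

lemma rho_U:
  assumes t: "t \<in> T"
  shows "P h c (\<gamma> t) *v G.U t = G.PU t - G.d1 Y t + u t *\<^sub>R Y t - (1/2 * G.ip t (Y t) (Y t)) *\<^sub>R G.Uf t"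
proof -
  define N where "N = cov_deriv_form g c (Upsilon \<Omega> c) (\<gamma> t)"
  have p: "\<gamma> t \<in> cdom c" by (rule G.T_cdom[OF t])
  have Ph: "P h c (\<gamma> t) = P g c (\<gamma> t) - N + (\<chi> a b. Y t $ a * Y t $ b) - (1/2 * G.ip t (Y t) (Y t)) *\<^sub>R g c (\<gamma> t)"
    unfolding N_def Y_def by (rule rho_rescaling[OF p])
  have "P h c (\<gamma> t) $ 2 $ 1 = P h c (\<gamma> t) $ 1 $ 2" "P g c (\<gamma> t) $ 2 $ 1 = P g c (\<gamma> t) $ 1 $ 2"
    using symmetric_tensor2D(2)[OF G.rho G.cA p] symmetric_tensor2D(2)[OF K.rho G.cA p] by (auto intro: transpose_symD)
  \<comment> \<open>Symmetry of \<nabla>\<Upsilon> is read off from the law for the Rho-tensor, in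
    which all other tensors are symmetric. It makes the first-index contraction of
    \<open>D1_Y\<close> agree with the second-index contraction in P U.\<close>
  then have Nsym: "N $ 2 $ 1 = N $ 1 $ 2"
    unfolding Ph using G.metric_sym[OF p] by simp
  have "G.U t v* N = N *v G.U t"
    by (simp add: vec_eq_iff vector_matrix_mult_def matrix_vector_mult_def sum_2 forall_2 Nsym algebra_simps)
  moreover have "(\<chi> a b. Y t $ a * Y t $ b) *v G.U t = u t *\<^sub>R Y t"
    by (simp add: vec_eq_iff matrix_vector_mult_def u_eq[OF t] inner_vec_def sum_2 algebra_simps)
  ultimately show ?thesis
    unfolding Ph D1_Y[OF t] N_def[symmetric] Uform_def G.PU_def
    by (simp add: matrix_vector_mult_diff_rdistrib matrix_vector_mult_add_rdistrib scaleR_matrix_vector_assoc[symmetric])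
qed

lemma PU_rescaled:
  assumes t: "t \<in> T"
  shows "K.PU t = (1 / w t) *\<^sub>R (G.PU t - G.d1 Y t + u t *\<^sub>R Y t - (1/2 * G.ip t (Y t) (Y t)) *\<^sub>R G.Uf t)"
  unfolding K.PU_def Uvec_rescaled[OF t] matrix_vector_mult_scaleR rho_U[OF t] ..

lemma form_inner_values:
  assumes t: "t \<in> T"
  shows "G.ip t (G.Uf t) (G.Uf t) = 1" "G.ip t (G.Uf t) (G.acc t) = 0" "G.ip t (G.acc t) (G.Uf t) = 0"
    "G.ip t (G.Uf t) (Y t) = u t" "G.ip t (Y t) (G.Uf t) = u t" "G.ip t (Y t) (G.acc t) = G.ip t (G.acc t) (Y t)"
    "G.ip t (G.Uf t) (G.jk t) = 0" "G.ip t (G.jk t) (G.Uf t) = 0" "G.ip t (G.jk t) (Y t) = G.ip t (Y t) (G.jk t)"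
  using G.ip_UU[OF t] G.ip_UA[OF t] G.ip_UJ[OF t] G.ip_commute[OF t] by (auto simp: u_def)

text \<open>Differentiating the factor w of the rescaled covector U gives w u; combined with the
  change of connection, a single term u U survives.\<close>

lemma accel_rescaled:
  assumes t: "t \<in> T"
  shows "K.acc t = G.acc t - Y t + u t *\<^sub>R G.Uf t"
proof -
  have "K.acc t = K.d1 (\<lambda>s. w s *\<^sub>R G.Uf s) t"
    unfolding K.accel_eq
    by (rule K.D1_cong) (use t in \<open>auto intro: smooth_intros G.open_T smooth_w G.smooth_Uform simp: Uform_rescaled\<close>)
  also have "\<dots> = (1 / w t) *\<^sub>R (w t *\<^sub>R (G.acc t - Y t + u t *\<^sub>R G.Uf t))"
    unfolding D1_rescaled[OF t] G.D1_scaleR[OF smooth_w G.smooth_Uform t] D0_w[OF t] form_inner_linear form_inner_values[OF t] G.accel_eq[symmetric]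
    by (simp add: algebra_simps)
  finally show ?thesis using w_pos[OF t] by simp
qed

lemma D0_u: "t \<in> T \<Longrightarrow> G.d0 u t = G.ip t (G.acc t) (Y t) + G.ip t (G.Uf t) (G.d1 Y t)"
  unfolding u_def[abs_def] by (simp add: G.D0_form_inner[OF G.smooth_Uform smooth_Y] G.accel_eq)

text \<open>The derivative of the new acceleration brings in the derivative of \<Upsilon> along the
  curve. The law for the Rho-tensor contains the same term, and the two cancel both as covectors and
  in the U-component.\<close>

lemma jerk_rescaled:
  assumes t: "t \<in> T"
  shows "K.jk t = (1 / w t) *\<^sub>R G.jk t"
proof -
  let ?A = "G.acc t" and ?U = "G.Uf t" and ?Y = "Y t"
  have sm: "smooth_on T (\<lambda>s. G.acc s - Y s)" "smooth_on T (\<lambda>s. u s *\<^sub>R G.Uf s)"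
    "smooth_on T (\<lambda>s. G.acc s - Y s + u s *\<^sub>R G.Uf s)"
    by (intro smooth_intros G.open_T smooth_u smooth_Y G.smooth_Uform G.smooth_accel)+
  have "K.d1 K.acc t = K.d1 (\<lambda>s. G.acc s - Y s + u s *\<^sub>R G.Uf s) t"
    by (rule K.D1_cong[OF sm(3) _ t]) (simp add: accel_rescaled)
  also have "\<dots> = (1 / w t) *\<^sub>R (G.d1 G.acc t - G.d1 Y t
      + (G.ip t ?A ?Y + G.ip t ?U (G.d1 Y t)) *\<^sub>R ?U + u t *\<^sub>R ?A
      - u t *\<^sub>R (?A - ?Y + u t *\<^sub>R ?U) + (G.ip t ?A ?Y - G.ip t ?Y ?Y + u t * u t) *\<^sub>R ?U)"
    unfolding D1_rescaled[OF t] G.D1_add[OF sm(1,2) t] G.D1_diff[OF G.smooth_accel smooth_Y t]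
      G.D1_scaleR[OF smooth_u G.smooth_Uform t] D0_u[OF t] form_inner_linear form_inner_values[OF t] G.accel_eq[symmetric]
    by (simp add: algebra_simps)
  finally have dA: "K.d1 K.acc t = \<dots>" .
  have W: "w t > 0" by (rule w_pos[OF t])
  show ?thesis
    unfolding K.jerk_eq[OF t] G.jerk_eq[OF t] dA accel_rescaled[OF t] PU_rescaled[OF t] Uform_rescaled[OF t]
      form_inner_rescaled[OF t] form_inner_linear form_inner_values[OF t] vec_eq_iff
    using W by (simp add: power2_eq_square field_simps)
qed

text \<open>The shift comes from -2u J in the new derivative of the jerk: one u from differentiating
  1/w, the other from the change of connection. The candidate is checked in the equation for h and
  identified by uniqueness.\<close>

lemma kap_rescaled:
  assumes t: "t \<in> T"
  shows "K.kap t = (G.kap t + u t) / w t"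
proof (rule K.kap_unique[OF t, symmetric])
  have W: "w t > 0" by (rule w_pos[OF t])
  have sm: "smooth_on T (\<lambda>s. 1 / w s)" "smooth_on T (\<lambda>s. (1 / w s) *\<^sub>R G.jk s)"
    by (intro smooth_intros G.open_T smooth_w G.smooth_jerk; use w_pos in force)+
  \<comment> \<open>Differentiating w (1/w) = 1 obtains the derivative of 1/w from the product
    rule.\<close>
  have "0 = G.d0 (\<lambda>s. w s * (1 / w s)) t"
    using G.D0_cong[OF smooth_on_const[OF G.open_T] _ t, of 1 "\<lambda>s. w s * (1 / w s)"] w_pos by (force simp: G.D0_const)
  then have dw: "G.d0 (\<lambda>s. 1 / w s) t = - (u t / w t)"
    unfolding G.D0_mult[OF smooth_w sm(1) t] D0_w[OF t] using W by (simp add: field_simps)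
  have dJ: "K.d1 K.jk t = K.d1 (\<lambda>s. (1 / w s) *\<^sub>R G.jk s) t"
    by (rule K.D1_cong[OF sm(2) _ t]) (simp add: jerk_rescaled)
  show "K.d1 K.jk t + K.ip t (K.acc t) (K.jk t) *\<^sub>R K.Uf t + (2 * ((G.kap t + u t) / w t)) *\<^sub>R K.jk t = 0"
    unfolding dJ
    unfolding D1_rescaled[OF t] G.D1_scaleR[OF sm(1) G.smooth_jerk t] dw G.D1_jerk[OF t]
      jerk_rescaled[OF t] accel_rescaled[OF t] Uform_rescaled[OF t] form_inner_rescaled[OF t] form_inner_linear form_inner_values[OF t]
      vec_eq_iff
    using W by (simp add: power2_eq_square field_simps)
qed

text \<open>The derivative of u contributes A.\<Upsilon> and the U-component of the derivative of
  \<Upsilon>. The former cancels the cross term in the squared new acceleration, the latter the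
  derivative term in the law for the Rho-tensor.\<close>

lemma chart_obstruction_rescaled:
  assumes t: "t \<in> T"
  shows "K.chart_obstruction t = G.chart_obstruction t / (w t)\<^sup>2"
proof -
  have W: "w t > 0" by (rule w_pos[OF t])
  \<comment> \<open>Clearing the denominator in the law for \<kappa> replaces the quotient rule by
    the product rule.\<close>
  have "G.d0 (\<lambda>s. w s * K.kap s) t = G.d0 (\<lambda>s. G.kap s + u s) t"
    by (rule G.D0_cong[OF _ _ t])
      (use w_pos in \<open>force intro: smooth_intros G.open_T G.smooth_kap smooth_u simp: kap_rescaled\<close>)+
  then have "w t * u t * K.kap t + w t * G.d0 K.kap t = G.d0 G.kap t + G.d0 u t"
    by (simp add: G.D0_mult[OF smooth_w K.smooth_kap t] G.D0_add[OF G.smooth_kap smooth_u t] D0_w[OF t])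
  then have dk: "G.d0 K.kap t = (G.d0 G.kap t + G.d0 u t) / w t - u t * K.kap t"
    using W by (simp add: field_simps)
  show ?thesis
    unfolding K.chart_obstruction_eq[OF t] G.chart_obstruction_eq[OF t] D0_rescaled[OF t] dk kap_rescaled[OF t] D0_u[OF t]
      accel_rescaled[OF t] PU_rescaled[OF t] Uform_rescaled[OF t] form_inner_rescaled[OF t] form_inner_linear form_inner_values[OF t]
    using W by (simp add: power2_eq_square field_simps)
qed

lemma tractor_rescaled:
  assumes t: "t \<in> T"
  shows "quad_rescale g c (\<gamma> t) (w t) (Y t) (G.\<Sigma> t) = w t *\<^sub>R K.\<Sigma> t"
proof -
  have W: "w t > 0" by (rule w_pos[OF t])
  \<comment> \<open>The shift of A by -\<Upsilon> accounts exactly for the added wedge of \<Upsilon>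
    with the first slot; the part of the shift along U wedges to zero.\<close>
  have \<mu>: "wedge (G.Uf t) (G.acc t) + wedge (Y t) (G.Uf t) = wedge (G.Uf t) (K.acc t)"
    by (simp add: accel_rescaled[OF t] wedge_linear wedge_swap[of "Y t"])
  have \<rho>: "G.bottom t + raise g c (\<gamma> t) (Y t) v* wedge (G.Uf t) (G.acc t) - G.kap t *\<^sub>R Y t
      - G.ip t (Y t) (G.Uf t) *\<^sub>R Y t + (1/2 * G.ip t (Y t) (Y t)) *\<^sub>R G.Uf t = w t *\<^sub>R K.bottom t"
    unfolding G.bottom_def K.bottom_def vector_mult_wedge G.raise_ip[OF t] kap_rescaled[OF t] jerk_rescaled[OF t]
      accel_rescaled[OF t] Uform_rescaled[OF t] form_inner_rescaled[OF t] form_inner_linear form_inner_values[OF t] vec_eq_iff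
    using W by (simp add: power2_eq_square field_simps)
  show ?thesis
    unfolding G.tractor_eq[OF t] K.tractor_eq[OF t] quad_rescale.simps \<mu> \<rho> scaleR_Pair
    using W by (simp add: Uform_rescaled[OF t] kap_rescaled[OF t] wedge_linear power2_eq_square form_inner_values[OF t])
qed

end

section \<open>The jerk line\<close>

lemma quad_rescale_scaleR: "quad_rescale g c p w Y (r *\<^sub>R q) = r *\<^sub>R quad_rescale g c p w Y q"
proof (cases q)
  case (fields \<sigma> \<mu> \<nu> \<rho>)
  have "a v* (r *\<^sub>R M) = r *\<^sub>R (a v* M)" for a and M :: "real^2^2"
    by (simp add: vec_eq_iff vector_matrix_mult_def sum_2 algebra_simps)
  then show ?thesis
    unfolding fields scaleR_Pair quad_rescale.simps wedge_linear form_inner_linear by (simp add: algebra_simps)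
qed

lemma quad_pull_scaleR: "quad_pull M (r *\<^sub>R q) = r *\<^sub>R quad_pull M q"
  by (cases q) (simp add: pull1_linear pull2_scaleR)

text \<open>The class is generated from one base metric; multiplying by the square of a positive
  smooth scalar common to all charts preserves every clause of the definition.\<close>

lemma rescaling_riemannian_metric:
  assumes surf: "smooth_surface A" and g: "riemannian_metric A g" and r: "rescaling A \<Omega> g h"
  shows "riemannian_metric A h"
proof -
  have g': "symmetric_tensor2 A g" using g by (simp add: riemannian_metric_def)
  have h: "h c p = (\<Omega> p)\<^sup>2 *\<^sub>R g c p" if "c \<in> A" "p \<in> cdom c" for c p
    using r that by (auto simp: rescaling_def)
  have pos: "\<Omega> p > 0" if "c \<in> A" "p \<in> cdom c" for c p
    using r that by (auto simp: rescaling_def surface_def)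
  have "smooth_on (coord c ` cdom c) (h c \<circ> cinv c)" if c: "c \<in> A" for c
  proof -
    note V = smooth_surfaceD(2)[OF surf c]
    have \<Omega>: "smooth_on (coord c ` cdom c) (\<Omega> \<circ> cinv c)"
      using r c by (simp add: rescaling_def smooth_field_def)
    have "smooth_on (coord c ` cdom c) (\<lambda>y. ((\<Omega> \<circ> cinv c) y)\<^sup>2 *\<^sub>R (g c \<circ> cinv c) y)"
      by (intro smooth_on_scaleR smooth_on_power V \<Omega> symmetric_tensor2D(1)[OF g' c])
    then show ?thesis
      by (rule smooth_on_cong[OF V, rotated]) (use h[OF c] cinv_coord[OF surf c] in auto)
  qed
  moreover have "transpose (h c p) = h c p" if "c \<in> A" "p \<in> cdom c" for c p
    unfolding h[OF that] using symmetric_tensor2D(2)[OF g' that] by (simp add: vec_eq_iff transpose_def)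
  moreover have "h c p = pull2 (transition c d p) (h d p)" if "c \<in> A" "d \<in> A" "p \<in> cdom c \<inter> cdom d" for c d p
    using that symmetric_tensor2D(3)[OF g', of c d p] by (simp add: h pull2_scaleR)
  moreover have "v \<bullet> (h c p *v v) > 0" if "c \<in> A" "p \<in> cdom c" "v \<noteq> 0" for c p v
    using that g pos[of c p] by (simp add: h riemannian_metric_def scaleR_matrix_vector_assoc[symmetric])
  ultimately show ?thesis
    unfolding riemannian_metric_def symmetric_tensor2_def smooth_field_def by blast
qed

text \<open>Members of the class are given by factors relative to the base metric; the quotient of
  two factors relates the members directly.\<close>

lemma rescaling_common:
  assumes surf: "smooth_surface A" and r: "rescaling A \<Omega>1 g g1" "rescaling A \<Omega>2 g g2"
  shows "rescaling A (\<lambda>p. \<Omega>2 p / \<Omega>1 p) g1 g2"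
proof -
  have pos: "\<Omega>1 p > 0" "\<Omega>2 p > 0" if "c \<in> A" "p \<in> cdom c" for c p
    using r that by (auto simp: rescaling_def surface_def)
  have "smooth_on (coord c ` cdom c) ((\<lambda>p. \<Omega>2 p / \<Omega>1 p) \<circ> cinv c)" if c: "c \<in> A" for c
  proof -
    have s: "smooth_on (coord c ` cdom c) (\<Omega>1 \<circ> cinv c)" "smooth_on (coord c ` cdom c) (\<Omega>2 \<circ> cinv c)"
      using r c by (auto simp: rescaling_def smooth_field_def)
    have "smooth_on (coord c ` cdom c) (\<lambda>y. (\<Omega>2 \<circ> cinv c) y / (\<Omega>1 \<circ> cinv c) y)"
      by (rule smooth_on_divide[OF smooth_surfaceD(2)[OF surf c] s(2,1)])
        (use pos[OF c] cinv_coord[OF surf c] in force)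
    then show ?thesis by (simp add: o_def)
  qed
  moreover have "g2 c p = (\<Omega>2 p / \<Omega>1 p)\<^sup>2 *\<^sub>R g1 c p" if "c \<in> A" "p \<in> cdom c" for c p
    using r that pos[OF that] by (simp add: rescaling_def power_divide)
  ultimately show ?thesis
    using r by (simp add: rescaling_def smooth_field_def)
qed

locale moebius_curve =
  fixes A :: "'a::{t2_space,second_countable_topology} chart set"
    and C :: "'a tensor2 set" and P :: "'a tensor2 \<Rightarrow> 'a tensor2"
    and I :: "real set" and \<gamma> :: "real \<Rightarrow> 'a"
  assumes surf: "smooth_surface A" and moebius: "mobius_structure A C P"
    and curve: "smooth_curve A I \<gamma>"
    and jerk_nz: "\<And>g t c. g \<in> C \<Longrightarrow> t \<in> I \<Longrightarrow> c \<in> A \<Longrightarrow> \<gamma> t \<in> cdom c \<Longrightarrow> jerk P \<gamma> g c t \<noteq> 0"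
begin

section \<open>Specialisation to the metrics of the class and the charts of the atlas\<close>

lemma metric:
  assumes "g \<in> C"
  shows "riemannian_metric A g"
proof -
  obtain g0 where "riemannian_metric A g0" "C = {h. \<exists>\<Omega>. rescaling A \<Omega> g0 h}"
    using moebius unfolding mobius_structure_def conformal_class_def by blast
  then show ?thesis using assms rescaling_riemannian_metric[OF surf] by blast
qed

lemma conformal_factor:
  assumes "g \<in> C" "h \<in> C"
  obtains \<Omega> where "rescaling A \<Omega> g h"
proof -
  obtain g0 where "C = {h. \<exists>\<Omega>. rescaling A \<Omega> g0 h}"
    using moebius unfolding mobius_structure_def conformal_class_def by blast
  then show ?thesis using assms rescaling_common[OF surf] that by blast
qed

lemma jerk_curve_C: "g \<in> C \<Longrightarrow> c \<in> A \<Longrightarrow> jerk_curve A I \<gamma> c g P"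
proof -
  assume gc: "g \<in> C" "c \<in> A"
  interpret chart_curve A I \<gamma> c g
    by unfold_locales (use surf curve metric gc in auto)
  show ?thesis
  proof unfold_locales
    show "symmetric_tensor2 A (P g)" using moebius gc unfolding mobius_structure_def by blast
    show "jerk P \<gamma> g c t \<noteq> 0" if "t \<in> T" for t using that gc jerk_nz by (simp add: T_def)
  qed
qed

lemma chart_exists: "t \<in> I \<Longrightarrow> \<exists>c\<in>A. \<gamma> t \<in> cdom c"
  using curve by (auto simp: smooth_curve_def surface_def)

text \<open>Existence in every chart comes from the solution in that chart and its agreement with
  \<open>kap\<close>; uniqueness needs one chart only, where the jerk is nonzero.\<close>

lemma kappa_curve_C:
  assumes gc: "g \<in> C" "c \<in> A"
  shows "kappa_curve A I \<gamma> c g P"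
proof -
  interpret jerk_curve A I \<gamma> c g P by (rule jerk_curve_C[OF gc])
  show ?thesis
  proof unfold_locales
    fix t assume t: "t \<in> T"
    show "kappa A P \<gamma> g t = kap t"
      unfolding kappa_def
    proof (rule the_equality)
      show "\<forall>d\<in>A. \<gamma> t \<in> cdom d \<longrightarrow> D1 \<gamma> g d (jerk P \<gamma> g d) t
        + form_inner g d (\<gamma> t) (accel \<gamma> g d t) (jerk P \<gamma> g d t) *\<^sub>R Uform \<gamma> g d t
        + (2 * kap t) *\<^sub>R jerk P \<gamma> g d t = 0"
      proof (intro ballI impI)
        fix d assume d: "d \<in> A" "\<gamma> t \<in> cdom d"
        interpret D: jerk_curve A I \<gamma> d g P by (rule jerk_curve_C[OF gc(1) d(1)])
        interpret two_jerk_charts A I \<gamma> c d g P by unfold_locales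
        have "t \<in> D.T" using t d(2) by (simp add: T_def D.T_def)
        from D.kap_eq[OF this] kap_chart[OF t this]
        show "D1 \<gamma> g d (jerk P \<gamma> g d) t
          + form_inner g d (\<gamma> t) (accel \<gamma> g d t) (jerk P \<gamma> g d t) *\<^sub>R Uform \<gamma> g d t
          + (2 * kap t) *\<^sub>R jerk P \<gamma> g d t = 0" by simp
      qed
      show "k = kap t" if "\<forall>d\<in>A. \<gamma> t \<in> cdom d \<longrightarrow> D1 \<gamma> g d (jerk P \<gamma> g d) t
        + form_inner g d (\<gamma> t) (accel \<gamma> g d t) (jerk P \<gamma> g d t) *\<^sub>R Uform \<gamma> g d t
        + (2 * k) *\<^sub>R jerk P \<gamma> g d t = 0" for k
        using that gc(2) T_cdom[OF t] by (intro kap_unique[OF t]) blast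
    qed
  qed
qed

lemma conformal_curves_C:
  assumes "g \<in> C" "h \<in> C" "c \<in> A" "rescaling A \<Omega> g h"
  shows "conformal_curves A I \<gamma> c g h P \<Omega>"
proof -
  interpret G: kappa_curve A I \<gamma> c g P by (rule kappa_curve_C[OF assms(1,3)])
  interpret K: kappa_curve A I \<gamma> c h P by (rule kappa_curve_C[OF assms(2,3)])
  show ?thesis
    by unfold_locales (use moebius assms in \<open>auto simp: mobius_structure_def\<close>)
qed

text \<open>The conformal weight of the tractor is absorbed by the speed, which makes this a genuine
  element of the fibre.\<close>

definition X where "X k t = (\<lambda>g c. (k * speed \<gamma> g c t) *\<^sub>R jerk_tractor A P \<gamma> g c t)"

text \<open>In the rescaling law the factor \<Omega> gained by the quadruple turns the speed for g
  into the speed for h. In the chart law the speed is a scalar and the slots pull back.\<close>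

lemma X_fibre:
  assumes t: "t \<in> I"
  shows "X k t \<in> adjoint_fibre A C (\<gamma> t)"
  unfolding adjoint_fibre_def mem_Collect_eq
proof (intro conjI ballI impI allI)
  fix g c assume gc: "g \<in> C" "c \<in> A" "\<gamma> t \<in> cdom c"
  interpret kappa_curve A I \<gamma> c g P by (rule kappa_curve_C[OF gc(1,2)])
  have tT: "t \<in> T" using t gc by (simp add: T_def)
  have "transpose (r *\<^sub>R wedge \<alpha> \<beta>) = - (r *\<^sub>R wedge \<alpha> \<beta>)" for r \<alpha> \<beta>
    using transpose_wedge[of "r *\<^sub>R \<alpha>" \<beta>] by (simp add: wedge_linear)
  then show "case X k t g c of (\<sigma>, \<mu>, \<nu>, \<rho>) \<Rightarrow> transpose \<mu> = - \<mu>"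
    by (simp add: X_def tractor_eq[OF tT])
next
  fix g c d assume gc: "g \<in> C" "c \<in> A" "d \<in> A" "\<gamma> t \<in> cdom c \<inter> cdom d"
  interpret C: kappa_curve A I \<gamma> c g P by (rule kappa_curve_C[OF gc(1,2)])
  interpret D: kappa_curve A I \<gamma> d g P by (rule kappa_curve_C[OF gc(1,3)])
  interpret two_jerk_charts A I \<gamma> c d g P by unfold_locales
  have tT: "t \<in> C.T" "t \<in> D.T" using t gc by (simp_all add: C.T_def D.T_def)
  have "jerk_tractor A P \<gamma> g c t = quad_pull (J (\<gamma> t)) (jerk_tractor A P \<gamma> g d t)"
    by (simp add: C.tractor_eq D.tractor_eq C.bottom_def D.bottom_def tT pull1_linear pull2_wedge
        jerk_chart accel_chart Uform_chart kap_chart form_inner_chart)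
  then show "X k t g c = quad_pull (transition c d (\<gamma> t)) (X k t g d)"
    by (simp add: X_def quad_pull_scaleR speed_chart tT J_def)
next
  fix g h \<Omega> c assume gh: "g \<in> C" "h \<in> C" "rescaling A \<Omega> g h" "c \<in> A" "\<gamma> t \<in> cdom c"
  interpret conformal_curves A I \<gamma> c g h P \<Omega> by (rule conformal_curves_C[OF gh(1,2,4,3)])
  have tT: "t \<in> T" using t gh by (simp add: G.T_def)
  show "X k t h c = quad_rescale g c (\<gamma> t) (\<Omega> (\<gamma> t)) (Upsilon \<Omega> c (\<gamma> t)) (X k t g c)"
    unfolding X_def quad_rescale_scaleR w_def[symmetric] Y_def[symmetric] tractor_rescaled[OF tT] speed_rescaled[OF tT]
    by (simp add: mult.commute mult.left_commute)
qed

text \<open>One multiple has to serve all charts at once; the speed read in any single chart does,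
  as it agrees in all of them.\<close>

lemma X_jerk_line:
  assumes "t \<in> I" "h \<in> C"
  shows "X k t \<in> jerk_line A C P \<gamma> h t"
proof -
  obtain c where c: "c \<in> A" "\<gamma> t \<in> cdom c" using chart_exists[OF assms(1)] by blast
  interpret C: kappa_curve A I \<gamma> c h P by (rule kappa_curve_C[OF assms(2) c(1)])
  have "X k t h d = (k * speed \<gamma> h c t) *\<^sub>R jerk_tractor A P \<gamma> h d t" if d: "d \<in> A" "\<gamma> t \<in> cdom d" for d
  proof -
    interpret D: kappa_curve A I \<gamma> d h P by (rule kappa_curve_C[OF assms(2) d(1)])
    interpret two_jerk_charts A I \<gamma> c d h P by unfold_locales
    show ?thesis
      using speed_chart[of t] assms(1) c d by (simp add: X_def C.T_def D.T_def)
  qed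
  then show ?thesis using X_fibre[OF assms(1)] by (auto simp: jerk_line_def)
qed

text \<open>The law of the fibre determines the h-components from the g-components and multiplies
  the coefficient by \<Omega>. Exchanging the metrics gives the opposite inclusion.\<close>

lemma jerk_line_subset:
  assumes "g \<in> C" "h \<in> C" "t \<in> I"
  shows "jerk_line A C P \<gamma> g t \<subseteq> jerk_line A C P \<gamma> h t"
proof
  fix Z assume Z: "Z \<in> jerk_line A C P \<gamma> g t"
  then obtain r where fib: "Z \<in> adjoint_fibre A C (\<gamma> t)" and
    r: "\<And>c. c \<in> A \<Longrightarrow> \<gamma> t \<in> cdom c \<Longrightarrow> Z g c = r *\<^sub>R jerk_tractor A P \<gamma> g c t"
    by (auto simp: jerk_line_def)
  obtain \<Omega> where \<Omega>: "rescaling A \<Omega> g h" by (rule conformal_factor[OF assms(1,2)])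
  have "Z h c = (r * \<Omega> (\<gamma> t)) *\<^sub>R jerk_tractor A P \<gamma> h c t" if c: "c \<in> A" "\<gamma> t \<in> cdom c" for c
  proof -
    interpret conformal_curves A I \<gamma> c g h P \<Omega> by (rule conformal_curves_C[OF assms(1,2) c(1) \<Omega>])
    have tT: "t \<in> T" using assms c by (simp add: G.T_def)
    have "Z h c = quad_rescale g c (\<gamma> t) (\<Omega> (\<gamma> t)) (Upsilon \<Omega> c (\<gamma> t)) (Z g c)"
      using fib assms c \<Omega> unfolding adjoint_fibre_def by blast
    also have "\<dots> = r *\<^sub>R (w t *\<^sub>R jerk_tractor A P \<gamma> h c t)"
      unfolding r[OF c] quad_rescale_scaleR w_def[symmetric] Y_def[symmetric] tractor_rescaled[OF tT] ..
    finally show ?thesis by (simp add: w_def)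
  qed
  then show "Z \<in> jerk_line A C P \<gamma> h t" using fib by (auto simp: jerk_line_def)
qed

lemma jerk_line_invariant:
  "g \<in> C \<Longrightarrow> h \<in> C \<Longrightarrow> t \<in> I \<Longrightarrow> jerk_line A C P \<gamma> g t = jerk_line A C P \<gamma> h t"
  using jerk_line_subset by blast

section \<open>Preservation of the line and vanishing of the obstruction\<close>

lemma preserved_invariant:
  assumes "g \<in> C" "h \<in> C"
  shows "preserved A C P I \<gamma> h (jerk_line A C P \<gamma> g) = preserved A C P I \<gamma> h (jerk_line A C P \<gamma> h)"
  using jerk_line_invariant[OF assms] by (simp add: preserved_def section_along_def)

text \<open>The quantity E of \<open>chart_obstruction\<close>, stated outside the one-chart locale
  so that metric and chart can vary.\<close>

definition obstruction where
  "obstruction g c t = D0 \<gamma> g c (kappa A P \<gamma> g) t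
    + 1/2 * (form_inner g c (\<gamma> t) (accel \<gamma> g c t) (accel \<gamma> g c t) + (kappa A P \<gamma> g t)\<^sup>2)
    + Uvec \<gamma> g c t \<bullet> (P g c (\<gamma> t) *v Uvec \<gamma> g c t)"

lemma obstruction_invariant:
  assumes "g \<in> C" "h \<in> C" "c \<in> A" "t \<in> I" "\<gamma> t \<in> cdom c"
  shows "obstruction g c t = 0 \<longleftrightarrow> obstruction h c t = 0"
proof -
  obtain \<Omega> where \<Omega>: "rescaling A \<Omega> g h" by (rule conformal_factor[OF assms(1,2)])
  interpret conformal_curves A I \<gamma> c g h P \<Omega> by (rule conformal_curves_C[OF assms(1-3) \<Omega>])
  have tT: "t \<in> T" using assms by (simp add: G.T_def)
  show ?thesis
    using chart_obstruction_rescaled[OF tT] w_pos[OF tT] by (simp add: obstruction_def G.chart_obstruction_def K.chart_obstruction_def)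
qed

text \<open>One nowhere vanishing test section decides: \<open>X 1\<close>, whose coefficient is the
  speed.\<close>

lemma preserved_imp_obstruction:
  assumes h: "h \<in> C" and pres: "preserved A C P I \<gamma> h (jerk_line A C P \<gamma> h)"
    and t: "t \<in> I" and c: "c \<in> A" "\<gamma> t \<in> cdom c"
  shows "obstruction h c t = 0"
proof -
  have "smooth_on {t\<in>I. \<gamma> t \<in> cdom d} (\<lambda>t. X 1 t g d)" if gd: "g \<in> C" "d \<in> A" for g d
  proof -
    interpret kappa_curve A I \<gamma> d g P by (rule kappa_curve_C[OF gd])
    show ?thesis unfolding X_def T_def[symmetric]
      by (intro smooth_intros open_T smooth_tractor smooth_speed)
  qed
  then have "section_along A C I \<gamma> (jerk_line A C P \<gamma> h) (X 1)"
    using X_jerk_line[OF _ h] by (simp add: section_along_def)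
  then obtain Z where Z: "Z \<in> jerk_line A C P \<gamma> h t"
    "\<forall>c\<in>A. \<gamma> t \<in> cdom c \<longrightarrow> Z h c = tractor_deriv P \<gamma> h c (\<lambda>s. X 1 s h c) t"
    using pres t unfolding preserved_def by blast
  from Z(1) obtain r where "\<forall>c\<in>A. \<gamma> t \<in> cdom c \<longrightarrow> Z h c = r *\<^sub>R jerk_tractor A P \<gamma> h c t"
    unfolding jerk_line_def by blast
  then have r: "r *\<^sub>R jerk_tractor A P \<gamma> h c t = tractor_deriv P \<gamma> h c (\<lambda>s. X 1 s h c) t"
    using Z(2) c by simp
  interpret K: kappa_curve A I \<gamma> c h P by (rule kappa_curve_C[OF h c(1)])
  have tT: "t \<in> K.T" using t c by (simp add: K.T_def)
  have "tractor_deriv P \<gamma> h c (\<lambda>s. X 1 s h c) t = (K.d0 K.sp t - K.sp t * K.kap t) *\<^sub>R K.\<Sigma> t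
    + (0, 0, K.sp t * K.chart_obstruction t, (K.sp t * K.chart_obstruction t) *\<^sub>R (K.acc t - K.kap t *\<^sub>R K.Uf t))"
    by (rule K.tractor_deriv_multiple[OF tT K.smooth_speed]) (simp add: X_def)
  \<comment> \<open>The first slot is a multiple of the nonzero covector U on both sides and fixes
    r; the third slot then says that speed times E vanishes.\<close>
  then have eq: "r *\<^sub>R K.Uf t = (K.d0 K.sp t - K.sp t * K.kap t) *\<^sub>R K.Uf t"
    "r * K.kap t = (K.d0 K.sp t - K.sp t * K.kap t) * K.kap t + K.sp t * K.chart_obstruction t"
    unfolding r[symmetric] K.tractor_eq[OF tT] by simp_all
  then have "K.chart_obstruction t = 0" using K.Uform_nonzero[OF tT] K.speed_pos[OF tT] by simp
  then show ?thesis by (simp add: obstruction_def K.chart_obstruction_def)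
qed

text \<open>A section provides its coefficient only pointwise, so smoothness of the coefficient has
  to be recovered before the product rule applies. The resulting multiple must also be realised by
  an actual element of the fibre.\<close>

lemma obstruction_imp_preserved:
  assumes h: "h \<in> C" and obstruction: "\<And>t c. t \<in> I \<Longrightarrow> c \<in> A \<Longrightarrow> \<gamma> t \<in> cdom c \<Longrightarrow> obstruction h c t = 0"
  shows "preserved A C P I \<gamma> h (jerk_line A C P \<gamma> h)"
  unfolding preserved_def
proof (intro allI impI ballI)
  fix S t assume S: "section_along A C I \<gamma> (jerk_line A C P \<gamma> h) S" and t: "t \<in> I"
  have "\<forall>s\<in>I. \<exists>r. \<forall>c\<in>A. \<gamma> s \<in> cdom c \<longrightarrow> S s h c = r *\<^sub>R jerk_tractor A P \<gamma> h c s"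
    using S unfolding section_along_def jerk_line_def by blast
  then obtain r where r: "\<And>s c. s \<in> I \<Longrightarrow> c \<in> A \<Longrightarrow> \<gamma> s \<in> cdom c \<Longrightarrow> S s h c = r s *\<^sub>R jerk_tractor A P \<gamma> h c s"
    by metis
  have deriv: "tractor_deriv P \<gamma> h c (\<lambda>s. S s h c) t
      = (vector_derivative r (at t) / speed \<gamma> h c t - r t * kappa A P \<gamma> h t) *\<^sub>R jerk_tractor A P \<gamma> h c t"
    if c: "c \<in> A" "\<gamma> t \<in> cdom c" for c
  proof -
    interpret K: kappa_curve A I \<gamma> c h P by (rule kappa_curve_C[OF h c(1)])
    have tT: "t \<in> K.T" using t c by (simp add: K.T_def)
    have rT: "S s h c = r s *\<^sub>R K.\<Sigma> s" if "s \<in> K.T" for s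
      using r that c(1) by (simp add: K.T_def)
    have "smooth_on K.T (\<lambda>s. S s h c)"
      using S h c unfolding section_along_def K.T_def by blast
    \<comment> \<open>Pairing the first slot r U with the unit covector U returns r, which thus
      inherits smoothness from the section.\<close>
    then have "smooth_on K.T (\<lambda>s. K.ip s (fst (S s h c)) (K.Uf s))"
      by (intro K.smooth_ip smooth_on_fst K.open_T K.smooth_Uform)
    then have "smooth_on K.T r"
      by (rule smooth_on_cong[OF K.open_T, rotated])
        (simp add: rT K.tractor_eq form_inner_linear K.ip_UU)
    moreover have "K.chart_obstruction t = 0" using obstruction[OF t c] by (simp add: obstruction_def K.chart_obstruction_def)
    ultimately show ?thesis
      using K.tractor_deriv_multiple[OF tT _ rT] K.kappa[OF tT] by (simp add: D0_def zero_prod_def[symmetric])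
  qed
  obtain c0 where c0: "c0 \<in> A" "\<gamma> t \<in> cdom c0" using chart_exists[OF t] by blast
  \<comment> \<open>\<open>X k\<close> already contains a factor of the speed, hence the division.
    The auxiliary chart c0 does not affect k, since the speed is the same in all charts.\<close>
  define k where "k = (vector_derivative r (at t) / speed \<gamma> h c0 t - r t * kappa A P \<gamma> h t) / speed \<gamma> h c0 t"
  interpret C: kappa_curve A I \<gamma> c0 h P by (rule kappa_curve_C[OF h c0(1)])
  have tC: "t \<in> C.T" using t c0 by (simp add: C.T_def)
  have "X k t h c = tractor_deriv P \<gamma> h c (\<lambda>s. S s h c) t" if c: "c \<in> A" "\<gamma> t \<in> cdom c" for c
  proof -
    interpret D: kappa_curve A I \<gamma> c h P by (rule kappa_curve_C[OF h c(1)])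
    interpret two_jerk_charts A I \<gamma> c0 c h P by unfold_locales
    have "speed \<gamma> h c t = speed \<gamma> h c0 t"
      using speed_chart[OF tC] t c by (simp add: D.T_def)
    then show ?thesis
      using C.speed_pos[OF tC] by (simp add: deriv[OF c] X_def k_def)
  qed
  then show "\<exists>Z\<in>jerk_line A C P \<gamma> h t. \<forall>c\<in>A. \<gamma> t \<in> cdom c \<longrightarrow>
      Z h c = tractor_deriv P \<gamma> h c (\<lambda>s. S s h c) t"
    using X_jerk_line[OF t h] by blast
qed

end

theorem theorem4:
  fixes A :: "'a::{t2_space,second_countable_topology} chart set"
    and C :: "'a tensor2 set"
    and P :: "'a tensor2 \<Rightarrow> 'a tensor2"
    and I :: "real set"
    and \<gamma> :: "real \<Rightarrow> 'a"
  assumes "smooth_surface A"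
    and "mobius_structure A C P"
    and "smooth_curve A I \<gamma>"
    and "\<forall>g\<in>C. \<forall>t\<in>I. \<forall>c\<in>A. \<gamma> t \<in> cdom c \<longrightarrow> jerk P \<gamma> g c t \<noteq> 0"
  shows "\<forall>g\<in>C. \<forall>h\<in>C.
    (\<forall>t\<in>I. jerk_line A C P \<gamma> g t = jerk_line A C P \<gamma> h t) \<and>
    (preserved A C P I \<gamma> h (jerk_line A C P \<gamma> g) \<longleftrightarrow>
      (\<forall>t\<in>I. \<forall>c\<in>A. \<gamma> t \<in> cdom c \<longrightarrow>
         D0 \<gamma> g c (kappa A P \<gamma> g) t
         + 1/2 * (form_inner g c (\<gamma> t) (accel \<gamma> g c t) (accel \<gamma> g c t) + (kappa A P \<gamma> g t)\<^sup>2)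
         + Uvec \<gamma> g c t \<bullet> (P g c (\<gamma> t) *v Uvec \<gamma> g c t) = 0))"
proof (intro ballI conjI)
  interpret moebius_curve A C P I \<gamma>
    using assms by unfold_locales auto
  fix g h assume gh: "g \<in> C" "h \<in> C"
  show "jerk_line A C P \<gamma> g t = jerk_line A C P \<gamma> h t" if "t \<in> I" for t
    by (rule jerk_line_invariant[OF gh that])
  show "preserved A C P I \<gamma> h (jerk_line A C P \<gamma> g) \<longleftrightarrow>
      (\<forall>t\<in>I. \<forall>c\<in>A. \<gamma> t \<in> cdom c \<longrightarrow>
         D0 \<gamma> g c (kappa A P \<gamma> g) t
         + 1/2 * (form_inner g c (\<gamma> t) (accel \<gamma> g c t) (accel \<gamma> g c t) + (kappa A P \<gamma> g t)\<^sup>2)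
         + Uvec \<gamma> g c t \<bullet> (P g c (\<gamma> t) *v Uvec \<gamma> g c t) = 0)"
    \<comment> \<open>The line is moved to the metric h used for differentiation, and the resulting
      equation is carried back to g by the conformal covariance of E.\<close>
    unfolding preserved_invariant[OF gh] obstruction_def[symmetric]
    using preserved_imp_obstruction[OF gh(2)] obstruction_imp_preserved[OF gh(2)] obstruction_invariant[OF gh] by blast
qed

end
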